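(* Given an unweighted graph $G$ on $n$ vertices and a parameter $r\in\{1,2,\ldots,\log n\}$, it is possible to find a minimum cut of $G$ using $\tilde{O}(r n^{1+1/r}\delta(G)^{-1/r})$ cut queries in $2r+1$ rounds. The algorithm is randomized and succeeds with probability $1-n^{-1}$.
   Context: Cut-query model: the input is a graph $G=(V,E,w)$ with $n=|V|$ and edge weights $w(e)>0$ (unweighted means $w\equiv 1$), accessed only via queries returning $\mathrm{cut}_G(S)=\sum_{e\in E:\,|e\cap S|=1} w(e)$ for a given $S\subseteq V$. An algorithm has round complexity $r$ if its queries are issued in $r$ rounds, queries of round $t$ depending only on answers from earlier rounds. $\delta(G)$ denotes the minimum degree of $G$. Finding a minimum cut means outputting a set $\emptyset\ne S\subsetneq V$ minimizing $\mathrm{cut}_G(S)$ and its value. $\tilde{O}(\cdot)$ hides factors polylogarithmic in $n$. *)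

theory Defs
  imports "HOL-Probability.Probability"
begin

definition simple_graph :: "'a set \<Rightarrow> 'a set set \<Rightarrow> bool" where
  "simple_graph V E \<longleftrightarrow> finite V \<and> (\<forall>e\<in>E. e \<subseteq> V \<and> card e = 2)"

definition cut_value :: "'a set set \<Rightarrow> ('a set \<Rightarrow> real) \<Rightarrow> 'a set \<Rightarrow> real" where
  "cut_value E w S = (\<Sum>e | e \<in> E \<and> card (e \<inter> S) = 1. w e)"

abbreviation unit_weight :: "'a set \<Rightarrow> real" where
  "unit_weight \<equiv> (\<lambda>_. 1)"

definition vertex_degree :: "'a set set \<Rightarrow> 'a \<Rightarrow> nat" where
  "vertex_degree E v = card {e \<in> E. v \<in> e}"

definition min_degree :: "'a set \<Rightarrow> 'a set set \<Rightarrow> nat" where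
  "min_degree V E = Min (vertex_degree E ` V)"

definition is_min_cut :: "'a set \<Rightarrow> 'a set set \<Rightarrow> ('a set \<Rightarrow> real) \<Rightarrow> 'a set \<times> real \<Rightarrow> bool" where
  "is_min_cut V E w = (\<lambda>(S, c).
     S \<noteq> {} \<and> S \<subset> V \<and> c = cut_value E w S \<and>
     (\<forall>T. T \<noteq> {} \<and> T \<subset> V \<longrightarrow> cut_value E w S \<le> cut_value E w T))"

text \<open>
  A deterministic algorithm either stops with an output or issues one round, i.e. a finite list
  of queries, and continues depending on the list of answers. Computation between the rounds is
  unrestricted. A randomized algorithm is a discrete probability distribution over deterministic
  algorithms: the random bits are drawn in advance and may be used in any round.
\<close>

datatype ('a, 'o) query_algorithm =
    Output 'o
  | Round "'a set list" "real list \<Rightarrow> ('a, 'o) query_algorithm"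

type_synonym ('a, 'o) randomized_algorithm = "('a, 'o) query_algorithm pmf"

text \<open>
  Execution against an oracle: the final output, and the list of rounds, each given by its list
  of queries.
\<close>

primrec result :: "('a set \<Rightarrow> real) \<Rightarrow> ('a, 'o) query_algorithm \<Rightarrow> 'o" where
  "result q (Output x) = x"
| "result q (Round Q f) = result q (f (map q Q))"

primrec rounds :: "('a set \<Rightarrow> real) \<Rightarrow> ('a, 'o) query_algorithm \<Rightarrow> 'a set list list" where
  "rounds q (Output x) = []"
| "rounds q (Round Q f) = Q # rounds q (f (map q Q))"

definition num_rounds :: "('a set \<Rightarrow> real) \<Rightarrow> ('a, 'o) query_algorithm \<Rightarrow> nat" where
  "num_rounds q a = length (rounds q a)"

definition num_queries :: "('a set \<Rightarrow> real) \<Rightarrow> ('a, 'o) query_algorithm \<Rightarrow> nat" where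
  "num_queries q a = length (concat (rounds q a))"

definition queries :: "('a set \<Rightarrow> real) \<Rightarrow> ('a, 'o) query_algorithm \<Rightarrow> 'a set set" where
  "queries q a = set (concat (rounds q a))"

end

(* The number |E(v, U)| of edges between a vertex and a set is obtained from three cut queries, so
   rows of the adjacency matrix can be measured linearly in one round. Measuring parities of random
   pair sets and adding them over a vertex set A gives the parity of the boundary of A, since inner
   edges count twice: these are the graph sketches of Ahn, Guha and McGregor. They give an algorithm
   with three rounds and n polylog n queries for every r, which suffices since (n / delta)^(1/r) is
   at least 1.

   Round 1 reads the degrees. In round 2 (repeated O(log n) times in parallel) every vertex picks a
   random neighbour in a random set of about n log n / delta centers; contracting the picks leaves
   few blocks. Fix a minimum cut, where no minimum cut separates a single vertex. No vertex has most
   of its edges in this cut, so no pick crosses it with constant probability. The components of G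
   sampled at rate 1 / (8 delta) are found by Boruvka steps on the sketches and contracted too. They
   avoid the cut with constant probability, and by the lemma of Karger, Klein and Tarjan only
   O(n log n) edges remain between the blocks. Round 3 learns all cuts of this sparse quotient:
   O(n polylog n) fixed unions of blocks separate all sparse quotients, since a random union
   separates two of them with probability at least 1/4. *)
theory Submission
  imports Defs
begin

section \<open>Random subsets\<close>

text \<open>Why the picks miss the cut: let d be the minimum degree. Each vertex has at least d/2
  neighbours on its own side, while the crossing edges have at most 2d endpoints in all, so the
  probability that no pick crosses is at least a product of factors exp(- c_v / b_v) whose exponents
  add up to O(1). Centers sampled at rate p must keep these ratios, hence p d is of order log n
  unless p = 1. Then O(p n) blocks remain, and sampling edges at rate 1 / (8 d) leaves O(d p n) =
  O(n log n) edges between them.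

  The obstacle is adaptivity: the components met by the Boruvka steps depend on earlier
  measurements, yet all sketches are asked in one round. So parities are recorded per vertex and
  added afterwards, every step has its own sample of pair sets, and the parities, which all steps
  share, are justified by comparison with an error-free run whose components do not depend on them.
  Round 3 must serve every sparse graph on the known blocks, so its queries come from a counting
  argument.\<close>

definition random_subset :: "'a set \<Rightarrow> real \<Rightarrow> 'a set pmf" where
  "random_subset A p = map_pmf (\<lambda>f. {x\<in>A. f x}) (Pi_pmf A False (\<lambda>_. bernoulli_pmf p))"

lemma set_random_subset: "set_pmf (random_subset A p) \<subseteq> Pow A"
  by (auto simp: random_subset_def)

lemma finite_set_random_subset: "finite A \<Longrightarrow> finite (set_pmf (random_subset A p))"
  using set_random_subset by (metis finite_Pow_iff finite_subset)

lemma card_insert_random_subset: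
  assumes "finite A" "x \<notin> A" "X \<in> set_pmf (random_subset A p)"
  shows "card (insert x X) = Suc (card X)"
proof -
  have "X \<subseteq> A" using assms(3) set_random_subset by blast
  then show ?thesis
    using assms by (metis card_insert_disjoint finite_subset subsetD)
qed

lemma random_subset_empty [simp]: "random_subset {} p = return_pmf {}"
  by (simp add: random_subset_def)

lemma random_subset_insert:
  assumes "finite A" "x \<notin> A"
  shows "random_subset (insert x A) p =
    bind_pmf (bernoulli_pmf p) (\<lambda>b. map_pmf (\<lambda>X. if b then insert x X else X) (random_subset A p))"
proof -
  have *: "{y. (y = x \<longrightarrow> b) \<and> (y \<noteq> x \<longrightarrow> y \<in> A \<and> f y)} =
      (if b then insert x {y\<in>A. f y} else {y\<in>A. f y})" for f b
    using assms by auto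
  show ?thesis
    unfolding random_subset_def
    apply (subst Pi_pmf_insert'[OF assms])
    apply (simp add: map_bind_pmf map_pmf_comp o_def bind_return_pmf)
    apply (simp add: map_pmf_def bind_assoc_pmf bind_return_pmf *)
    done
qed

lemma random_subset_Int:
  assumes "finite A" "B \<subseteq> A"
  shows "map_pmf (\<lambda>X. X \<inter> B) (random_subset A p) = random_subset B p"
proof -
  have *: "{x \<in> A. f x} \<inter> B = {x \<in> B. if x \<in> B then f x else False}" for f
    using assms by auto
  show ?thesis
    unfolding random_subset_def
    by (subst Pi_pmf_subset[OF assms]) (simp add: map_pmf_comp o_def *)
qed

lemma expectation_random_subset_insert:
  fixes g :: "'a set \<Rightarrow> real"
  assumes "finite A" "x \<notin> A" "0 \<le> p" "p \<le> 1"
  shows "measure_pmf.expectation (random_subset (insert x A) p) g =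
    p * measure_pmf.expectation (random_subset A p) (\<lambda>X. g (insert x X)) +
    (1 - p) * measure_pmf.expectation (random_subset A p) g"
  unfolding random_subset_insert[OF assms(1,2)]
  apply (subst pmf_expectation_bind[where A = UNIV])
  using assms finite_set_random_subset[OF assms(1)] by (auto simp: UNIV_bool)

lemma prob_random_subset_insert:
  assumes "finite A" "x \<notin> A" "0 \<le> p" "p \<le> 1"
  shows "measure_pmf.prob (random_subset (insert x A) p) {X. Q X} =
    p * measure_pmf.prob (random_subset A p) {X. Q (insert x X)} +
    (1 - p) * measure_pmf.prob (random_subset A p) {X. Q X}"
proof -
  have *: "(\<lambda>X. indicator {X. Q X} (insert x X) :: real) = indicator {X. Q (insert x X)}"
    by (auto simp: indicator_def)
  show ?thesis
    using expectation_random_subset_insert[OF assms, of "indicator {X. Q X}"]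
    by (simp add: * )
qed

lemma prob_random_subset_Int:
  assumes "finite A" "B \<subseteq> A"
  shows "measure_pmf.prob (random_subset A p) {X. Q (X \<inter> B)} = measure_pmf.prob (random_subset B p) {X. Q X}"
  by (simp flip: random_subset_Int[OF assms] add: vimage_def)

lemma expectation_random_subset_Int:
  fixes g :: "'a set \<Rightarrow> real"
  assumes "finite A" "B \<subseteq> A"
  shows "measure_pmf.expectation (random_subset A p) (\<lambda>X. g (X \<inter> B)) = measure_pmf.expectation (random_subset B p) g"
  by (simp flip: random_subset_Int[OF assms])

lemma prob_random_subset_empty:
  assumes "finite M" "0 \<le> p" "p \<le> 1"
  shows "measure_pmf.prob (random_subset M p) {X. X = {}} = (1 - p) ^ card M"
  using assms(1)
proof (induction M)
  case (insert x M)
  show ?case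
    using insert assms prob_random_subset_insert[of M x p "\<lambda>X. X = {}"] by simp
qed simp

lemma prob_random_subset_singleton:
  assumes "finite M" "0 \<le> p" "p \<le> 1" "u \<in> M"
  shows "measure_pmf.prob (random_subset M p) {X. X = {u}} = p * (1 - p) ^ (card M - 1)"
proof -
  let ?M = "M - {u}"
  have M: "M = insert u ?M" using assms by auto
  have 1: "measure_pmf.prob (random_subset ?M p) {X. insert u X = {u}} =
     measure_pmf.prob (random_subset ?M p) {X. X = {}}"
    using set_random_subset[of ?M p] by (intro measure_prob_cong_0) (auto simp: set_pmf_eq)
  have 2: "measure_pmf.prob (random_subset ?M p) {X. X = {u}} = 0"
    using set_random_subset[of ?M p] by (auto simp: measure_pmf_zero_iff)
  show ?thesis
    using assms prob_random_subset_insert[of ?M u p "\<lambda>X. X = {u}"] M 1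
      prob_random_subset_empty[of ?M p] 2
    by simp
qed

text \<open>The other elements may be fixed: adding one element u swaps the parities, so the fair
  coin of u alone balances them.\<close>

lemma prob_random_subset_even:
  assumes "finite M" "M \<noteq> {}"
  shows "measure_pmf.prob (random_subset M (1/2)) {X. even (card X)} = 1/2"
proof -
  obtain u where u: "u \<in> M" using assms by auto
  let ?M = "M - {u}"
  have M: "M = insert u ?M" using u by auto
  have 1: "measure_pmf.prob (random_subset ?M (1/2)) {X. even (card (insert u X))} =
     measure_pmf.prob (random_subset ?M (1/2)) (- {X. even (card X)})"
    using assms(1) card_insert_random_subset[of ?M u _ "1/2"]
    by (intro measure_prob_cong_0) (simp_all add: set_pmf_eq, (metis even_Suc)+)
  have 2: "measure_pmf.prob (random_subset ?M (1/2)) (- {X. even (card X)}) =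
     1 - measure_pmf.prob (random_subset ?M (1/2)) {X. even (card X)}"
    using measure_pmf.prob_compl[of "{X. even (card X)}" "random_subset ?M (1/2)"] by (simp add: Compl_eq_Diff_UNIV)
  show ?thesis
    using prob_random_subset_insert[of ?M u "1/2" "\<lambda>X. even (card X)"] M 1 2 assms
    by (simp add: field_simps)
qed

lemma expectation_card_random_subset:
  assumes "finite M" "0 \<le> p" "p \<le> 1"
  shows "measure_pmf.expectation (random_subset M p) (\<lambda>X. real (card X)) = p * card M"
  using assms(1)
proof (induction M)
  case (insert x M)
  have 1: "measure_pmf.expectation (random_subset M p) (\<lambda>X. real (card (insert x X))) =
     measure_pmf.expectation (random_subset M p) (\<lambda>X. 1 + real (card X))"
    using insert.hyps
    by (intro integral_cong_AE) (auto simp: AE_measure_pmf_iff card_insert_random_subset)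
  show ?case
    using insert assms finite_set_random_subset[of M p]
    apply (subst expectation_random_subset_insert)
    apply (auto simp: 1 integrable_measure_pmf_finite)
    apply (simp add: algebra_simps)
    done
qed simp

text \<open>The generating function of the binomial distribution at 1/2, needed for the lower tail
  bound \<open>prob_few_neighbours\<close>.\<close>

lemma expectation_half_power_random_subset:
  assumes "finite M" "0 \<le> p" "p \<le> 1"
  shows "measure_pmf.expectation (random_subset M p) (\<lambda>X. (1/2) ^ card X) = (1 - p / 2) ^ card M"
  using assms(1)
proof (induction M)
  case (insert x M)
  have 1: "measure_pmf.expectation (random_subset M p) (\<lambda>X. (1/2) ^ card (insert x X)) =
     measure_pmf.expectation (random_subset M p) (\<lambda>X. (1/2) ^ card X / 2 :: real)"
    using insert.hyps
    by (intro integral_cong_AE) (auto simp: AE_measure_pmf_iff card_insert_random_subset)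
  show ?case
    using insert assms
    by (subst expectation_random_subset_insert) (simp_all only: 1, simp_all add: algebra_simps)
qed simp

section \<open>Components and contraction\<close>

definition pairs :: "'a set \<Rightarrow> 'a set set" where
  "pairs V = {e. e \<subseteq> V \<and> card e = 2}"

definition boundary :: "'a set set \<Rightarrow> 'a set \<Rightarrow> 'a set set" where
  "boundary E S = {e \<in> E. card (e \<inter> S) = 1}"

lemma cut_value_unit: "cut_value E unit_weight S = real (card (boundary E S))"
  by (simp add: cut_value_def boundary_def)

lemma simple_graph_iff: "simple_graph V E \<longleftrightarrow> finite V \<and> E \<subseteq> pairs V"
  by (auto simp: simple_graph_def pairs_def)

lemma finite_pairs: "finite V \<Longrightarrow> finite (pairs V)"
  by (auto simp: pairs_def intro: finite_subset[of _ "Pow V"])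

lemma pairsE:
  assumes "e \<in> pairs V"
  obtains u v where "e = {u, v}" "u \<noteq> v" "u \<in> V" "v \<in> V"
  using assms by (auto simp: pairs_def card_2_iff)

lemma doubleton_in_pairs [simp]: "{u, v} \<in> pairs V \<longleftrightarrow> u \<noteq> v \<and> u \<in> V \<and> v \<in> V"
  by (auto simp: pairs_def card_2_iff doubleton_eq_iff)

lemma card_pairs_le:
  assumes "finite V"
  shows "card (pairs V) \<le> card V ^ 2"
proof -
  have "pairs V \<subseteq> (\<lambda>(u, v). {u, v}) ` (V \<times> V)"
    by (auto elim!: pairsE)
  then have "card (pairs V) \<le> card (V \<times> V)"
    using assms by (meson card_image_le card_mono finite_SigmaI finite_imageI le_trans)
  then show ?thesis by (simp add: power2_eq_square card_cartesian_product)
qed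

lemma card_doubleton_Int: "u \<noteq> v \<Longrightarrow> card ({u, v} \<inter> S) = 1 \<longleftrightarrow> (u \<in> S) \<noteq> (v \<in> S)"
  by (cases "u \<in> S"; cases "v \<in> S") (auto simp: Int_insert_left)

lemma doubleton_in_boundary [simp]:
  "u \<noteq> v \<Longrightarrow> {u, v} \<in> boundary E S \<longleftrightarrow> {u, v} \<in> E \<and> (u \<in> S) \<noteq> (v \<in> S)"
  unfolding boundary_def using card_doubleton_Int[of u v S] by auto

lemma boundary_subset: "boundary E S \<subseteq> E"
  by (auto simp: boundary_def)

lemma boundary_Int: "boundary (E \<inter> P) S = boundary E S \<inter> P"
  by (auto simp: boundary_def)

section \<open>Connected components and the multigraph of their blocks\<close>

definition adj :: "'a set set \<Rightarrow> ('a \<times> 'a) set" where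
  "adj F = {(u, v). {u, v} \<in> F}"

definition comp_of :: "'a set \<Rightarrow> 'a set set \<Rightarrow> 'a \<Rightarrow> 'a set" where
  "comp_of V F v = {u \<in> V. (v, u) \<in> (adj F)\<^sup>*}"

definition comps :: "'a set \<Rightarrow> 'a set set \<Rightarrow> 'a set set" where
  "comps V F = comp_of V F ` V"

lemma adj_rtrancl_sym: "(u, v) \<in> (adj F)\<^sup>* \<Longrightarrow> (v, u) \<in> (adj F)\<^sup>*"
proof -
  have "sym (adj F)" by (auto simp: adj_def sym_def insert_commute)
  then show "(u, v) \<in> (adj F)\<^sup>* \<Longrightarrow> (v, u) \<in> (adj F)\<^sup>*"
    by (meson symD sym_rtrancl)
qed

lemma comp_of_self: "v \<in> V \<Longrightarrow> v \<in> comp_of V F v"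
  by (simp add: comp_of_def)

lemma comp_of_eqI: "(u, v) \<in> (adj F)\<^sup>* \<Longrightarrow> comp_of V F u = comp_of V F v"
  unfolding comp_of_def using adj_rtrancl_sym[of u v F] by (auto intro: rtrancl_trans)

lemma comp_of_eq_iff: "v \<in> V \<Longrightarrow> comp_of V F u = comp_of V F v \<longleftrightarrow> (u, v) \<in> (adj F)\<^sup>*"
  using comp_of_eqI[of u v F V] comp_of_self[of v V F] by (auto simp: comp_of_def)

lemma comp_of_eq_edge: "{u, v} \<in> F \<Longrightarrow> comp_of V F u = comp_of V F v"
  by (rule comp_of_eqI) (auto simp: adj_def)

lemma compsD:
  assumes "A \<in> comps V F" "x \<in> A"
  shows "A = comp_of V F x"
proof -
  obtain v where "A = comp_of V F v" using assms(1) by (auto simp: comps_def)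
  moreover then have "(v, x) \<in> (adj F)\<^sup>*" using assms(2) by (simp add: comp_of_def)
  ultimately show ?thesis using comp_of_eqI by metis
qed

lemma comps_subset: "A \<in> comps V F \<Longrightarrow> A \<subseteq> V"
  by (auto simp: comps_def comp_of_def)

lemma comps_disjoint: "A \<in> comps V F \<Longrightarrow> B \<in> comps V F \<Longrightarrow> A \<noteq> B \<Longrightarrow> A \<inter> B = {}"
  using compsD[of A V F] compsD[of B V F] by (metis disjoint_iff)

lemma comp_of_in_comps: "v \<in> V \<Longrightarrow> comp_of V F v \<in> comps V F"
  by (simp add: comps_def)

lemma finite_comps: "finite V \<Longrightarrow> finite (comps V F)"
  by (simp add: comps_def)

lemma card_comps_le: "finite V \<Longrightarrow> card (comps V F) \<le> card V"
  by (simp add: comps_def card_image_le)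

lemma adj_rtrancl_mono: "F \<subseteq> F' \<Longrightarrow> (adj F)\<^sup>* \<subseteq> (adj F')\<^sup>*"
  by (intro rtrancl_mono) (auto simp: adj_def)

lemma adj_rtrancl_closed:
  assumes "F \<subseteq> pairs V" "boundary F S = {}" "(u, v) \<in> (adj F)\<^sup>*"
  shows "u \<in> S \<longleftrightarrow> v \<in> S"
  using assms(3)
proof (induction rule: rtrancl_induct)
  case (step y z)
  then have "{y, z} \<in> F" by (simp add: adj_def)
  moreover from this assms(1) have "{y, z} \<in> pairs V" by blast
  then have "y \<noteq> z" by simp
  ultimately have "y \<in> S \<longleftrightarrow> z \<in> S" using assms(2) doubleton_in_boundary[of y z F S] by auto
  with step show ?case by simp
qed simp

text \<open>This is how a cut survives contraction: if no contracted edge crosses it, no path of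
  contracted edges does, and its value can be read off the quotient.\<close>

lemma Union_comps_closed:
  assumes "F \<subseteq> pairs V" "boundary F S = {}" "S \<subseteq> V"
  shows "\<exists>U \<subseteq> comps V F. S = \<Union>U"
proof -
  have "S = \<Union> (comp_of V F ` S)"
  proof
    show "S \<subseteq> \<Union> (comp_of V F ` S)" using assms(3) comp_of_self[of _ V F] by blast
    show "\<Union> (comp_of V F ` S) \<subseteq> S"
      using adj_rtrancl_closed[OF assms(1,2)] by (auto simp: comp_of_def)
  qed
  moreover have "comp_of V F ` S \<subseteq> comps V F" using assms(3) by (auto simp: comps_def)
  ultimately show ?thesis by metis
qed

text \<open>The edges of the multigraph obtained by contracting the components of F, kept as members
  of E with their multiplicity. In this form the set is visibly the union of the boundaries of the
  blocks.\<close>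

definition inter_edges :: "'a set \<Rightarrow> 'a set set \<Rightarrow> 'a set set \<Rightarrow> 'a set set" where
  "inter_edges V E F = {e \<in> E. \<exists>A \<in> comps V F. card (e \<inter> A) = 1}"

lemma inter_edges_subset: "inter_edges V E F \<subseteq> E"
  by (auto simp: inter_edges_def)

lemma doubleton_in_inter_edges:
  assumes "u \<noteq> v" "u \<in> V" "v \<in> V"
  shows "{u, v} \<in> inter_edges V E F \<longleftrightarrow> {u, v} \<in> E \<and> comp_of V F u \<noteq> comp_of V F v"
proof -
  have "(\<exists>A \<in> comps V F. (u \<in> A) \<noteq> (v \<in> A)) \<longleftrightarrow> comp_of V F u \<noteq> comp_of V F v"
    using assms compsD[of _ V F] comp_of_self[of _ V F] comp_of_in_comps[of _ V F] by metis
  then show ?thesis unfolding inter_edges_def by (simp add: card_doubleton_Int[OF assms(1)] del: One_nat_def)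
qed

lemma inter_edges_antimono:
  assumes "E \<subseteq> pairs V" "(adj F)\<^sup>* \<subseteq> (adj F')\<^sup>*"
  shows "inter_edges V E F' \<subseteq> inter_edges V E F"
proof
  fix e assume e: "e \<in> inter_edges V E F'"
  then have "e \<in> pairs V" using assms(1) inter_edges_subset by blast
  then obtain u v where uv: "e = {u, v}" "u \<noteq> v" "u \<in> V" "v \<in> V" by (rule pairsE)
  with e show "e \<in> inter_edges V E F" using assms(2) by (auto simp: doubleton_in_inter_edges comp_of_eq_iff)
qed

text \<open>Gives a well-defined surjection from the finer components onto the coarser ones; all
  counts of components below compare domain and image of this map.\<close>

lemma comps_coarsen:
  assumes "(adj F)\<^sup>* \<subseteq> (adj F')\<^sup>*" "x \<in> V"
  shows "(\<Union>y\<in>comp_of V F x. comp_of V F' y) = comp_of V F' x"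
proof -
  have "comp_of V F' y = comp_of V F' x" if "y \<in> comp_of V F x" for y
    using that assms(1) comp_of_eqI[of x y F' V] by (auto simp: comp_of_def)
  then have "(\<Union>y\<in>comp_of V F x. comp_of V F' y) = (\<Union>y\<in>comp_of V F x. comp_of V F' x)" by simp
  then show ?thesis using comp_of_self[OF assms(2), of F] by auto
qed

text \<open>The components of u and v have the same image under the coarsening map, so that map is
  not injective.\<close>

lemma comps_insert_less:
  assumes "finite V" "u \<in> V" "v \<in> V" "comp_of V F u \<noteq> comp_of V F v"
  shows "card (comps V (insert {u, v} F)) < card (comps V F)"
proof -
  let ?F = "insert {u, v} F"
  define g where "g A = (\<Union>y\<in>A. comp_of V ?F y)" for A
  have mono: "(adj F)\<^sup>* \<subseteq> (adj ?F)\<^sup>*" by (rule adj_rtrancl_mono) auto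
  have g: "g (comp_of V F x) = comp_of V ?F x" if "x \<in> V" for x
    using comps_coarsen[OF mono that] by (simp add: g_def)
  have img: "comps V ?F = g ` comps V F"
    unfolding comps_def image_image using g by (intro image_cong) auto
  have "\<not> inj_on g (comps V F)"
  proof
    assume "inj_on g (comps V F)"
    moreover have "g (comp_of V F u) = g (comp_of V F v)"
      using g assms comp_of_eq_edge[of u v ?F V] by simp
    ultimately show False using assms by (simp add: inj_on_def comp_of_in_comps)
  qed
  then show ?thesis unfolding img
    using finite_comps[OF assms(1), of F] by (metis card_image_le eq_card_imp_inj_on le_neq_implies_less)
qed

lemma comps_insert_le:
  assumes "finite V"
  shows "card (comps V (insert e F)) \<le> card (comps V F)"
proof -
  let ?F = "insert e F"
  define g where "g A = (\<Union>y\<in>A. comp_of V ?F y)" for A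
  have mono: "(adj F)\<^sup>* \<subseteq> (adj ?F)\<^sup>*" by (rule adj_rtrancl_mono) auto
  have g: "g (comp_of V F x) = comp_of V ?F x" if "x \<in> V" for x
    using comps_coarsen[OF mono that] by (simp add: g_def)
  have img: "comps V ?F = g ` comps V F"
    unfolding comps_def image_image using g by (intro image_cong) auto
  then show ?thesis using finite_comps[OF assms, of F] by (simp add: card_image_le)
qed

text \<open>Counting over the fibres of g: a fibre holds two elements of X, or else its element lies
  in U and is counted a second time there.\<close>

lemma card_image_halving:
  assumes "finite X" "Y \<subseteq> g ` X" "U \<subseteq> X"
    and "\<And>x. x \<in> X - U \<Longrightarrow> \<exists>x'\<in>X. x' \<noteq> x \<and> g x' = g x"
  shows "2 * card Y \<le> card X + card U"
proof -
  have fin: "finite Y" "finite (g ` X)" "finite U"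
    using assms by (auto intro: finite_subset)
  have fiber: "2 \<le> card {x\<in>X. g x = y} + card {x\<in>U. g x = y}" if "y \<in> g ` X" for y
  proof -
    obtain x where x: "x \<in> X" "g x = y" using \<open>y \<in> g ` X\<close> by auto
    show ?thesis
    proof (cases "x \<in> U")
      case True
      then have "{x\<in>X. g x = y} \<noteq> {}" "{x\<in>U. g x = y} \<noteq> {}" using x by auto
      then have "card {x\<in>X. g x = y} > 0" "card {x\<in>U. g x = y} > 0"
        using assms(1) fin by (auto simp: card_gt_0_iff)
      then show ?thesis by linarith
    next
      case False
      then obtain x' where "x' \<in> X" "x' \<noteq> x" "g x' = g x" using assms(4) x by blast
      then have "{x, x'} \<subseteq> {x\<in>X. g x = y}" using x by auto
      then have "card {x, x'} \<le> card {x\<in>X. g x = y}" using assms(1) by (intro card_mono) auto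
      then show ?thesis using \<open>x' \<noteq> x\<close> by auto
    qed
  qed
  have "2 * card Y \<le> 2 * card (g ` X)" using assms fin by (simp add: card_mono)
  also have "\<dots> = (\<Sum>y\<in>g ` X. 2)" by simp
  also have "\<dots> \<le> (\<Sum>y\<in>g ` X. card {x\<in>X. g x = y} + card {x\<in>U. g x = y})"
    by (intro sum_mono fiber)
  also have "\<dots> = (\<Sum>y\<in>g ` X. \<Sum>x\<in>{x\<in>X. g x = y}. 1) + (\<Sum>y\<in>g ` X. \<Sum>x\<in>{x\<in>U. g x = y}. 1)"
    by (simp add: sum.distrib)
  also have "\<dots> = card X + card U"
    using assms(1,3) fin by (subst (1 2) sum.group) auto
  finally show ?thesis .
qed

text \<open>
  Below fn A X e stands for: e is the only edge of X on the boundary of A. The analysis uses the exact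
  predicate \<open>isolates\<close>, the algorithm its test by parities, \<open>detects\<close>.
\<close>

definition boruvka_step ::
    "'a set \<Rightarrow> ('a set \<Rightarrow> 'a set set \<Rightarrow> 'a set \<Rightarrow> bool) \<Rightarrow> 'a set set \<Rightarrow> 'a set set set \<Rightarrow> 'a set set \<Rightarrow> 'a set set" where
  "boruvka_step V fn P Qs F = F \<union> {e. \<exists>A\<in>comps V F. \<exists>Q\<in>Qs. fn A (P \<inter> Q) e}"

definition isolates :: "'a set set \<Rightarrow> 'a set \<Rightarrow> 'a set set \<Rightarrow> 'a set \<Rightarrow> bool" where
  "isolates E A X e \<longleftrightarrow> boundary E A \<inter> X = {e}"

text \<open>The measure of progress. A component without a leaving edge of G is finished: no edge of
  G can merge it further, so it must not be counted.\<close>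

definition open_comps :: "'a set \<Rightarrow> 'a set set \<Rightarrow> 'a set set \<Rightarrow> 'a set set" where
  "open_comps V G F = {A \<in> comps V F. boundary G A \<noteq> {}}"

lemma boruvka_step_subset:
  "F \<subseteq> E \<inter> P \<Longrightarrow> boruvka_step V (isolates E) P Qs F \<subseteq> E \<inter> P"
  by (auto simp: boruvka_step_def isolates_def boundary_def)

text \<open>An open component outside U is merged with another open component along its isolated
  edge. Under the coarsening map only the members of U can be alone in their fibre, and
  \<open>card_image_halving\<close> applies.\<close>

lemma boruvka_step_halving:
  assumes "finite V" "E \<subseteq> pairs V"
    and U_def: "U = {A \<in> open_comps V (E \<inter> P) F. \<forall>Q\<in>Qs. \<forall>e. \<not> isolates E A (P \<inter> Q) e}"
  shows "2 * card (open_comps V (E \<inter> P) (boruvka_step V (isolates E) P Qs F))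
     \<le> card (open_comps V (E \<inter> P) F) + card U"
proof -
  let ?F = "boruvka_step V (isolates E) P Qs F" and ?G = "E \<inter> P"
  define g where "g A = (\<Union>y\<in>A. comp_of V ?F y)" for A
  have mono: "(adj F)\<^sup>* \<subseteq> (adj ?F)\<^sup>*" by (rule adj_rtrancl_mono) (auto simp: boruvka_step_def)
  have g: "g (comp_of V F x) = comp_of V ?F x" if "x \<in> V" for x
    using comps_coarsen[OF mono that] by (simp add: g_def)
  have open_comp: "comp_of V F x \<in> open_comps V ?G F"
    if "{x, y} \<in> ?G" "comp_of V F x \<noteq> comp_of V F y" for x y
  proof -
    have xy: "x \<noteq> y" "x \<in> V" "y \<in> V" using that assms(2) by auto
    have "y \<notin> comp_of V F x" using that(2) comp_of_eqI[of x y F V] by (auto simp: comp_of_def)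
    then have "{x, y} \<in> boundary ?G (comp_of V F x)"
      using that xy comp_of_self[of x V F] by auto
    then show ?thesis using xy comp_of_in_comps[of x V F] unfolding open_comps_def by blast
  qed
  show ?thesis
  proof (rule card_image_halving)
    show "finite (open_comps V ?G F)"
      using finite_comps[OF assms(1), of F] by (simp add: open_comps_def)
    show "U \<subseteq> open_comps V ?G F" by (auto simp: U_def)
    \<comment> \<open>An edge that leaves a new component also leaves the old component of its inner
      endpoint, so that old component is open as well.\<close>
    show "open_comps V ?G ?F \<subseteq> g ` open_comps V ?G F"
    proof
      fix B assume B: "B \<in> open_comps V ?G ?F"
      then obtain e where e: "e \<in> boundary ?G B" by (auto simp: open_comps_def)
      then have "e \<in> pairs V" using assms(2) boundary_subset[of ?G B] by blast
      then obtain x y where xy: "e = {x, y}" "x \<noteq> y" "x \<in> V" "y \<in> V" by (rule pairsE)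
      have "\<exists>x y. e = {x, y} \<and> x \<in> B \<and> y \<notin> B \<and> x \<in> V \<and> y \<in> V"
        using e xy doubleton_in_boundary[of x y ?G B] by (metis insert_commute)
      then obtain x y where xy: "e = {x, y}" "x \<in> B" "y \<notin> B" "x \<in> V" "y \<in> V" by blast
      have "B \<in> comps V ?F" using B by (simp add: open_comps_def)
      then have BB: "B = comp_of V ?F x" using xy(2) by (rule compsD)
      have "comp_of V F x \<noteq> comp_of V F y"
        using g[of x] g[of y] xy BB comp_of_self[of y V ?F] by auto
      then have "comp_of V F x \<in> open_comps V ?G F"
        using open_comp[of x y] e xy boundary_subset[of ?G B] by auto
      then show "B \<in> g ` open_comps V ?G F" using g[of x] xy BB by blast
    qed
    \<comment> \<open>The partner of A is the old component at the outer end of the isolated edge;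
      the same edge shows that it is open.\<close>
    fix A assume A: "A \<in> open_comps V ?G F - U"
    then obtain Q e where Q: "Q \<in> Qs" and iso: "isolates E A (P \<inter> Q) e" by (auto simp: U_def)
    have e: "e \<in> boundary E A" "e \<in> P" using iso by (auto simp: isolates_def)
    have AV: "A \<in> comps V F" using A by (auto simp: open_comps_def)
    have "e \<in> pairs V" using assms(2) e boundary_subset[of E A] by blast
    then obtain x y where xy: "e = {x, y}" "x \<noteq> y" "x \<in> V" "y \<in> V" by (rule pairsE)
    have "\<exists>x y. e = {x, y} \<and> x \<in> A \<and> y \<notin> A \<and> x \<in> V \<and> y \<in> V"
      using e xy doubleton_in_boundary[of x y E A] by (metis insert_commute)
    then obtain x y where xy: "e = {x, y}" "x \<in> A" "y \<notin> A" "x \<in> V" "y \<in> V" by blast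
    have AA: "A = comp_of V F x" using AV xy(2) by (rule compsD)
    have ne: "comp_of V F y \<noteq> A" using comp_of_self[of y V F] xy by auto
    have "e \<in> ?F" using AV Q iso by (auto simp: boruvka_step_def)
    then have "g (comp_of V F y) = g A" using AA g xy comp_of_eq_edge[of x y ?F V] by auto
    moreover have "comp_of V F y \<in> open_comps V ?G F"
      using open_comp[of y x] ne AA e xy boundary_subset[of E A] by (auto simp: insert_commute)
    ultimately show "\<exists>A'\<in>open_comps V ?G F. A' \<noteq> A \<and> g A' = g A" using ne by blast
  qed
qed

lemma open_comps_empty_connected:
  assumes "G \<subseteq> pairs V" "open_comps V G F = {}"
  shows "G \<subseteq> {{u, v} |u v. (u, v) \<in> (adj F)\<^sup>*}"
proof
  fix e assume e: "e \<in> G"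
  then have "e \<in> pairs V" using assms by auto
  then obtain u v where uv: "e = {u, v}" "u \<noteq> v" "u \<in> V" "v \<in> V" by (rule pairsE)
  have "boundary G (comp_of V F u) = {}"
    using assms(2) comp_of_in_comps[OF uv(3), of F] by (auto simp: open_comps_def)
  then have "v \<in> comp_of V F u"
    using doubleton_in_boundary[OF uv(2), of G "comp_of V F u"] e uv comp_of_self[OF uv(3), of F] by auto
  then show "e \<in> {{u, v} |u v. (u, v) \<in> (adj F)\<^sup>*}" using uv by (auto simp: comp_of_def)
qed

text \<open>The sampling lemma speaks of contracting the whole sample G, the algorithm only finds
  edges F that connect the endpoints of G. On top of the contracted picks D the latter contract at
  least as much.\<close>

lemma adj_rtrancl_absorb:
  assumes "G \<subseteq> {{u, v} |u v. (u, v) \<in> (adj F)\<^sup>*}"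
  shows "(adj (D \<union> G))\<^sup>* \<subseteq> (adj (D \<union> F))\<^sup>*"
proof -
  have F: "(adj F)\<^sup>* \<subseteq> (adj (D \<union> F))\<^sup>*" by (rule adj_rtrancl_mono) auto
  have "adj (D \<union> G) \<subseteq> (adj (D \<union> F))\<^sup>*"
  proof (rule subrelI)
    fix x y assume "(x, y) \<in> adj (D \<union> G)"
    then consider "{x, y} \<in> D" | "{x, y} \<in> G" by (auto simp: adj_def)
    then show "(x, y) \<in> (adj (D \<union> F))\<^sup>*"
    proof cases
      case 2
      then obtain u v where "{x, y} = {u, v}" "(u, v) \<in> (adj F)\<^sup>*" using assms by blast
      then have "(x, y) \<in> (adj F)\<^sup>*" using adj_rtrancl_sym by (auto simp: doubleton_eq_iff)
      then show ?thesis using F by blast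
    qed (auto simp: adj_def)
  qed
  then show ?thesis by (metis rtrancl_idemp rtrancl_mono)
qed

section \<open>Queries that determine a sparse quotient\<close>

text \<open>Double counting of the pairs of a query and an element which it fails to
  separate.\<close>

lemma exists_separating_query:
  assumes "finite W" "finite B" "\<And>b. b \<in> B \<Longrightarrow> card W \<le> 4 * card {q \<in> W. sep b q}" "W \<noteq> {}"
  shows "\<exists>q\<in>W. 4 * card {b \<in> B. \<not> sep b q} \<le> 3 * card B"
proof (rule ccontr)
  assume "\<not> ?thesis"
  then have "(\<Sum>q\<in>W. 3 * card B) < (\<Sum>q\<in>W. 4 * card {b \<in> B. \<not> sep b q})"
    using assms by (intro sum_strict_mono) auto
  also have "(\<Sum>q\<in>W. 4 * card {b \<in> B. \<not> sep b q}) = 4 * (\<Sum>q\<in>W. \<Sum>b\<in>B. of_bool (\<not> sep b q))"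
    using assms by (simp add: sum_distrib_left sum_of_bool_eq Int_def)
  also have "\<dots> = (\<Sum>b\<in>B. 4 * card {q \<in> W. \<not> sep b q})"
    using assms by (subst sum.swap) (simp add: sum_distrib_left sum_of_bool_eq Int_def)
  also have "\<dots> \<le> (\<Sum>b\<in>B. 3 * card W)"
  proof (rule sum_mono)
    fix b assume b: "b \<in> B"
    have "card W = card {q \<in> W. sep b q} + card {q \<in> W. \<not> sep b q}"
      using assms(1) by (subst card_Un_disjoint[symmetric]) (auto intro: arg_cong[where f = card])
    with assms(3)[OF b] show "4 * card {q \<in> W. \<not> sep b q} \<le> 3 * card W" by linarith
  qed
  finally show False by simp
qed

text \<open>Greedy choice: each further query removes a quarter of what is left. As soon as the
  bound is below 1 everything is separated, so a fixed list does the work of random queries.\<close>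

lemma exists_separating_list:
  assumes "finite W" "finite B" "\<And>b. b \<in> B \<Longrightarrow> card W \<le> 4 * card {q \<in> W. sep b q}" "W \<noteq> {}"
  shows "\<exists>qs. length qs = k \<and> set qs \<subseteq> W \<and>
    real (card {b \<in> B. \<forall>q\<in>set qs. \<not> sep b q}) \<le> (3/4) ^ k * real (card B)"
proof (induction k)
  case (Suc k)
  then obtain qs where qs: "length qs = k" "set qs \<subseteq> W"
    "real (card {b \<in> B. \<forall>q\<in>set qs. \<not> sep b q}) \<le> (3/4) ^ k * real (card B)" by blast
  let ?B = "{b \<in> B. \<forall>q\<in>set qs. \<not> sep b q}"
  obtain q where q: "q \<in> W" "4 * card {b \<in> ?B. \<not> sep b q} \<le> 3 * card ?B"
    using exists_separating_query[of W ?B sep] assms by auto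
  have "{b \<in> B. \<forall>q\<in>set (q # qs). \<not> sep b q} = {b \<in> ?B. \<not> sep b q}" by auto
  then have "real (card {b \<in> B. \<forall>q\<in>set (q # qs). \<not> sep b q}) \<le> (3/4) ^ Suc k * real (card B)"
    using q qs by simp
  then show ?case using q qs by (intro exI[of _ "q # qs"]) simp
qed simp

lemma card_boundary_sum:
  "finite X \<Longrightarrow> card (boundary X S) = (\<Sum>e\<in>X. of_bool (card (e \<inter> S) = 1))"
  by (simp add: boundary_def sum_of_bool_eq Int_def)

text \<open>The last term counts the edges between A and B and does not depend on S, so the second
  difference of the cut function is the same at every S. The identity is checked edge by edge from
  the positions of the two endpoints.\<close>

lemma boundary_second_difference:
  assumes "finite V" "X \<subseteq> pairs V" "A \<inter> B = {}" "A \<inter> S = {}" "B \<inter> S = {}"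
  shows "card (boundary X (A \<union> S)) + card (boundary X (B \<union> S)) =
     card (boundary X S) + card (boundary X (A \<union> (B \<union> S))) +
     2 * card {e \<in> X. card (e \<inter> A) = 1 \<and> card (e \<inter> B) = 1}"
proof -
  have fin: "finite X" using assms finite_pairs finite_subset by blast
  have edge: "of_bool (card (e \<inter> (A \<union> S)) = 1) + of_bool (card (e \<inter> (B \<union> S)) = 1) =
      of_bool (card (e \<inter> S) = 1) + of_bool (card (e \<inter> (A \<union> (B \<union> S))) = 1) +
      (2 * of_bool (card (e \<inter> A) = 1 \<and> card (e \<inter> B) = 1) :: nat)" if "e \<in> X" for e
  proof -
    have "e \<in> pairs V" using that assms by auto
    then obtain x y where xy: "e = {x, y}" "x \<noteq> y" by (rule pairsE)
    show ?thesis unfolding xy(1) card_doubleton_Int[OF xy(2)] using assms(3-5)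
      by (cases "x \<in> A"; cases "y \<in> A"; cases "x \<in> B"; cases "y \<in> B"; cases "x \<in> S"; cases "y \<in> S") auto
  qed
  have "{e \<in> X. card (e \<inter> A) = 1 \<and> card (e \<inter> B) = 1} = X \<inter> {e. card (e \<inter> A) = 1 \<and> card (e \<inter> B) = 1}"
    by auto
  then have "card {e \<in> X. card (e \<inter> A) = 1 \<and> card (e \<inter> B) = 1} =
      (\<Sum>e\<in>X. of_bool (card (e \<inter> A) = 1 \<and> card (e \<inter> B) = 1))"
    using fin by (simp add: sum_of_bool_eq)
  then show ?thesis
    using sum.cong[OF refl edge, of X] fin
    by (simp only: card_boundary_sum[OF fin] sum.distrib sum_distrib_left)
qed

text \<open>
  A nonzero second difference of the cut function forces two graphs to differ on one of the
  four sets U, A + U, B + U, A + B + U for every U avoiding the blocks A and B.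
\<close>

lemma distinguishing_unions:
  fixes C :: "'a set set"
  assumes "finite V" "X \<subseteq> pairs V" "Y \<subseteq> pairs V" "finite C"
    and disj: "\<And>A B. A \<in> C \<Longrightarrow> B \<in> C \<Longrightarrow> A \<noteq> B \<Longrightarrow> A \<inter> B = {}"
    and single: "\<And>A. A \<in> C \<Longrightarrow> card (boundary X A) = card (boundary Y A)"
    and ne: "U0 \<subseteq> C" "card (boundary X (\<Union>U0)) \<noteq> card (boundary Y (\<Union>U0))"
  shows "card (Pow C) \<le> 4 * card {U \<in> Pow C. card (boundary X (\<Union>U)) \<noteq> card (boundary Y (\<Union>U))}"
proof -
  define m where "m X A B = card {e \<in> X. card (e \<inter> A) = 1 \<and> card (e \<inter> B) = 1}" for X and A B :: "'a set"
  let ?f = "\<lambda>X U. card (boundary X (\<Union>U))"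
  have second: "?f Z (insert A U) + ?f Z (insert B U) = ?f Z U + ?f Z (insert A (insert B U)) + 2 * m Z A B"
    if "A \<in> C" "B \<in> C" "A \<noteq> B" "U \<subseteq> C - {A, B}" "Z \<subseteq> pairs V" for Z A B U
  proof -
    have "A \<inter> \<Union>U = {}" "B \<inter> \<Union>U = {}" "A \<inter> B = {}" using that disj by blast+
    then show ?thesis using boundary_second_difference[OF assms(1) that(5), of A B "\<Union>U"]
      by (simp add: m_def)
  qed
  \<comment> \<open>Otherwise the second differences agree everywhere. Together with the values on
    single blocks they determine the value on every union, by induction on the number of
    blocks.\<close>
  have "\<exists>A\<in>C. \<exists>B\<in>C. A \<noteq> B \<and> m X A B \<noteq> m Y A B"
  proof (rule ccontr)
    assume "\<not> ?thesis"
    then have meq: "\<forall>A\<in>C. \<forall>B\<in>C. A \<noteq> B \<longrightarrow> m X A B = m Y A B" by blast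
    have "?f X U = ?f Y U" if "U \<subseteq> C" for U
      using that
    proof (induction "card U" arbitrary: U rule: less_induct)
      case less
      have fU: "finite U" by (rule finite_subset[OF less.prems assms(4)])
      consider "U = {}" | A where "U = {A}" | A B U' where "U = insert A (insert B U')" "A \<noteq> B" "A \<notin> U'" "B \<notin> U'"
      proof (cases "U = {}")
        case False
        then obtain A U1 where U1: "U = insert A U1" "A \<notin> U1" by (metis mk_disjoint_insert ex_in_conv)
        show ?thesis
        proof (cases "U1 = {}")
          case False
          then obtain B U' where "U1 = insert B U'" "B \<notin> U'" by (metis mk_disjoint_insert ex_in_conv)
          with U1 that(3)[of A B U'] show ?thesis by simp
        qed (use U1 that(2) in simp)
      qed (use that(1) in simp)
      then show ?case
      proof cases
        case 1
        then show ?thesis by (simp add: boundary_def)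
      next
        case (2 A)
        then show ?thesis using less.prems single by simp
      next
        case (3 A B U')
        then have fU': "finite U'" using fU by simp
        have sub: "A \<in> C" "B \<in> C" "U' \<subseteq> C - {A, B}" using less.prems 3 by auto
        have IH: "?f X U' = ?f Y U'" "?f X (insert A U') = ?f Y (insert A U')" "?f X (insert B U') = ?f Y (insert B U')"
          by (rule less.hyps; use sub 3 fU' in auto)+
        show ?thesis
          using second[OF sub(1,2) 3(2) sub(3) assms(2)] second[OF sub(1,2) 3(2) sub(3) assms(3)] IH
            meq sub 3 by simp
      qed
    qed
    with ne show False by blast
  qed
  then obtain A B where AB: "A \<in> C" "B \<in> C" "A \<noteq> B" "m X A B \<noteq> m Y A B" by blast
  let ?D = "{U \<in> Pow C. ?f X U \<noteq> ?f Y U}"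
  \<comment> \<open>Each U that avoids A and B has a separating set among its four extensions, so
    the separating sets make up at least a quarter of \<open>Pow C\<close>.\<close>
  have "Pow (C - {A, B}) \<subseteq> (\<lambda>U. U - {A, B}) ` ?D"
  proof
    fix U assume U: "U \<in> Pow (C - {A, B})"
    then have "?f X U \<noteq> ?f Y U \<or> ?f X (insert A U) \<noteq> ?f Y (insert A U) \<or>
       ?f X (insert B U) \<noteq> ?f Y (insert B U) \<or> ?f X (insert A (insert B U)) \<noteq> ?f Y (insert A (insert B U))"
      using second[of A B U X] second[of A B U Y] AB assms(2,3) by auto
    then show "U \<in> (\<lambda>U. U - {A, B}) ` ?D"
    proof (elim disjE)
      assume "?f X U \<noteq> ?f Y U"
      then show ?thesis using U by (intro image_eqI[of _ _ U]) auto
    next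
      assume "?f X (insert A U) \<noteq> ?f Y (insert A U)"
      then show ?thesis using U AB by (intro image_eqI[of _ _ "insert A U"]) auto
    next
      assume "?f X (insert B U) \<noteq> ?f Y (insert B U)"
      then show ?thesis using U AB by (intro image_eqI[of _ _ "insert B U"]) auto
    next
      assume "?f X (insert A (insert B U)) \<noteq> ?f Y (insert A (insert B U))"
      then show ?thesis using U AB by (intro image_eqI[of _ _ "insert A (insert B U)"]) auto
    qed
  qed
  then have "card (Pow (C - {A, B})) \<le> card ?D"
    by (rule surj_card_le[rotated]) (use assms(4) in simp)
  moreover have "card (Pow C) = 4 * card (Pow (C - {A, B}))"
  proof -
    have "card C = Suc (Suc (card (C - {A, B})))"
      using assms(4) AB card_Suc_Diff1[of C A] card_Suc_Diff1[of "C - {A}" B]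
      by (simp add: Diff_insert2 [symmetric] insert_commute)
    then show ?thesis using assms(4) by (simp add: card_Pow)
  qed
  ultimately show ?thesis by simp
qed

text \<open>A small subset is encoded as a list of length exactly M, padded with
  \<open>None\<close>; this yields a single power instead of a sum of binomial coefficients.\<close>

lemma card_bounded_subsets:
  assumes "finite P"
  shows "card {X. X \<subseteq> P \<and> card X \<le> M} \<le> (card P + 1) ^ M"
proof -
  have "{X. X \<subseteq> P \<and> card X \<le> M} \<subseteq> (\<lambda>xs. {x. Some x \<in> set xs}) ` {xs. set xs \<subseteq> insert None (Some ` P) \<and> length xs = M}"
  proof
    fix X assume X: "X \<in> {X. X \<subseteq> P \<and> card X \<le> M}"
    then have "finite X" using assms finite_subset by blast
    then obtain xs where xs: "set xs = X" "length xs = card X"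
      using finite_distinct_list distinct_card by metis
    let ?ys = "map Some xs @ replicate (M - card X) None"
    have "X = {x. Some x \<in> set ?ys}" using xs by auto
    moreover have "set ?ys \<subseteq> insert None (Some ` P)" "length ?ys = M" using xs X by auto
    ultimately show "X \<in> (\<lambda>xs. {x. Some x \<in> set xs}) ` {xs. set xs \<subseteq> insert None (Some ` P) \<and> length xs = M}" by blast
  qed
  then have "card {X. X \<subseteq> P \<and> card X \<le> M} \<le> card {xs. set xs \<subseteq> insert None (Some ` P) \<and> length xs = M}"
    using assms by (intro surj_card_le) (auto intro: finite_lists_length_eq)
  also have "\<dots> = (card P + 1) ^ M"
    using assms by (subst card_lists_length_eq) (auto simp: card_image)
  finally show ?thesis .
qed

lemma boundary_Union_comps:
  assumes "E \<subseteq> pairs V" "U \<subseteq> comps V F"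
  shows "boundary (inter_edges V E F) (\<Union>U) = boundary E (\<Union>U)"
proof
  show "boundary E (\<Union>U) \<subseteq> boundary (inter_edges V E F) (\<Union>U)"
  proof
    fix e assume e: "e \<in> boundary E (\<Union>U)"
    then have "e \<in> pairs V" using assms boundary_subset by blast
    then obtain x y where xy: "e = {x, y}" "x \<noteq> y" "x \<in> V" "y \<in> V" by (rule pairsE)
    have "e \<in> E" "(x \<in> \<Union>U) \<noteq> (y \<in> \<Union>U)" using e xy by auto
    then have "comp_of V F x \<noteq> comp_of V F y"
      using assms(2) xy comp_of_self[of _ V F] compsD[of _ V F] by (metis UnionE UnionI subsetD)
    then show "e \<in> boundary (inter_edges V E F) (\<Union>U)"
      using e xy by (simp add: doubleton_in_inter_edges)
  qed
qed (auto simp: boundary_def inter_edges_def)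

text \<open>There are at most (n^2 + 1)^(2M) pairs of quotients with at most M edges, and k greedy
  queries leave a fraction (3/4)^k of the pairs unseparated, hence none. The list depends on V and F
  only, so it can be fixed before any of its answers is seen.\<close>

lemma exists_quotient_queries:
  assumes "finite V" "(real (card V) ^ 2 + 1) ^ (2 * M) < (4/3) ^ k"
  shows "\<exists>qs. length qs = k \<and> set qs \<subseteq> Pow (comps V F) \<and>
    (\<forall>E E'. E \<subseteq> pairs V \<longrightarrow> E' \<subseteq> pairs V \<longrightarrow> card (inter_edges V E F) \<le> M \<longrightarrow> card (inter_edges V E' F) \<le> M \<longrightarrow>
      (\<forall>A\<in>comps V F. card (boundary E A) = card (boundary E' A)) \<longrightarrow>
      (\<forall>U\<in>set qs. card (boundary E (\<Union>U)) = card (boundary E' (\<Union>U))) \<longrightarrow>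
      (\<forall>U\<subseteq>comps V F. card (boundary E (\<Union>U)) = card (boundary E' (\<Union>U))))"
proof -
  let ?C = "comps V F"
  define Fam where "Fam = {X. X \<subseteq> pairs V \<and> card X \<le> M}"
  \<comment> \<open>The pairs that agree on every single block and differ on some union: the blocks
    are queried anyway, and \<open>distinguishing_unions\<close> relies on their agreement.\<close>
  define B where "B = {(X, Y) \<in> Fam \<times> Fam. (\<forall>A\<in>?C. card (boundary X A) = card (boundary Y A)) \<and>
     (\<exists>U\<subseteq>?C. card (boundary X (\<Union>U)) \<noteq> card (boundary Y (\<Union>U)))}"
  define sep :: "'a set set \<times> 'a set set \<Rightarrow> 'a set set \<Rightarrow> bool"
    where "sep = (\<lambda>(X, Y) U. card (boundary X (\<Union>U)) \<noteq> card (boundary Y (\<Union>U)))"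
  have fC: "finite ?C" using assms finite_comps by blast
  have fP: "finite (pairs V)" using assms finite_pairs by blast
  have fFam: "finite Fam" unfolding Fam_def using fP by simp
  have fB: "finite B" by (rule finite_subset[of _ "Fam \<times> Fam"]) (use fFam in \<open>auto simp: B_def\<close>)
  have "card (Pow ?C) \<le> 4 * card {q \<in> Pow ?C. sep b q}" if bB: "b \<in> B" for b
  proof -
    obtain X Y where b: "b = (X, Y)" by force
    then obtain U0 where *: "X \<subseteq> pairs V" "Y \<subseteq> pairs V" "\<forall>A\<in>?C. card (boundary X A) = card (boundary Y A)"
      "U0 \<subseteq> ?C" "card (boundary X (\<Union>U0)) \<noteq> card (boundary Y (\<Union>U0))"
      using bB by (auto simp: B_def Fam_def)
    from distinguishing_unions[OF assms(1) *(1,2) fC comps_disjoint _ *(4,5)] *(3)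
    show ?thesis by (simp add: sep_def b)
  qed
  then obtain qs where qs: "length qs = k" "set qs \<subseteq> Pow ?C"
    "real (card {b \<in> B. \<forall>q\<in>set qs. \<not> sep b q}) \<le> (3/4) ^ k * real (card B)"
    using exists_separating_list[of "Pow ?C" B sep k] fC fB by auto
  have "card B \<le> card (Fam \<times> Fam)" by (intro card_mono) (use fFam in \<open>auto simp: B_def\<close>)
  also have "\<dots> = card Fam ^ 2" by (simp add: card_cartesian_product power2_eq_square)
  also have "\<dots> \<le> ((card V ^ 2 + 1) ^ M) ^ 2"
  proof (rule power_mono)
    have "card Fam \<le> (card (pairs V) + 1) ^ M" unfolding Fam_def by (rule card_bounded_subsets[OF fP])
    also have "\<dots> \<le> (card V ^ 2 + 1) ^ M" using card_pairs_le[OF assms(1)] by (intro power_mono) auto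
    finally show "card Fam \<le> (card V ^ 2 + 1) ^ M" .
  qed simp
  also have "\<dots> = (card V ^ 2 + 1) ^ (2 * M)" by (simp flip: power_mult add: mult.commute)
  finally have "real (card B) \<le> real ((card V ^ 2 + 1) ^ (2 * M))" by (simp only: of_nat_le_iff)
  also have "\<dots> < (4/3) ^ k" using assms(2) by (simp add: add.commute)
  finally have "(3/4) ^ k * real (card B) < (3/4) ^ k * (4/3) ^ k"
    by (intro mult_strict_left_mono) auto
  also have "\<dots> = 1" by (simp flip: power_mult_distrib)
  finally have "card {b \<in> B. \<forall>q\<in>set qs. \<not> sep b q} = 0" using qs(3) by simp
  then have none: "{b \<in> B. \<forall>q\<in>set qs. \<not> sep b q} = {}" using fB by simp
  show ?thesis
  proof (intro exI[of _ qs] conjI allI impI qs(1,2))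
    fix E E' U
    assume E: "E \<subseteq> pairs V" "E' \<subseteq> pairs V" "card (inter_edges V E F) \<le> M" "card (inter_edges V E' F) \<le> M"
      and agree: "\<forall>A\<in>?C. card (boundary E A) = card (boundary E' A)"
        "\<forall>U\<in>set qs. card (boundary E (\<Union>U)) = card (boundary E' (\<Union>U))" and U: "U \<subseteq> ?C"
    let ?b = "(inter_edges V E F, inter_edges V E' F)"
    have b1: "card (boundary (inter_edges V E F) A) = card (boundary E A)"
       "card (boundary (inter_edges V E' F) A) = card (boundary E' A)" if "A \<in> ?C" for A
      using boundary_Union_comps[of _ V "{A}" F] E that by auto
    have b2: "card (boundary (inter_edges V E F) (\<Union>U)) = card (boundary E (\<Union>U))"
       "card (boundary (inter_edges V E' F) (\<Union>U)) = card (boundary E' (\<Union>U))" if "U \<subseteq> ?C" for U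
      using boundary_Union_comps[of _ V U F] E that by auto
    have fam: "inter_edges V E F \<in> Fam" "inter_edges V E' F \<in> Fam"
      using E inter_edges_subset[of V E F] inter_edges_subset[of V E' F] by (auto simp: Fam_def)
    have "\<forall>q\<in>set qs. \<not> sep ?b q"
    proof
      fix q assume q: "q \<in> set qs"
      then have "q \<subseteq> ?C" using qs(2) by auto
      then show "\<not> sep ?b q" using b2[of q] agree(2) q by (simp add: sep_def)
    qed
    then have nB: "?b \<notin> B" using none by blast
    show "card (boundary E (\<Union>U)) = card (boundary E' (\<Union>U))"
    proof (rule ccontr)
      assume "card (boundary E (\<Union>U)) \<noteq> card (boundary E' (\<Union>U))"
      then have "\<exists>U\<subseteq>?C. card (boundary (inter_edges V E F) (\<Union>U)) \<noteq> card (boundary (inter_edges V E' F) (\<Union>U))"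
        using b2[OF U] U by (intro exI[of _ U]) simp
      moreover have "\<forall>A\<in>?C. card (boundary (inter_edges V E F) A) = card (boundary (inter_edges V E' F) A)"
        using b1 agree(1) by simp
      ultimately have "?b \<in> B" using fam by (simp add: B_def)
      with nB show False by simp
    qed
  qed
qed

section \<open>Sampling and sketching\<close>

lemma prob_bind_pmf:
  "measure_pmf.prob (bind_pmf p f) S = measure_pmf.expectation p (\<lambda>x. measure_pmf.prob (f x) S)"
proof -
  have "measure (measure_pmf p \<bind> (\<lambda>x. measure_pmf (f x))) S = (\<integral>x. measure_pmf.prob (f x) S \<partial>measure_pmf p)"
    using measure_pmf.subprob_space_axioms
    by (intro subprob_space.measure_bind[where N = "count_space UNIV"]) (auto simp: measure_pmf_in_subprob_algebra)
  then show ?thesis by (simp add: measure_pmf_bind)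
qed

text \<open>For an analysis in stages: B is the good outcome of the first stage, and the success
  bounds of successive stages multiply.\<close>

lemma prob_bind_ge:
  assumes "a \<le> measure_pmf.prob p B" "0 \<le> b"
    and "\<And>x. x \<in> B \<Longrightarrow> x \<in> set_pmf p \<Longrightarrow> b \<le> measure_pmf.prob (f x) S"
  shows "a * b \<le> measure_pmf.prob (bind_pmf p f) S"
proof -
  have "a * b \<le> measure_pmf.expectation p (\<lambda>x. b * indicator B x)"
    using mult_right_mono[OF assms(1,2)] by (simp add: mult.commute)
  also have "\<dots> \<le> measure_pmf.expectation p (\<lambda>x. measure_pmf.prob (f x) S)"
  proof (rule integral_mono_AE)
    show "integrable (measure_pmf p) (\<lambda>x. b * indicator B x)"
      by (rule measure_pmf.integrable_const_bound[where B = b]) (use assms(2) in \<open>auto simp: indicator_def\<close>)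
    show "integrable (measure_pmf p) (\<lambda>x. measure_pmf.prob (f x) S)"
      by (rule measure_pmf.integrable_const_bound[where B = 1]) auto
    show "AE x in measure_pmf p. b * indicator B x \<le> measure_pmf.prob (f x) S"
      using assms by (auto simp: AE_measure_pmf_iff indicator_def)
  qed
  finally show ?thesis by (simp add: prob_bind_pmf)
qed

lemma expectation_bind_le:
  fixes h :: "'b \<Rightarrow> real"
  assumes "finite (set_pmf p)" "\<And>x. x \<in> set_pmf p \<Longrightarrow> finite (set_pmf (f x))"
    and "\<And>x. x \<in> set_pmf p \<Longrightarrow> measure_pmf.expectation (f x) h \<le> g x"
  shows "measure_pmf.expectation (bind_pmf p f) h \<le> measure_pmf.expectation p g"
proof -
  have "measure_pmf.expectation (bind_pmf p f) h = (\<Sum>a\<in>set_pmf p. pmf p a *\<^sub>R measure_pmf.expectation (f a) h)"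
    using assms by (intro pmf_expectation_bind) auto
  also have "\<dots> \<le> (\<Sum>a\<in>set_pmf p. pmf p a *\<^sub>R g a)"
    using assms by (intro sum_mono scaleR_left_mono) auto
  also have "\<dots> = measure_pmf.expectation p g"
    using assms(1) by (subst integral_measure_pmf[of "set_pmf p"]) auto
  finally show ?thesis .
qed

lemma expectation_mono_pmf:
  fixes f g :: "'b \<Rightarrow> real"
  assumes "finite (set_pmf p)" "\<And>x. x \<in> set_pmf p \<Longrightarrow> f x \<le> g x"
  shows "measure_pmf.expectation p f \<le> measure_pmf.expectation p g"
  using assms by (intro integral_mono_AE integrable_measure_pmf_finite) (auto simp: AE_measure_pmf_iff)

lemma prob_ge_le_expectation:
  fixes f :: "'b \<Rightarrow> real"
  assumes "finite (set_pmf p)" "\<And>x. x \<in> set_pmf p \<Longrightarrow> 0 \<le> f x" "0 < c"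
  shows "measure_pmf.prob p {x. c \<le> f x} \<le> measure_pmf.expectation p f / c"
  using integral_Markov_inequality_measure[of "measure_pmf p" f UNIV c] assms
  by (simp add: integrable_measure_pmf_finite AE_measure_pmf_iff)

lemma prob_Ex_le_sum:
  assumes "finite I"
  shows "measure_pmf.prob p {x. \<exists>i\<in>I. Q i x} \<le> (\<Sum>i\<in>I. measure_pmf.prob p {x. Q i x})"
proof -
  have "{x. \<exists>i\<in>I. Q i x} = (\<Union>i\<in>I. {x. Q i x})" by auto
  then show ?thesis using measure_pmf.finite_measure_subadditive_finite[OF assms, of "\<lambda>i. {x. Q i x}" p] by auto
qed

lemma prob_Collect_not: "measure_pmf.prob p {x. \<not> Q x} = 1 - measure_pmf.prob p {x. Q x}"
  using measure_pmf.prob_compl[of "{x. Q x}" p] by (simp add: Collect_neg_eq Compl_eq_Diff_UNIV)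

lemma prob_mono_support:
  assumes "\<And>x. x \<in> set_pmf p \<Longrightarrow> Q x \<Longrightarrow> Q' x"
  shows "measure_pmf.prob p {x. Q x} \<le> measure_pmf.prob p {x. Q' x}"
  using assms by (intro measure_pmf.finite_measure_mono_AE) (auto simp: AE_measure_pmf_iff)

lemma prob_Pi_pmf_component:
  assumes "finite A" "x \<in> A"
  shows "measure_pmf.prob (Pi_pmf A d p) {f. Q (f x)} = measure_pmf.prob (p x) {y. Q y}"
proof -
  have "p x = map_pmf (\<lambda>f. f x) (Pi_pmf A d p)" using Pi_pmf_component[OF assms(1), of x d p] assms(2) by simp
  then have "measure_pmf.prob (p x) {y. Q y} = measure_pmf.prob (map_pmf (\<lambda>f. f x) (Pi_pmf A d p)) {y. Q y}"
    by simp
  then show ?thesis by (simp add: vimage_def)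
qed

lemma prob_replicate_all:
  "measure_pmf.prob (replicate_pmf t p) {xs. \<forall>x\<in>set xs. Q x} = measure_pmf.prob p {x. Q x} ^ t"
proof (induction t)
  case (Suc t)
  have "measure_pmf.prob (replicate_pmf t p \<bind> (\<lambda>xs. return_pmf (x # xs))) {xs. \<forall>x\<in>set xs. Q x} =
      indicator {x. Q x} x * measure_pmf.prob p {x. Q x} ^ t" for x
    using Suc by (cases "Q x") (simp_all flip: map_pmf_def add: vimage_def)
  then show ?case by (simp add: prob_bind_pmf)
qed simp

text \<open>
  The sampling lemma of Karger, Klein and Tarjan: when the edges are examined one by one, every
  edge that joins two current components is sampled, and then merges them, with probability r.
\<close>

lemma expectation_inter_edges:
  assumes "finite V" "0 \<le> r" "r \<le> 1" "E \<subseteq> pairs V"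
  shows "r * measure_pmf.expectation (random_subset E r) (\<lambda>P. real (card (inter_edges V E (F \<union> P))))
    \<le> real (card (comps V F))"
proof -
  have "finite E" using assms(1,4) finite_pairs finite_subset by blast
  then show ?thesis using assms(4)
  \<comment> \<open>F is generalized because an edge that is sampled joins the contracted
    set.\<close>
  proof (induction E arbitrary: F rule: finite_induct)
    case empty
    then show ?case by (simp add: inter_edges_def)
  next
    case (insert e E)
    let ?X = "\<lambda>F. measure_pmf.expectation (random_subset E r) (\<lambda>P. real (card (inter_edges V E (F \<union> P))))"
    have IH: "r * ?X F \<le> real (card (comps V F))" for F using insert by auto
    have fin: "finite (set_pmf (random_subset E r))" using insert finite_set_random_subset by blast
    have "e \<in> pairs V" using insert by auto
    then obtain u v where uv: "e = {u, v}" "u \<noteq> v" "u \<in> V" "v \<in> V" by (rule pairsE)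
    have not_inter: "inter_edges V (insert e E) D = inter_edges V E D" if "comp_of V D u = comp_of V D v" for D
    proof -
      have "e \<notin> inter_edges V (insert e E) D" unfolding uv(1) doubleton_in_inter_edges[OF uv(2-4)] using that by simp
      then show ?thesis unfolding inter_edges_def by blast
    qed
    have split: "measure_pmf.expectation (random_subset (insert e E) r) (\<lambda>P. real (card (inter_edges V (insert e E) (F \<union> P))))
      = r * ?X (insert e F) + (1 - r) * measure_pmf.expectation (random_subset E r) (\<lambda>P. real (card (inter_edges V (insert e E) (F \<union> P))))"
    proof -
      have "comp_of V (insert e F \<union> P) u = comp_of V (insert e F \<union> P) v" for P
        using uv(1) by (intro comp_of_eq_edge) auto
      then have "inter_edges V (insert e E) (F \<union> insert e P) = inter_edges V E (insert e F \<union> P)" for P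
        using not_inter[of "insert e F \<union> P"] by simp
      then show ?thesis
        using expectation_random_subset_insert[OF insert(1,2) assms(2,3)] by simp
    qed
    show ?case
    proof (cases "comp_of V F u = comp_of V F v")
      case True
      have "comp_of V (F \<union> P) u = comp_of V (F \<union> P) v" for P
        using True comp_of_eq_iff[OF uv(4)] adj_rtrancl_mono[of F "F \<union> P"] by blast
      then have "inter_edges V (insert e E) (F \<union> P) = inter_edges V E (F \<union> P)" for P
        using not_inter by blast
      then have "measure_pmf.expectation (random_subset E r) (\<lambda>P. real (card (inter_edges V (insert e E) (F \<union> P)))) = ?X F"
        by simp
      then have "r * measure_pmf.expectation (random_subset (insert e E) r) (\<lambda>P. real (card (inter_edges V (insert e E) (F \<union> P))))
        = r * (r * ?X (insert e F)) + (1 - r) * (r * ?X F)"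
        using split by (simp only: distrib_left mult.left_commute)
      also have "\<dots> \<le> r * real (card (comps V F)) + (1 - r) * real (card (comps V F))"
        using IH[of F] IH[of "insert e F"] comps_insert_le[OF assms(1), of e F] assms(2,3)
        by (intro add_mono mult_left_mono) linarith+
      finally show ?thesis by (simp add: algebra_simps)
    next
      case False
      have "real (card (inter_edges V (insert e E) (F \<union> P))) \<le> 1 + real (card (inter_edges V E (F \<union> P)))" for P
      proof -
        have "inter_edges V (insert e E) (F \<union> P) \<subseteq> insert e (inter_edges V E (F \<union> P))"
          by (auto simp: inter_edges_def)
        moreover have "finite (inter_edges V E (F \<union> P))"
          using insert(1) inter_edges_subset finite_subset by metis
        ultimately have "card (inter_edges V (insert e E) (F \<union> P)) \<le> card (insert e (inter_edges V E (F \<union> P)))"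
          by (intro card_mono) auto
        also have "\<dots> \<le> Suc (card (inter_edges V E (F \<union> P)))" by (rule card_insert_le_m1) auto
        finally show ?thesis by linarith
      qed
      then have "measure_pmf.expectation (random_subset E r) (\<lambda>P. real (card (inter_edges V (insert e E) (F \<union> P))))
         \<le> measure_pmf.expectation (random_subset E r) (\<lambda>P. 1 + real (card (inter_edges V E (F \<union> P))))"
        using fin by (intro expectation_mono_pmf)
      also have "\<dots> = 1 + ?X F" using fin by (simp add: integrable_measure_pmf_finite)
      finally have le: "measure_pmf.expectation (random_subset E r) (\<lambda>P. real (card (inter_edges V (insert e E) (F \<union> P))))
         \<le> 1 + ?X F" .
      have Y: "r * measure_pmf.expectation (random_subset E r) (\<lambda>P. real (card (inter_edges V (insert e E) (F \<union> P))))
         \<le> r + real (card (comps V F))" using mult_left_mono[OF le assms(2)] IH[of F]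
        by (simp add: distrib_left)
      have Z: "r * ?X (insert e F) \<le> real (card (comps V F)) - 1"
        using IH[of "insert e F"] comps_insert_less[OF assms(1) uv(3,4) False] uv(1) by auto
      \<comment> \<open>If e is sampled, one component is lost; if not, e itself may remain. With c
        components the weighted sum is r (c - 1) + (1 - r) (r + c) = c - r^2, so the lost component
        pays for the remaining edge.\<close>
      have "r * measure_pmf.expectation (random_subset (insert e E) r) (\<lambda>P. real (card (inter_edges V (insert e E) (F \<union> P))))
        \<le> r * (real (card (comps V F)) - 1) + (1 - r) * (r + real (card (comps V F)))"
      proof -
        have eq: "r * (r * a + (1 - r) * b) = r * (r * a) + (1 - r) * (r * b)" for a b :: real
          by (simp add: algebra_simps)
        show ?thesis unfolding split eq using Y Z assms(2,3) by (intro add_mono mult_left_mono) auto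
      qed
      also have "\<dots> = real (card (comps V F)) - r\<^sup>2" by (simp add: algebra_simps power2_eq_square)
      also have "\<dots> \<le> real (card (comps V F))" by simp
      finally show ?thesis .
    qed
  qed
qed

section \<open>Isolating a single element by sampling at dyadic rates\<close>

lemma prob_isolate_in:
  fixes q :: real
  assumes "finite A" "B \<subseteq> M" "M \<subseteq> A" "0 \<le> q" "q \<le> 1"
  shows "measure_pmf.prob (random_subset A q) {X. \<exists>e\<in>B. X \<inter> M = {e}} = card B * (q * (1 - q) ^ (card M - 1))"
proof -
  have fin: "finite M" "finite B" using assms finite_subset by metis+
  have "measure_pmf.prob (random_subset A q) {X. \<exists>e\<in>B. X \<inter> M = {e}} = measure_pmf.prob (random_subset M q) {X. \<exists>e\<in>B. X = {e}}"
    using prob_random_subset_Int[OF assms(1,3), where Q = "\<lambda>Y. \<exists>e\<in>B. Y = {e}"] .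
  also have "{X. \<exists>e\<in>B. X = {e}} = (\<Union>e\<in>B. {X. X = {e}})" by auto
  also have "measure_pmf.prob (random_subset M q) \<dots> = (\<Sum>e\<in>B. measure_pmf.prob (random_subset M q) {X. X = {e}})"
    using fin by (intro measure_pmf.finite_measure_finite_Union) (auto simp: disjoint_family_on_def)
  also have "\<dots> = (\<Sum>e\<in>B. q * (1 - q) ^ (card M - 1))"
    using fin assms by (intro sum.cong refl prob_random_subset_singleton) auto
  finally show ?thesis by simp
qed

text \<open>At rate q = 2^-j the expected number q m of sampled elements lies between 1/4 and 1/2.
  By Bernoulli's inequality (1 - q)^(m - 1) is then at least 1/2, and 1/4 times 1/2 gives the
  constant.\<close>

lemma isolation_probability:
  assumes "2 * m \<le> 2 ^ j" "2 ^ j < 4 * m"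
  shows "1/8 \<le> real m * ((1/2) ^ j * (1 - (1/2) ^ j) ^ (m - 1))"
proof -
  define q :: real where "q = (1/2) ^ j"
  have q: "0 < q" "q \<le> 1" by (auto simp: q_def power_le_one)
  have 1: "q * 2 ^ j = 1" by (simp add: q_def power_one_over)
  have "real (2 * m) \<le> real (2 ^ j)" "real (2 ^ j) < real (4 * m)" using assms by (simp_all only: of_nat_le_iff of_nat_less_iff)
  then have "q * (2 * real m) \<le> q * 2 ^ j" "q * 2 ^ j < q * (4 * real m)" using q by simp_all
  then have qm: "q * real m \<le> 1/2" "1/4 \<le> q * real m" using 1 by simp_all
  have "1 - real (m - 1) * q \<le> (1 - q) ^ (m - 1)"
    using Bernoulli_inequality[of "- q" "m - 1"] q by simp
  moreover have "real (m - 1) * q \<le> q * real m" using q by (simp add: mult.commute mult_left_mono)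
  ultimately have "1/2 \<le> (1 - q) ^ (m - 1)" using qm by linarith
  then have "1/4 * (1/2) \<le> (q * real m) * (1 - q) ^ (m - 1)" using qm q by (intro mult_mono) auto
  then show ?thesis by (simp add: q_def mult_ac)
qed

lemma exists_isolation_scale:
  assumes "0 < m" "2 * m \<le> 2 ^ s"
  shows "\<exists>j\<le>s. 2 * m \<le> 2 ^ j \<and> 2 ^ j < 4 * (m :: nat)"
proof -
  define j where "j = (LEAST j. 2 * m \<le> 2 ^ j)"
  have j: "2 * m \<le> 2 ^ j" unfolding j_def by (rule LeastI[of _ s]) (rule assms)
  have "j \<le> s" unfolding j_def by (rule Least_le) (rule assms)
  moreover have "j \<noteq> 0" using j assms by (cases j) auto
  then have "\<not> 2 * m \<le> 2 ^ (j - 1)" unfolding j_def by (intro not_less_Least) simp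
  then have "2 ^ j < 4 * m" using \<open>j \<noteq> 0\<close> by (cases j) auto
  ultimately show ?thesis using j by blast
qed

text \<open>The size of the boundary to be sampled is unknown, so every rate 2^-j with j \<le> s is
  tried; one of them fits.\<close>

definition scales_pmf :: "'a set \<Rightarrow> nat \<Rightarrow> 'a set set set pmf" where
  "scales_pmf V s = map_pmf (\<lambda>f. f ` {..s}) (Pi_pmf {..s} {} (\<lambda>j. random_subset (pairs V) ((1/2) ^ j)))"

lemma finite_set_scales_pmf: "finite V \<Longrightarrow> finite (set_pmf (scales_pmf V s))"
  unfolding scales_pmf_def
  by (auto intro!: finite_PiE_dflt finite_set_random_subset finite_pairs simp: set_Pi_pmf)

lemma prob_scales_isolate:
  assumes "finite V" "M \<subseteq> pairs V" "M \<noteq> {}" "2 * card M \<le> 2 ^ s"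
  shows "1/8 \<le> measure_pmf.prob (scales_pmf V s) {Qs. \<exists>Q\<in>Qs. \<exists>e. M \<inter> Q = {e}}"
proof -
  have fin: "finite M" using assms finite_pairs finite_subset by blast
  obtain j where j: "j \<le> s" "2 * card M \<le> 2 ^ j" "2 ^ j < 4 * card M"
    using exists_isolation_scale[of "card M" s] assms fin by (auto simp: card_gt_0_iff)
  let ?P = "Pi_pmf {..s} {} (\<lambda>j. random_subset (pairs V) ((1/2) ^ j))"
  have "1/8 \<le> measure_pmf.prob (random_subset (pairs V) ((1/2) ^ j)) {X. \<exists>e\<in>M. X \<inter> M = {e}}"
    using isolation_probability[OF j(2,3)]
      prob_isolate_in[OF finite_pairs[OF assms(1)] subset_refl assms(2), of "(1/2) ^ j"]
    by (simp add: power_le_one)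
  also have "\<dots> = measure_pmf.prob ?P {f. \<exists>e\<in>M. f j \<inter> M = {e}}"
    using j(1) by (subst prob_Pi_pmf_component) auto
  also have "\<dots> \<le> measure_pmf.prob ?P {f. \<exists>Q\<in>f ` {..s}. \<exists>e. M \<inter> Q = {e}}"
    using j(1) by (intro measure_pmf.finite_measure_mono) (auto simp: Int_commute)
  also have "\<dots> = measure_pmf.prob (scales_pmf V s) {Qs. \<exists>Q\<in>Qs. \<exists>e. M \<inter> Q = {e}}"
    by (simp add: scales_pmf_def vimage_def)
  finally show ?thesis .
qed

text \<open>Each open component fails to see an isolated edge with probability at most 7/8, so U has
  expected size at most 7/8 of the open components; averaging with the halving bound gives (1 + 7/8)
  / 2 = 15/16.\<close>

lemma expectation_boruvka_step:
  assumes "finite V" "E \<subseteq> pairs V" "2 * card V ^ 2 \<le> 2 ^ s"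
  shows "measure_pmf.expectation (scales_pmf V s) (\<lambda>Qs. real (card (open_comps V (E \<inter> P) (boruvka_step V (isolates E) P Qs F))))
     \<le> 15/16 * real (card (open_comps V (E \<inter> P) F))"
proof -
  let ?O = "open_comps V (E \<inter> P) F" and ?D = "scales_pmf V s"
  have fO: "finite ?O" using finite_comps[OF assms(1)] by (simp add: open_comps_def)
  have fD: "finite (set_pmf ?D)" by (rule finite_set_scales_pmf[OF assms(1)])
  define U where "U Qs = {A \<in> ?O. \<forall>Q\<in>Qs. \<forall>e. \<not> isolates E A (P \<inter> Q) e}" for Qs
  have bad: "measure_pmf.prob ?D {Qs. A \<in> U Qs} \<le> 7/8" if A: "A \<in> ?O" for A
  proof -
    let ?M = "boundary (E \<inter> P) A"
    have M: "?M \<subseteq> pairs V" using boundary_subset[of "E \<inter> P" A] assms(2) by blast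
    have "card ?M \<le> card V ^ 2"
      using card_mono[OF finite_pairs[OF assms(1)] M] card_pairs_le[OF assms(1)] by linarith
    then have "2 * card ?M \<le> 2 ^ s" using assms(3) by linarith
    moreover have "?M \<noteq> {}" using A by (simp add: open_comps_def)
    ultimately have "1/8 \<le> measure_pmf.prob ?D {Qs. \<exists>Q\<in>Qs. \<exists>e. ?M \<inter> Q = {e}}"
      using prob_scales_isolate[OF assms(1) M] by blast
    moreover have "{Qs. A \<in> U Qs} = {Qs. \<not> (\<exists>Q\<in>Qs. \<exists>e. ?M \<inter> Q = {e})}"
      using A by (auto simp: U_def isolates_def boundary_Int Int_assoc)
    ultimately show ?thesis by (simp only: prob_Collect_not)
  qed
  have "2 * real (card (open_comps V (E \<inter> P) (boruvka_step V (isolates E) P Qs F))) \<le> real (card ?O) + real (card (U Qs))" for Qs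
    using boruvka_step_halving[OF assms(1,2) U_def] by (metis of_nat_add of_nat_le_iff of_nat_mult of_nat_numeral)
  then have "measure_pmf.expectation ?D (\<lambda>Qs. 2 * real (card (open_comps V (E \<inter> P) (boruvka_step V (isolates E) P Qs F))))
    \<le> measure_pmf.expectation ?D (\<lambda>Qs. real (card ?O) + real (card (U Qs)))"
    using fD by (intro expectation_mono_pmf)
  also have "\<dots> = real (card ?O) + measure_pmf.expectation ?D (\<lambda>Qs. real (card (U Qs)))"
    using fD by (simp add: integrable_measure_pmf_finite)
  also have "measure_pmf.expectation ?D (\<lambda>Qs. real (card (U Qs))) = measure_pmf.expectation ?D (\<lambda>Qs. \<Sum>A\<in>?O. indicator {Qs. A \<in> U Qs} Qs)"
  proof (intro Bochner_Integration.integral_cong refl)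
    fix Qs
    have "?O \<inter> U Qs = U Qs" by (auto simp: U_def)
    then show "real (card (U Qs)) = (\<Sum>A\<in>?O. indicator {Qs. A \<in> U Qs} Qs)"
      using fO by (simp add: indicator_def sum.If_cases Int_def flip: sum.inter_filter)
  qed
  also have "\<dots> = (\<Sum>A\<in>?O. measure_pmf.prob ?D {Qs. A \<in> U Qs})"
    using fD by (subst Bochner_Integration.integral_sum) (auto simp: integrable_measure_pmf_finite)
  also have "\<dots> \<le> (\<Sum>A\<in>?O. 7/8)" by (intro sum_mono bad)
  finally show ?thesis by simp
qed

lemma finite_set_replicate_pmf: "finite (set_pmf p) \<Longrightarrow> finite (set_pmf (replicate_pmf t p))"
  by (rule finite_subset[OF _ finite_lists_length_eq[of "set_pmf p" t]]) (auto simp: set_replicate_pmf)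

text \<open>Every step draws fresh scales, independent of the components it meets, so the factors
  15/16 multiply.\<close>

lemma expectation_boruvka:
  assumes "finite V" "E \<subseteq> pairs V" "2 * card V ^ 2 \<le> 2 ^ s"
  shows "measure_pmf.expectation (replicate_pmf T (scales_pmf V s))
     (\<lambda>Qss. real (card (open_comps V (E \<inter> P) (fold (boruvka_step V (isolates E) P) Qss F))))
     \<le> (15/16) ^ T * real (card (open_comps V (E \<inter> P) F))"
proof (induction T arbitrary: F)
  case (Suc T)
  let ?D = "scales_pmf V s"
  let ?h = "\<lambda>F Qss. real (card (open_comps V (E \<inter> P) (fold (boruvka_step V (isolates E) P) Qss F)))"
  have fD: "finite (set_pmf ?D)" by (rule finite_set_scales_pmf[OF assms(1)])
  have "measure_pmf.expectation (replicate_pmf (Suc T) ?D) (?h F)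
    \<le> measure_pmf.expectation ?D (\<lambda>Qs. (15/16) ^ T * real (card (open_comps V (E \<inter> P) (boruvka_step V (isolates E) P Qs F))))"
    unfolding replicate_pmf.simps
    using fD finite_set_replicate_pmf[OF fD, of T] Suc
    by (intro expectation_bind_le) (auto simp flip: map_pmf_def)
  also have "\<dots> \<le> (15/16) ^ T * (15/16 * real (card (open_comps V (E \<inter> P) F)))"
    using expectation_boruvka_step[OF assms] by simp
  finally show ?case by simp
qed simp

text \<open>A linear fingerprint over GF(2): the inner products of
  \<open>boundary E A \<inter> X\<close> with the sets Z are compared with those of {e}. Parities
  are used because they add up over the vertices of A.\<close>

definition detects :: "'a set set \<Rightarrow> 'a set set list \<Rightarrow> 'a set \<Rightarrow> 'a set set \<Rightarrow> 'a set \<Rightarrow> bool" where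
  "detects E Zs A X e \<longleftrightarrow> e \<in> X \<and> (\<forall>Z\<in>set Zs. odd (card (boundary E A \<inter> X \<inter> Z)) \<longleftrightarrow> e \<in> Z)"

definition parity_pmf :: "'a set \<Rightarrow> nat \<Rightarrow> 'a set set list pmf" where
  "parity_pmf V t = replicate_pmf t (random_subset (pairs V) (1/2))"

text \<open>Let S e be the symmetric difference of the sampled boundary and {e}. The test of e errs
  only if S e is nonempty and meets all t sets Z evenly, which has probability 2^-t; the union bound
  runs over the at most n^2 elements of X.\<close>

lemma prob_detects_wrong:
  assumes "finite V" "E \<subseteq> pairs V" "X \<subseteq> pairs V"
  shows "measure_pmf.prob (parity_pmf V t) {Zs. \<not> (\<forall>e. detects E Zs A X e = isolates E A X e)}
     \<le> real (card V) ^ 2 / 2 ^ t"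
proof -
  let ?D = "parity_pmf V t" and ?Y = "boundary E A \<inter> X"
  have fX: "finite X" using assms finite_pairs finite_subset by blast
  have fY: "finite ?Y" using fX by simp
  define S where "S e = (?Y - {e}) \<union> ({e} - ?Y)" for e
  have par: "(odd (card (?Y \<inter> Z)) \<longleftrightarrow> e \<in> Z) \<longleftrightarrow> even (card (Z \<inter> S e))" for e Z
  proof (cases "e \<in> Z")
    case False
    then have "Z \<inter> S e = ?Y \<inter> Z" by (auto simp: S_def)
    then show ?thesis using False by simp
  next
    case True
    show ?thesis
    proof (cases "e \<in> ?Y")
      case True
      have "?Y \<inter> Z = insert e (Z \<inter> S e)" using True \<open>e \<in> Z\<close> by (auto simp: S_def)
      moreover have "e \<notin> Z \<inter> S e" "finite (Z \<inter> S e)" using True fY by (auto simp: S_def)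
      ultimately show ?thesis using \<open>e \<in> Z\<close> by simp
    next
      case False
      have "Z \<inter> S e = insert e (?Y \<inter> Z)" using False \<open>e \<in> Z\<close> by (auto simp: S_def)
      moreover have "e \<notin> ?Y \<inter> Z" using False by auto
      ultimately show ?thesis using \<open>e \<in> Z\<close> fY by simp
    qed
  qed
  have "measure_pmf.prob ?D {Zs. \<not> (\<forall>e. detects E Zs A X e = isolates E A X e)}
     \<le> measure_pmf.prob ?D {Zs. \<exists>e\<in>X. S e \<noteq> {} \<and> (\<forall>Z\<in>set Zs. even (card (Z \<inter> S e)))}"
  proof (rule prob_mono_support)
    fix Zs assume "\<not> (\<forall>e. detects E Zs A X e = isolates E A X e)"
    then obtain e where e: "detects E Zs A X e \<noteq> isolates E A X e" by blast
    have iso: "isolates E A X e \<longleftrightarrow> S e = {}" by (auto simp: isolates_def S_def)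
    have eX: "e \<in> X" using e by (auto simp: detects_def isolates_def)
    then have "detects E Zs A X e \<longleftrightarrow> (\<forall>Z\<in>set Zs. even (card (Z \<inter> S e)))"
      using par by (simp add: detects_def)
    with e iso eX show "\<exists>e\<in>X. S e \<noteq> {} \<and> (\<forall>Z\<in>set Zs. even (card (Z \<inter> S e)))" by auto
  qed
  also have "\<dots> \<le> (\<Sum>e\<in>X. measure_pmf.prob ?D {Zs. S e \<noteq> {} \<and> (\<forall>Z\<in>set Zs. even (card (Z \<inter> S e)))})"
    by (rule prob_Ex_le_sum[OF fX])
  also have "\<dots> \<le> (\<Sum>e\<in>X. (1/2) ^ t)"
  proof (rule sum_mono)
    fix e assume e: "e \<in> X"
    show "measure_pmf.prob ?D {Zs. S e \<noteq> {} \<and> (\<forall>Z\<in>set Zs. even (card (Z \<inter> S e)))} \<le> (1/2) ^ t"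
    proof (cases "S e = {}")
      case False
      have sub: "S e \<subseteq> pairs V" using e assms(3) by (auto simp: S_def)
      then have fS: "finite (S e)" using finite_pairs[OF assms(1)] finite_subset by blast
      have "measure_pmf.prob ?D {Zs. \<forall>Z\<in>set Zs. even (card (Z \<inter> S e))} =
        measure_pmf.prob (random_subset (pairs V) (1/2)) {Z. even (card (Z \<inter> S e))} ^ t"
        unfolding parity_pmf_def by (rule prob_replicate_all)
      also have "measure_pmf.prob (random_subset (pairs V) (1/2)) {Z. even (card (Z \<inter> S e))} = 1/2"
        using prob_random_subset_Int[OF finite_pairs[OF assms(1)] sub, where Q = "\<lambda>X. even (card X)" and p = "1/2"]
          prob_random_subset_even[OF fS False] by simp
      finally show ?thesis using False by simp
    qed simp
  qed
  also have "\<dots> = real (card X) / 2 ^ t" by (simp add: power_one_over)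
  also have "\<dots> \<le> real (card V) ^ 2 / 2 ^ t"
  proof (rule divide_right_mono)
    have "card X \<le> card V ^ 2"
      using card_mono[OF finite_pairs[OF assms(1)] assms(3)] card_pairs_le[OF assms(1)] by linarith
    then show "real (card X) \<le> real (card V) ^ 2" by (metis of_nat_le_iff of_nat_power)
  qed simp
  finally show ?thesis .
qed

section \<open>Contraction to random centers\<close>

lemma prob_conj_ge:
  "1 - measure_pmf.prob p {x. \<not> Q x} - measure_pmf.prob p {x. \<not> Q' x} \<le> measure_pmf.prob p {x. Q x \<and> Q' x}"
proof -
  have "{x. \<not> (Q x \<and> Q' x)} = {x. \<not> Q x} \<union> {x. \<not> Q' x}" by auto
  then have "measure_pmf.prob p {x. \<not> (Q x \<and> Q' x)} \<le> measure_pmf.prob p {x. \<not> Q x} + measure_pmf.prob p {x. \<not> Q' x}"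
    using measure_Un_le[of "{x. \<not> Q x}" "measure_pmf p" "{x. \<not> Q' x}"] by simp
  then show ?thesis using prob_Collect_not[of p "\<lambda>x. Q x \<and> Q' x"] by linarith
qed

primrec trials :: "'a set \<Rightarrow> nat list \<Rightarrow> 'a set list pmf" where
  "trials V [] = return_pmf []"
| "trials V (j # js) = bind_pmf (random_subset V ((1/2) ^ j)) (\<lambda>W. map_pmf ((#) W) (trials V js))"

definition star :: "'a \<Rightarrow> 'a set \<Rightarrow> 'a set set" where
  "star v U = (\<lambda>u. {v, u}) ` (U - {v})"

text \<open>The first W that passes the test decides. All e that pass are returned, which avoids a
  choice; for the exact predicate there is at most one.\<close>

primrec star_pick :: "('a set \<Rightarrow> 'a set set \<Rightarrow> 'a set \<Rightarrow> bool) \<Rightarrow> 'a \<Rightarrow> 'a set \<Rightarrow> 'a set list \<Rightarrow> 'a set set" where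
  "star_pick fn v R [] = {}"
| "star_pick fn v R (W # Ws) = (if \<exists>e. fn {v} (star v (R \<inter> W)) e then {e. fn {v} (star v (R \<inter> W)) e}
     else star_pick fn v R Ws)"

lemma star_subset_pairs: "v \<in> V \<Longrightarrow> U \<subseteq> V \<Longrightarrow> star v U \<subseteq> pairs V"
  by (auto simp: star_def)

lemma isolates_star:
  assumes "E \<subseteq> pairs V"
  shows "isolates E {v} (star v U) e \<longleftrightarrow> (\<exists>u. {u \<in> U. {v, u} \<in> E} = {u} \<and> e = {v, u})"
proof -
  have neq: "v \<noteq> u" if "{v, u} \<in> E" for u
    using that assms doubleton_in_pairs[of v u V] by blast
  have "{v} \<notin> E" using assms by (auto simp: pairs_def)
  then have "boundary E {v} \<inter> star v U = (\<lambda>u. {v, u}) ` {u \<in> U. {v, u} \<in> E}"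
    using neq by (auto simp: star_def)
  moreover have "(\<lambda>u. {v, u}) ` A = {e} \<longleftrightarrow> (\<exists>u. A = {u} \<and> e = {v, u})" for A
  proof
    assume *: "(\<lambda>u. {v, u}) ` A = {e}"
    then have "e \<in> (\<lambda>u. {v, u}) ` A" by simp
    then obtain u where u: "u \<in> A" "e = {v, u}" by blast
    have "A = {u}"
    proof -
      have "x = u" if "x \<in> A" for x
      proof -
        have "{v, x} \<in> (\<lambda>u. {v, u}) ` A" using that by (rule imageI)
        then have "{v, x} = e" unfolding * by simp
        then show ?thesis using u(2) by (auto simp: doubleton_eq_iff)
      qed
      then show ?thesis using u(1) by blast
    qed
    then show "\<exists>u. A = {u} \<and> e = {v, u}" using u(2) by blast
  qed auto
  ultimately show ?thesis by (simp add: isolates_def)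
qed

text \<open>\<open>s j\<close> is the probability that one given neighbour is isolated at rate 2^-j,
  the same for all neighbours. Hence a trial that decides picks a uniform neighbour, and the pick
  lies in B with probability \<open>card B / card N\<close> times the probability that some trial
  decides.\<close>

lemma prob_star_pick:
  fixes R :: "'a set"
  assumes "finite V" "E \<subseteq> pairs V" "R \<subseteq> V" "N = {u \<in> R. {v, u} \<in> E}" "B \<subseteq> N" "N \<noteq> {}"
  defines "s \<equiv> \<lambda>j. (1/2) ^ j * (1 - (1/2) ^ j) ^ (card N - 1)"
  shows "real (card B) / real (card N) * (1 - (\<Prod>j\<leftarrow>js. 1 - real (card N) * s j))
    \<le> measure_pmf.prob (trials V js) {Ws. \<exists>u\<in>B. star_pick (isolates E) v R Ws = {{v, u}}}"
proof (induction js)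
  case (Cons j js)
  let ?G = "\<lambda>Ws. \<exists>u\<in>B. star_pick (isolates E) v R Ws = {{v, u}}"
  let ?g = "measure_pmf.prob (trials V js) {Ws. ?G Ws}"
  let ?D = "random_subset V ((1/2) ^ j)"
  let ?S1 = "{W. \<exists>u\<in>B. W \<inter> N = {u}}" and ?S2 = "{W. \<not> (\<exists>u\<in>N. W \<inter> N = {u})}"
  have NV: "N \<subseteq> V" using assms by auto
  have m: "real (card N) > 0" using assms finite_subset[OF NV assms(1)] by (simp add: card_gt_0_iff)
  have iso: "isolates E {v} (star v (R \<inter> W)) e \<longleftrightarrow> (\<exists>u. W \<inter> N = {u} \<and> e = {v, u})" for W e
  proof -
    have "{u \<in> R \<inter> W. {v, u} \<in> E} = W \<inter> N" using assms(4) by auto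
    then show ?thesis using isolates_star[OF assms(2), of v "R \<inter> W" e] by simp
  qed
  have pick1: "star_pick (isolates E) v R (W # Ws) = {{v, u}}" if "W \<inter> N = {u}" for W Ws u
  proof -
    have "{e. isolates E {v} (star v (R \<inter> W)) e} = {{v, u}}" using iso that by auto
    then show ?thesis by (auto split: if_splits)
  qed
  have pick2: "star_pick (isolates E) v R (W # Ws) = star_pick (isolates E) v R Ws"
    if "\<not> (\<exists>u\<in>N. W \<inter> N = {u})" for W Ws
  proof -
    have "\<not> (\<exists>e. isolates E {v} (star v (R \<inter> W)) e)" using iso that by blast
    then show ?thesis by simp
  qed
  \<comment> \<open>Either W isolates a member of B and the pick is good, or W isolates nothing and
    the remaining trials decide, or W isolates a bad neighbour.\<close>
  have phi: "indicator ?S1 W + ?g * indicator ?S2 W \<le> measure_pmf.prob (map_pmf ((#) W) (trials V js)) {Ws. ?G Ws}" for W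
  proof -
    consider "W \<in> ?S1" "W \<notin> ?S2" | "W \<notin> ?S1" "W \<in> ?S2" | "W \<notin> ?S1" "W \<notin> ?S2" using assms(5) by blast
    then show ?thesis
    proof cases
      case 1
      then obtain u where "u \<in> B" "W \<inter> N = {u}" by blast
      then have "{Ws. ?G (W # Ws)} = UNIV" using pick1[of W u] by auto
      then have "measure_pmf.prob (trials V js) {Ws. ?G (W # Ws)} = 1" by (simp only: measure_pmf_UNIV)
      with 1 show ?thesis by (simp add: vimage_def del: star_pick.simps)
    next
      case 2
      then have "?G (W # Ws) = ?G Ws" for Ws using pick2[of W] by simp
      with 2 show ?thesis by (simp add: vimage_def del: star_pick.simps)
    qed simp
  qed
  have S2: "measure_pmf.prob ?D ?S2 = 1 - real (card N) * s j"
    unfolding prob_Collect_not s_def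
    by (subst prob_isolate_in[OF assms(1) subset_refl NV]) (simp_all add: power_le_one)
  have "real (card B) * s j + ?g * (1 - real (card N) * s j) = measure_pmf.prob ?D ?S1 + ?g * measure_pmf.prob ?D ?S2"
    unfolding S2 using prob_isolate_in[OF assms(1,5) NV, of "(1/2) ^ j"]
    by (simp add: power_le_one s_def)
  also have "\<dots> = measure_pmf.expectation ?D (\<lambda>W. indicator ?S1 W + ?g * indicator ?S2 W)"
    using finite_set_random_subset[OF assms(1)] by (subst Bochner_Integration.integral_add) (auto simp: integrable_measure_pmf_finite)
  also have "\<dots> \<le> measure_pmf.expectation ?D (\<lambda>W. measure_pmf.prob (map_pmf ((#) W) (trials V js)) {Ws. ?G Ws})"
    using finite_set_random_subset[OF assms(1)] phi by (intro expectation_mono_pmf)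
  also have "\<dots> = measure_pmf.prob (trials V (j # js)) {Ws. ?G Ws}"
    by (simp add: prob_bind_pmf)
  finally have main: "real (card B) * s j + ?g * (1 - real (card N) * s j) \<le> measure_pmf.prob (trials V (j # js)) {Ws. ?G Ws}" .
  let ?P = "\<Prod>j\<leftarrow>js. 1 - real (card N) * s j"
  have q: "0 \<le> 1 - real (card N) * s j"
    using prob_isolate_in[OF assms(1) subset_refl NV, of "(1/2) ^ j"] measure_pmf.prob_le_1[of ?D "{X. \<exists>e\<in>N. X \<inter> N = {e}}"]
    by (simp add: power_le_one s_def)
  have "real (card B) / real (card N) * (1 - (\<Prod>j\<leftarrow>j # js. 1 - real (card N) * s j)) =
    real (card B) * s j + (real (card B) / real (card N) * (1 - ?P)) * (1 - real (card N) * s j)"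
    using m by (simp add: field_simps)
  also have "\<dots> \<le> real (card B) * s j + ?g * (1 - real (card N) * s j)"
    using Cons.IH q by (intro add_left_mono mult_right_mono)
  finally show ?case using main by linarith
qed simp

definition trial_scales :: "nat \<Rightarrow> nat \<Rightarrow> nat list" where
  "trial_scales L s = concat (replicate L [0..<Suc s])"

lemma length_trial_scales: "length (trial_scales L s) = L * Suc s"
  by (simp add: trial_scales_def length_concat sum_list_replicate map_replicate)

text \<open>Each of the L sweeps over all rates contains one that fits the unknown number of
  neighbours, so a sweep stays undecided with probability at most 7/8.\<close>

lemma prob_star_pick_scales:
  fixes R :: "'a set"
  assumes "finite V" "E \<subseteq> pairs V" "R \<subseteq> V" "N = {u \<in> R. {v, u} \<in> E}" "B \<subseteq> N" "N \<noteq> {}" "2 * card V \<le> 2 ^ s"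
  shows "real (card B) / real (card N) * (1 - (7/8) ^ L)
    \<le> measure_pmf.prob (trials V (trial_scales L s)) {Ws. \<exists>u\<in>B. star_pick (isolates E) v R Ws = {{v, u}}}"
proof -
  define f where "f j = 1 - real (card N) * ((1/2) ^ j * (1 - (1/2) ^ j) ^ (card N - 1))" for j :: nat
  have NV: "N \<subseteq> V" using assms by auto
  have f: "0 \<le> f j" "f j \<le> 1" for j
    using prob_isolate_in[OF assms(1) subset_refl NV, of "(1/2) ^ j"] measure_pmf.prob_le_1[of "random_subset V ((1/2) ^ j)" "{X. \<exists>e\<in>N. X \<inter> N = {e}}"]
    by (auto simp: power_le_one f_def)
  have "card N \<le> card V" using NV assms(1) card_mono by blast
  then obtain j where j: "j \<le> s" "2 * card N \<le> 2 ^ j" "2 ^ j < 4 * card N"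
    using exists_isolation_scale[of "card N" s] assms(6,7) finite_subset[OF NV assms(1)] by (auto simp: card_gt_0_iff)
  have "(\<Prod>j\<leftarrow>[0..<Suc s]. f j) = (\<Prod>j\<in>{0..<Suc s}. f j)"
    by (metis atLeastLessThan_upt distinct_upt prod.distinct_set_conv_list)
  also have "\<dots> = f j * (\<Prod>j\<in>{0..<Suc s} - {j}. f j)" using j(1) by (subst prod.remove[of _ j]) auto
  also have "\<dots> \<le> 7/8 * 1"
    using isolation_probability[OF j(2,3)] f by (intro mult_mono prod_le_1 prod_nonneg) (auto simp: f_def)
  finally have 1: "(\<Prod>j\<leftarrow>[0..<Suc s]. f j) \<le> 7/8" by simp
  have 2: "0 \<le> (\<Prod>j\<leftarrow>[0..<Suc s]. f j)" using f by (intro prod_list_nonneg) auto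
  have "(\<Prod>j\<leftarrow>trial_scales L s. f j) = (\<Prod>j\<leftarrow>[0..<Suc s]. f j) ^ L"
    unfolding trial_scales_def by (induction L) simp_all
  also have "\<dots> \<le> (7/8) ^ L" using 1 2 by (rule power_mono)
  finally have "real (card B) / real (card N) * (1 - (7/8) ^ L) \<le> real (card B) / real (card N) * (1 - (\<Prod>j\<leftarrow>trial_scales L s. f j))"
    by (intro mult_left_mono) auto
  then show ?thesis using prob_star_pick[OF assms(1-6), of "trial_scales L s"] by (simp add: f_def)
qed

definition stars_pmf :: "'a set \<Rightarrow> nat \<Rightarrow> nat \<Rightarrow> ('a \<Rightarrow> 'a set list) pmf" where
  "stars_pmf V L s = Pi_pmf V [] (\<lambda>_. trials V (trial_scales L s))"

text \<open>Since 1 + x \<le> exp x, a vertex with b good and c bad neighbours among the centers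
  picks well with probability at least exp (- c / b), up to undecided trials. Independence turns the
  product over the vertices into a sum in the exponent.\<close>

lemma prob_stars:
  fixes R :: "'a set"
  assumes "finite V" "E \<subseteq> pairs V" "R \<subseteq> V" "2 * card V \<le> 2 ^ s" "(7/8) ^ L * real (card V) \<le> 1/2"
    and B: "\<And>v. v \<in> V \<Longrightarrow> B v \<noteq> {} \<and> B v \<subseteq> {u \<in> R. {v, u} \<in> E}"
  shows "exp (- (\<Sum>v\<in>V. real (card ({u \<in> R. {v, u} \<in> E} - B v)) / real (card (B v)))) / 2
    \<le> measure_pmf.prob (stars_pmf V L s) {ws. \<forall>v\<in>V. \<exists>u\<in>B v. star_pick (isolates E) v R (ws v) = {{v, u}}}"
proof -
  let ?N = "\<lambda>v. {u \<in> R. {v, u} \<in> E}" and ?r = "(7/8) ^ L :: real"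
  have fin: "finite (?N v)" for v using assms(1,3) finite_subset by fastforce
  have ratio: "exp (- (real (card (?N v - B v)) / real (card (B v)))) \<le> real (card (B v)) / real (card (?N v))" if v: "v \<in> V" for v
  proof -
    have fB: "finite (B v)" using B[OF v] fin finite_subset by blast
    have b: "real (card (B v)) > 0" using B[OF v] fB by (simp add: card_gt_0_iff)
    have "card (?N v) = card (?N v - B v) + card (B v)"
      using B[OF v] fin[of v] by (metis (no_types, lifting) card_Diff_subset card_mono fB le_add_diff_inverse2)
    then have "real (card (?N v)) = real (card (?N v - B v)) + real (card (B v))" by linarith
    then have "real (card (?N v)) / real (card (B v)) = 1 + real (card (?N v - B v)) / real (card (B v))"
      using b by (simp add: field_simps)
    also have "\<dots> \<le> exp (real (card (?N v - B v)) / real (card (B v)))" by (rule exp_ge_add_one_self)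
    finally have "real (card (?N v)) / real (card (B v)) \<le> exp (real (card (?N v - B v)) / real (card (B v)))" .
    moreover have "real (card (?N v)) > 0" using \<open>card (?N v) = _\<close> b by linarith
    ultimately show ?thesis using b by (simp add: exp_minus field_simps)
  qed
  have r1: "0 \<le> 1 - ?r" by (simp add: power_le_one)
  \<comment> \<open>By Bernoulli's inequality the undecided trials of all vertices together cost no
    more than a factor 1/2.\<close>
  have "1/2 \<le> 1 - real (card V) * ?r" using assms(5) by (simp add: mult.commute)
  also have "\<dots> \<le> (1 - ?r) ^ card V" using Bernoulli_inequality[of "- ?r" "card V"] by (simp add: power_le_one)
  finally have half: "1/2 \<le> (1 - ?r) ^ card V" .
  have "exp (- (\<Sum>v\<in>V. real (card (?N v - B v)) / real (card (B v)))) / 2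
    \<le> (\<Prod>v\<in>V. real (card (B v)) / real (card (?N v))) * (1 - ?r) ^ card V"
  proof -
    have "exp (- (\<Sum>v\<in>V. real (card (?N v - B v)) / real (card (B v)))) = (\<Prod>v\<in>V. exp (- (real (card (?N v - B v)) / real (card (B v)))))"
      using assms(1) by (simp add: exp_sum flip: sum_negf)
    also have "\<dots> \<le> (\<Prod>v\<in>V. real (card (B v)) / real (card (?N v)))" using ratio by (intro prod_mono) auto
    finally show ?thesis using half by (metis (no_types, lifting) divide_inverse exp_ge_zero inverse_eq_divide mult_mono order_trans zero_le_divide_1_iff zero_le_numeral)
  qed
  also have "\<dots> = (\<Prod>v\<in>V. real (card (B v)) / real (card (?N v)) * (1 - ?r))"
    by (simp only: prod.distrib prod_constant)
  also have "\<dots> \<le> (\<Prod>v\<in>V. measure_pmf.prob (trials V (trial_scales L s)) {Ws. \<exists>u\<in>B v. star_pick (isolates E) v R Ws = {{v, u}}})"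
  proof (rule prod_mono, intro conjI)
    fix v assume v: "v \<in> V"
    show "0 \<le> real (card (B v)) / real (card (?N v)) * (1 - ?r)" using r1 by simp
    show "real (card (B v)) / real (card (?N v)) * (1 - ?r) \<le> measure_pmf.prob (trials V (trial_scales L s)) {Ws. \<exists>u\<in>B v. star_pick (isolates E) v R Ws = {{v, u}}}"
      using B[OF v] by (intro prob_star_pick_scales[OF assms(1-3) refl _ _ assms(4)]) auto
  qed
  also have "\<dots> = measure_pmf.prob (stars_pmf V L s) (Pi V (\<lambda>v. {Ws. \<exists>u\<in>B v. star_pick (isolates E) v R Ws = {{v, u}}}))"
    unfolding stars_pmf_def using assms(1) by (subst measure_Pi_pmf_Pi) auto
  also have "Pi V (\<lambda>v. {Ws. \<exists>u\<in>B v. star_pick (isolates E) v R Ws = {{v, u}}}) =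
     {ws. \<forall>v\<in>V. \<exists>u\<in>B v. star_pick (isolates E) v R (ws v) = {{v, u}}}" by auto
  finally show ?thesis .
qed

section \<open>Sampling the centers\<close>

lemma random_subset_1: "finite A \<Longrightarrow> random_subset A 1 = return_pmf A"
proof (induction A rule: finite_induct)
  case (insert x A)
  have "bernoulli_pmf 1 = return_pmf True"
  proof (rule pmf_eqI)
    show "pmf (bernoulli_pmf 1) b = pmf (return_pmf True) b" for b by (cases b) auto
  qed
  then show ?case using insert by (simp add: random_subset_insert bind_return_pmf)
qed simp

text \<open>A Chernoff bound with base 1/2: Markov's inequality for (1/2)^|R| gives (1 - p/2)^|B|
  exp (p d / 8), at most exp (p d / 8 - p |B| / 2), and |B| is at least d / 2.\<close>

lemma prob_few_neighbours:
  assumes "finite V" "B \<subseteq> V" "0 \<le> p" "p \<le> 1" "d \<le> 2 * real (card B)"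
  shows "measure_pmf.prob (random_subset V p) {R. 8 * real (card (R \<inter> B)) < p * d} \<le> exp (- (p * d / 8))"
proof -
  have fin: "finite B" using assms finite_subset by blast
  have fD: "finite (set_pmf (random_subset B p))" by (rule finite_set_random_subset[OF fin])
  have "measure_pmf.prob (random_subset V p) {R. 8 * real (card (R \<inter> B)) < p * d}
    = measure_pmf.prob (random_subset B p) {R. 8 * real (card R) < p * d}"
    by (rule prob_random_subset_Int[OF assms(1,2), where Q = "\<lambda>X. 8 * real (card X) < p * d"])
  also have "\<dots> \<le> measure_pmf.prob (random_subset B p) {R. exp (- (p * d / 8)) \<le> (1/2) ^ card R}"
  proof (rule prob_mono_support)
    fix R :: "'a set" assume "8 * real (card R) < p * d"
    then have "exp (- (p * d / 8)) \<le> exp (- real (card R))" by simp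
    also have "\<dots> = exp (- 1) ^ card R" by (simp flip: exp_of_nat_mult)
    also have "\<dots> \<le> (1/2) ^ card R"
      using exp_ge_add_one_self[of 1] by (intro power_mono) (auto simp: exp_minus field_simps)
    finally show "exp (- (p * d / 8)) \<le> (1/2) ^ card R" .
  qed
  also have "\<dots> \<le> measure_pmf.expectation (random_subset B p) (\<lambda>R. (1/2) ^ card R) / exp (- (p * d / 8))"
    using fD by (intro prob_ge_le_expectation) auto
  also have "\<dots> = (1 - p / 2) ^ card B * exp (p * d / 8)"
    using expectation_half_power_random_subset[OF fin assms(3,4)] by (simp add: exp_minus field_simps)
  also have "\<dots> \<le> exp (- (p / 2)) ^ card B * exp (p * d / 8)"
    using exp_ge_add_one_self[of "- (p / 2)"] assms(4) by (intro mult_right_mono power_mono) auto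
  also have "\<dots> = exp (p * d / 8 - p * real (card B) / 2)"
    by (simp add: mult_exp_exp algebra_simps flip: exp_of_nat_mult)
  also have "\<dots> \<le> exp (- (p * d / 8))"
    using mult_left_mono[OF assms(5,3)] by (simp add: mult_ac)
  finally show ?thesis .
qed

text \<open>3/8 is 1 - 1/8 - 1/4 - 1/4. The lower bounds at the vertices fail with probability at
  most 2^l * 2^(-4 l) \<le> 1/8 by the tail bound with p d = 32 l; the two upper bounds are four
  times the expectations (or more), so each fails with probability at most 1/4 by Markov's
  inequality.\<close>

lemma prob_good_centers:
  fixes B C :: "'a \<Rightarrow> 'a set"
  assumes "finite V" "2 \<le> card V" "card V \<le> 2 ^ l" "0 < d" "p = min 1 (32 * real l / d)" "1 \<le> l"
    and B: "\<And>v. v \<in> V \<Longrightarrow> B v \<subseteq> V \<and> d \<le> 2 * real (card (B v))"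
    and C: "\<And>v. v \<in> V \<Longrightarrow> C v \<subseteq> V" "(\<Sum>v\<in>V. real (card (C v))) \<le> 2 * d"
  shows "3/8 \<le> measure_pmf.prob (random_subset V p)
     {R. (\<forall>v\<in>V. p * d \<le> 8 * real (card (R \<inter> B v))) \<and>
       ((\<Sum>v\<in>V. real (card (R \<inter> C v))) \<le> 8 * p * d \<and> real (card R) \<le> 4 * p * real (card V))}"
proof -
  let ?D = "random_subset V p"
  have p: "0 < p" "p \<le> 1" using assms by auto
  have fD: "finite (set_pmf ?D)" by (rule finite_set_random_subset[OF assms(1)])
  have n: "real (card V) > 0" using assms by linarith
  have 1: "measure_pmf.prob ?D {R. \<not> (\<forall>v\<in>V. p * d \<le> 8 * real (card (R \<inter> B v)))} \<le> 1/8"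
  \<comment> \<open>For p = 1 the product p d may be smaller than 32 l and the tail bound too weak,
    but then every vertex is a center and nothing is random.\<close>
  proof (cases "p = 1")
    case True
    have "\<forall>v\<in>V. p * d \<le> 8 * real (card (V \<inter> B v))"
    proof
      fix v assume "v \<in> V"
      then have "V \<inter> B v = B v" "d \<le> 2 * real (card (B v))" using B by auto
      then show "p * d \<le> 8 * real (card (V \<inter> B v))" using True by simp
    qed
    then show ?thesis using True by (simp add: random_subset_1[OF assms(1)])
  next
    case False
    then have pd: "p * d = 32 * real l" using assms by (auto simp: min_def split: if_splits)
    have "measure_pmf.prob ?D {R. \<not> (\<forall>v\<in>V. p * d \<le> 8 * real (card (R \<inter> B v)))} =
       measure_pmf.prob ?D {R. \<exists>v\<in>V. 8 * real (card (R \<inter> B v)) < p * d}"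
      by (simp add: not_le)
    also have "\<dots> \<le> (\<Sum>v\<in>V. measure_pmf.prob ?D {R. 8 * real (card (R \<inter> B v)) < p * d})"
      by (rule prob_Ex_le_sum[OF assms(1)])
    also have "\<dots> \<le> (\<Sum>v\<in>V. exp (- (p * d / 8)))"
      using B p by (intro sum_mono prob_few_neighbours[OF assms(1)]) auto
    also have "\<dots> = real (card V) * exp (- 1) ^ (4 * l)" by (simp add: pd flip: exp_of_nat_mult)
    also have "\<dots> \<le> real (card V) * (1/2) ^ (4 * l)"
      using exp_ge_add_one_self[of 1] by (intro mult_left_mono power_mono) (auto simp: exp_minus field_simps)
    also have "\<dots> \<le> 2 ^ l * (1/2) ^ (4 * l)"
    proof (rule mult_right_mono)
      have "real (card V) \<le> real (2 ^ l)" using assms(3) by (simp only: of_nat_le_iff)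
      then show "real (card V) \<le> 2 ^ l" by simp
    qed simp
    also have "\<dots> = (2 * (1/2) ^ 4) ^ l" by (simp only: power_mult power_mult_distrib)
    also have "\<dots> = (1/8) ^ l" by (simp add: power4_eq_xxxx)
    also have "\<dots> \<le> (1/8) ^ 1" using assms(6) by (intro power_decreasing) auto
    finally show ?thesis by simp
  qed
  have card_C: "measure_pmf.expectation ?D (\<lambda>R. real (card (R \<inter> A))) = p * real (card A)" if "A \<subseteq> V" for A
    using expectation_random_subset_Int[OF assms(1) that, of p "\<lambda>X. real (card X)"] p
      expectation_card_random_subset[OF finite_subset[OF that assms(1)], of p] by simp
  have 2: "measure_pmf.prob ?D {R. \<not> (\<Sum>v\<in>V. real (card (R \<inter> C v))) \<le> 8 * p * d} \<le> 1/4"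
  proof -
    have "measure_pmf.prob ?D {R. \<not> (\<Sum>v\<in>V. real (card (R \<inter> C v))) \<le> 8 * p * d}
      \<le> measure_pmf.prob ?D {R. 8 * p * d \<le> (\<Sum>v\<in>V. real (card (R \<inter> C v)))}"
      by (intro measure_pmf.finite_measure_mono) auto
    also have "\<dots> \<le> measure_pmf.expectation ?D (\<lambda>R. \<Sum>v\<in>V. real (card (R \<inter> C v))) / (8 * p * d)"
      using fD p assms(4) by (intro prob_ge_le_expectation) (auto intro: sum_nonneg)
    also have "measure_pmf.expectation ?D (\<lambda>R. \<Sum>v\<in>V. real (card (R \<inter> C v))) = (\<Sum>v\<in>V. p * real (card (C v)))"
      using fD C(1) by (subst Bochner_Integration.integral_sum) (auto simp: integrable_measure_pmf_finite card_C)
    also have "\<dots> / (8 * p * d) \<le> p * (2 * d) / (8 * p * d)"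
      using C(2) p assms(4) by (intro divide_right_mono) (auto simp flip: sum_distrib_left)
    also have "\<dots> = 1/4" using p assms(4) by simp
    finally show ?thesis .
  qed
  have 3: "measure_pmf.prob ?D {R. \<not> real (card R) \<le> 4 * p * real (card V)} \<le> 1/4"
  proof -
    have "measure_pmf.prob ?D {R. \<not> real (card R) \<le> 4 * p * real (card V)}
      \<le> measure_pmf.prob ?D {R. 4 * p * real (card V) \<le> real (card R)}"
      by (intro measure_pmf.finite_measure_mono) auto
    also have "\<dots> \<le> measure_pmf.expectation ?D (\<lambda>R. real (card R)) / (4 * p * real (card V))"
      using fD p n by (intro prob_ge_le_expectation) auto
    also have "\<dots> = 1/4" using expectation_card_random_subset[OF assms(1), of p] p n by simp
    finally show ?thesis .
  qed
  show ?thesis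
    using prob_conj_ge[of ?D "\<lambda>R. (\<Sum>v\<in>V. real (card (R \<inter> C v))) \<le> 8 * p * d" "\<lambda>R. real (card R) \<le> 4 * p * real (card V)"]
      prob_conj_ge[of ?D "\<lambda>R. \<forall>v\<in>V. p * d \<le> 8 * real (card (R \<inter> B v))"
        "\<lambda>R. (\<Sum>v\<in>V. real (card (R \<inter> C v))) \<le> 8 * p * d \<and> real (card R) \<le> 4 * p * real (card V)"]
      prob_Collect_not[of ?D "\<lambda>R. (\<Sum>v\<in>V. real (card (R \<inter> C v))) \<le> 8 * p * d \<and> real (card R) \<le> 4 * p * real (card V)"]
      1 2 3
    by linarith
qed

section \<open>One repetition\<close>

definition clog :: "nat \<Rightarrow> nat" where
  "clog n = nat \<lceil>log 2 (real n)\<rceil>"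

lemma le_two_power_clog: "n \<le> 2 ^ clog n"
proof (cases "n = 0")
  case False
  then have "0 \<le> log 2 (real n)" by simp
  have "real n = 2 powr log 2 (real n)" using False by simp
  also have "\<dots> \<le> 2 powr real (clog n)" unfolding clog_def by (intro powr_mono) linarith+
  also have "\<dots> = real (2 ^ clog n)" by (simp add: powr_realpow)
  finally show ?thesis by (simp only: of_nat_le_iff)
qed simp

lemma log_two_ge_one: "2 \<le> n \<Longrightarrow> 1 \<le> log 2 (real n)"
  using log_le_cancel_iff[of 2 2 "real n"] by simp

lemma clog_ge_one: "2 \<le> n \<Longrightarrow> 1 \<le> clog n"
  using log_two_ge_one[of n] unfolding clog_def by linarith

lemma clog_le: "2 \<le> n \<Longrightarrow> real (clog n) \<le> 2 * log 2 (real n)"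
  using log_two_ge_one[of n] unfolding clog_def by linarith

type_synonym 'a sample = "'a set \<times> ('a \<Rightarrow> 'a set list) \<times> 'a set set \<times> 'a set set set list \<times> 'a set set list"

text \<open>With n \<le> 2^l the constants are: 2 n^2 \<le> 2^s, so every boundary has a fitting
  rate; 12 l sweeps, as 2 (7/8)^12 \<le> 1/2; rate 1 / (8 d), so at most 1/8 of a cut edge is
  expected; 44 l Boruvka steps, as 2 (15/16)^44 \<le> 1/8; 15 l parities for a union bound over
  O(2^(3 l)) tests with n^2 possible edges each.\<close>

definition sample_pmf :: "'a set \<Rightarrow> nat \<Rightarrow> 'a sample pmf" where
  "sample_pmf V d = (let l = clog (card V); s = 2 * l + 1 in
     bind_pmf (random_subset V (min 1 (32 * real l / real d))) (\<lambda>R.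
     bind_pmf (stars_pmf V (12 * l) s) (\<lambda>ws.
     bind_pmf (random_subset (pairs V) (1 / (8 * real d))) (\<lambda>P.
     bind_pmf (replicate_pmf (44 * l) (scales_pmf V s)) (\<lambda>Qss.
     bind_pmf (parity_pmf V (15 * l)) (\<lambda>Zs. return_pmf (R, ws, P, Qss, Zs)))))))"

definition star_edges :: "'a set \<Rightarrow> ('a set \<Rightarrow> 'a set set \<Rightarrow> 'a set \<Rightarrow> bool) \<Rightarrow> 'a set \<Rightarrow> ('a \<Rightarrow> 'a set list) \<Rightarrow> 'a set set" where
  "star_edges V fn R ws = (\<Union>v\<in>V. star_pick fn v R (ws v))"

definition contracted ::
    "'a set \<Rightarrow> ('a set \<Rightarrow> 'a set set \<Rightarrow> 'a set \<Rightarrow> bool) \<Rightarrow> 'a set \<Rightarrow> ('a \<Rightarrow> 'a set list) \<Rightarrow> 'a set set \<Rightarrow> 'a set set set list \<Rightarrow> 'a set set" where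
  "contracted V fn R ws P Qss = star_edges V fn R ws \<union> fold (boruvka_step V fn P) Qss {}"

definition forest :: "'a set \<Rightarrow> 'a set set \<Rightarrow> 'a sample \<Rightarrow> 'a set set" where
  "forest V E = (\<lambda>(R, ws, P, Qss, Zs). contracted V (detects E Zs) R ws P Qss)"

text \<open>
  The pairs (A, X) on which the process consults its detection predicate. Evaluated with the exact
  predicate, this set is independent of the random parities, so a union bound over it shows that
  all detections made with parities are correct.
\<close>

primrec boruvka_tests ::
    "'a set \<Rightarrow> ('a set \<Rightarrow> 'a set set \<Rightarrow> 'a set \<Rightarrow> bool) \<Rightarrow> 'a set set \<Rightarrow> 'a set set set list \<Rightarrow> 'a set set \<Rightarrow> ('a set \<times> 'a set set) set" where
  "boruvka_tests V fn P [] F = {}"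
| "boruvka_tests V fn P (Qs # Qss) F = comps V F \<times> (\<inter>) P ` Qs \<union> boruvka_tests V fn P Qss (boruvka_step V fn P Qs F)"

definition star_tests :: "'a set \<Rightarrow> 'a set \<Rightarrow> ('a \<Rightarrow> 'a set list) \<Rightarrow> ('a set \<times> 'a set set) set" where
  "star_tests V R ws = (\<Union>v\<in>V. (\<lambda>W. ({v}, star v (R \<inter> W))) ` set (ws v))"

lemma star_pick_cong:
  "(\<And>W e. W \<in> set Ws \<Longrightarrow> fn {v} (star v (R \<inter> W)) e = fn' {v} (star v (R \<inter> W)) e) \<Longrightarrow>
    star_pick fn v R Ws = star_pick fn' v R Ws"
  by (induction Ws) auto

text \<open>As long as the predicates agree, both runs hold the same F, so agreement on the tests of
  the run with \<open>fn'\<close> is enough to keep them together.\<close>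

lemma boruvka_cong:
  "(\<And>A X e. (A, X) \<in> boruvka_tests V fn' P Qss F \<Longrightarrow> fn A X e = fn' A X e) \<Longrightarrow>
    fold (boruvka_step V fn P) Qss F = fold (boruvka_step V fn' P) Qss F"
proof (induction Qss arbitrary: F)
  case (Cons Qs Qss)
  have "boruvka_step V fn P Qs F = boruvka_step V fn' P Qs F"
    unfolding boruvka_step_def using Cons.prems by auto
  then show ?case using Cons by simp
qed simp

lemma contracted_cong:
  assumes "\<And>A X e. (A, X) \<in> star_tests V R ws \<union> boruvka_tests V fn' P Qss {} \<Longrightarrow> fn A X e = fn' A X e"
  shows "contracted V fn R ws P Qss = contracted V fn' R ws P Qss"
proof -
  have "star_pick fn v R (ws v) = star_pick fn' v R (ws v)" if "v \<in> V" for v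
    using that by (intro star_pick_cong assms) (auto simp: star_tests_def)
  then show ?thesis unfolding contracted_def star_edges_def
    using boruvka_cong[of V fn' P Qss "{}" fn] assms by simp
qed

lemma boruvka_tests_subset: "(A, X) \<in> boruvka_tests V fn P Qss F \<Longrightarrow> X \<subseteq> P \<and> A \<subseteq> V"
  by (induction Qss arbitrary: F) (auto dest: comps_subset)

lemma finite_boruvka_tests:
  assumes "finite V" "\<And>Qs. Qs \<in> set Qss \<Longrightarrow> finite Qs \<and> card Qs \<le> m"
  shows "finite (boruvka_tests V fn P Qss F) \<and> card (boruvka_tests V fn P Qss F) \<le> length Qss * (card V * m)"
  using assms(2)
proof (induction Qss arbitrary: F)
  case (Cons Qs Qss)
  let ?T = "boruvka_tests V fn P Qss (boruvka_step V fn P Qs F)"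
  have IH: "finite ?T" "card ?T \<le> length Qss * (card V * m)" using Cons by auto
  have Qs: "finite Qs" "card Qs \<le> m" using Cons.prems by auto
  have "card (comps V F \<times> (\<inter>) P ` Qs) \<le> card V * m"
    unfolding card_cartesian_product using card_comps_le[OF assms(1), of F] card_image_le[OF Qs(1), of "(\<inter>) P"] Qs(2)
    by (intro mult_mono) auto
  moreover have "card (comps V F \<times> (\<inter>) P ` Qs \<union> ?T) \<le> card (comps V F \<times> (\<inter>) P ` Qs) + card ?T"
    by (rule card_Un_le)
  ultimately show ?case using IH Qs finite_comps[OF assms(1)] by simp
qed simp

lemma card_star_tests:
  assumes "finite V" "\<And>v. v \<in> V \<Longrightarrow> length (ws v) \<le> m"
  shows "finite (star_tests V R ws) \<and> card (star_tests V R ws) \<le> card V * m"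
proof -
  have "card (star_tests V R ws) \<le> (\<Sum>v\<in>V. card ((\<lambda>W. ({v}, star v (R \<inter> W))) ` set (ws v)))"
    unfolding star_tests_def by (rule card_UN_le[OF assms(1)])
  also have "\<dots> \<le> (\<Sum>v\<in>V. m)"
  proof (rule sum_mono)
    fix v assume "v \<in> V"
    then show "card ((\<lambda>W. ({v}, star v (R \<inter> W))) ` set (ws v)) \<le> m"
      using card_image_le[of "set (ws v)" "\<lambda>W. ({v}, star v (R \<inter> W))"] card_length[of "ws v"] assms(2)[of v] by auto
  qed
  finally show ?thesis using assms(1) by (simp add: star_tests_def)
qed

lemma length_trials: "Ws \<in> set_pmf (trials V js) \<Longrightarrow> length Ws = length js"
  by (induction js arbitrary: Ws) auto

lemma set_stars_pmf:
  assumes "finite V" "ws \<in> set_pmf (stars_pmf V L s)" "v \<in> V"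
  shows "length (ws v) = L * Suc s"
proof -
  have "ws v \<in> set_pmf (trials V (trial_scales L s))"
    using assms by (auto simp: stars_pmf_def set_Pi_pmf PiE_dflt_def)
  then show ?thesis by (simp add: length_trials length_trial_scales)
qed

lemma set_scales_pmf: "Qs \<in> set_pmf (scales_pmf V s) \<Longrightarrow> finite Qs \<and> card Qs \<le> Suc s"
  unfolding scales_pmf_def using card_image_le[of "{..s}"] by auto

lemma prob_all_detected:
  assumes "finite V" "E \<subseteq> pairs V" "finite \<T>" "\<And>A X. (A, X) \<in> \<T> \<Longrightarrow> X \<subseteq> pairs V"
  shows "1 - real (card \<T>) * (real (card V) ^ 2 / 2 ^ t) \<le>
    measure_pmf.prob (parity_pmf V t) {Zs. \<forall>(A, X)\<in>\<T>. \<forall>e. detects E Zs A X e = isolates E A X e}"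
proof -
  have "measure_pmf.prob (parity_pmf V t) {Zs. \<exists>q\<in>\<T>. \<not> (\<forall>e. detects E Zs (fst q) (snd q) e = isolates E (fst q) (snd q) e)}
    \<le> (\<Sum>q\<in>\<T>. measure_pmf.prob (parity_pmf V t) {Zs. \<not> (\<forall>e. detects E Zs (fst q) (snd q) e = isolates E (fst q) (snd q) e)})"
    by (rule prob_Ex_le_sum[OF assms(3)])
  also have "\<dots> \<le> (\<Sum>q\<in>\<T>. real (card V) ^ 2 / 2 ^ t)"
    by (intro sum_mono prob_detects_wrong[OF assms(1,2)]) (metis assms(4) prod.collapse)
  finally have "measure_pmf.prob (parity_pmf V t) {Zs. \<exists>q\<in>\<T>. \<not> (\<forall>e. detects E Zs (fst q) (snd q) e = isolates E (fst q) (snd q) e)}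
    \<le> real (card \<T>) * (real (card V) ^ 2 / 2 ^ t)" by simp
  moreover have "{Zs. \<exists>q\<in>\<T>. \<not> (\<forall>e. detects E Zs (fst q) (snd q) e = isolates E (fst q) (snd q) e)} =
     {Zs. \<not> (\<forall>(A, X)\<in>\<T>. \<forall>e. detects E Zs A X e = isolates E A X e)}" by (simp add: case_prod_beta)
  ultimately show ?thesis by (simp only: prob_Collect_not)
qed

lemma fold_boruvka_subset:
  "F \<subseteq> E \<inter> P \<Longrightarrow> fold (boruvka_step V (isolates E) P) Qss F \<subseteq> E \<inter> P"
proof (induction Qss arbitrary: F)
  case (Cons Qs Qss)
  then show ?case using boruvka_step_subset[of F E P V Qs] by simp
qed simp

text \<open>Four times the bound 8 d * 4 p n \<le> 1024 l n on the expected number of remaining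
  edges, where l = \<open>clog n\<close>; Markov's inequality then costs 1/4.\<close>

definition inter_bound :: "nat \<Rightarrow> nat" where
  "inter_bound n = 4096 * clog n * n"

text \<open>One factor for each random choice: centers, picks, sampled edges, Boruvka steps, parities.\<close>

definition success_rate :: real where
  "success_rate = 3/8 * (exp (-64) / 2 * (1/2 * (7/8 * (1/2))))"

text \<open>S stands for a fixed minimum cut and d for the minimum degree. The random choices are
  treated in the order in which they are drawn, each conditioned on good outcomes of the earlier
  ones; what remains is a deterministic argument.\<close>

lemma prob_good_forest:
  fixes V :: "'a set"
  assumes "finite V" "2 \<le> card V" "E \<subseteq> pairs V" "S \<subseteq> V" "0 < d"
    and same: "\<And>v. v \<in> V \<Longrightarrow> d \<le> 2 * card {u \<in> V. {v, u} \<in> E \<and> (u \<in> S) = (v \<in> S)}"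
    and cross: "(\<Sum>v\<in>V. card {u \<in> V. {v, u} \<in> E \<and> (u \<in> S) \<noteq> (v \<in> S)}) \<le> 2 * d"
    and cut: "card (boundary E S) \<le> d"
  shows "success_rate \<le> measure_pmf.prob (sample_pmf V d)
    {w. boundary (forest V E w) S = {} \<and> forest V E w \<subseteq> pairs V \<and> card (inter_edges V E (forest V E w)) \<le> inter_bound (card V)}"
    (is "_ \<le> measure_pmf.prob _ ?Good")
proof -
  define n l s where "n = card V" and "l = clog n" and "s = 2 * l + 1"
  define p where "p = min 1 (32 * real l / real d)"
  have n2: "2 \<le> n" and l1: "1 \<le> l" using assms(2) clog_ge_one by (simp_all add: n_def l_def)
  have nl: "n \<le> 2 ^ l" using le_two_power_clog by (simp add: l_def)
  then have "real n \<le> real (2 ^ l)" by (simp only: of_nat_le_iff)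
  then have nlr: "real n \<le> 2 ^ l" by simp
  have fP: "finite (pairs V)" by (rule finite_pairs[OF assms(1)])
  have fE: "finite E" using assms(3) fP finite_subset by blast
  have p: "0 < p" "p \<le> 1" using l1 assms(5) by (auto simp: p_def)
  have pd: "p * real d \<le> 32 * real l"
  proof -
    have "p * real d \<le> 32 * real l / real d * real d" by (intro mult_right_mono) (auto simp: p_def)
    then show ?thesis using assms(5) by simp
  qed
  define B where "B v = {u \<in> V. {v, u} \<in> E \<and> (u \<in> S) = (v \<in> S)}" for v
  define C where "C v = {u \<in> V. {v, u} \<in> E \<and> (u \<in> S) \<noteq> (v \<in> S)}" for v
  define RG where "RG = {R. (\<forall>v\<in>V. p * real d \<le> 8 * real (card (R \<inter> B v))) \<and>
       ((\<Sum>v\<in>V. real (card (R \<inter> C v))) \<le> 8 * p * real d \<and> real (card R) \<le> 4 * p * real (card V))}"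
  have step1: "3/8 \<le> measure_pmf.prob (random_subset V p) RG"
    unfolding RG_def
  proof (rule prob_good_centers[OF assms(1,2) _ _ _ l1])
    show "card V \<le> 2 ^ l" using nl by (simp add: n_def)
    show "p = min 1 (32 * real l / real d)" by (rule p_def)
    show "0 < real d" using assms(5) by simp
    show "B v \<subseteq> V \<and> real d \<le> 2 * real (card (B v))" if "v \<in> V" for v
      using same[OF that] by (auto simp: B_def)
    show "C v \<subseteq> V" for v by (auto simp: C_def)
    have "real (\<Sum>v\<in>V. card (C v)) \<le> real (2 * d)" using cross by (simp only: of_nat_le_iff C_def)
    then show "(\<Sum>v\<in>V. real (card (C v))) \<le> 2 * real d" by simp
  qed
  define WG where "WG R = {ws. \<forall>v\<in>V. \<exists>u\<in>R \<inter> B v. star_pick (isolates E) v R (ws v) = {{v, u}}}" for R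
  have step2: "exp (-64) / 2 \<le> measure_pmf.prob (stars_pmf V (12 * l) s) (WG R)"
    if R: "R \<in> RG" "R \<in> set_pmf (random_subset V p)" for R
  proof -
    have RV: "R \<subseteq> V" using R(2) set_random_subset by blast
    have large: "p * real d \<le> 8 * real (card (R \<inter> B v))" if "v \<in> V" for v using R(1) that by (simp add: RG_def)
    have pd0: "0 < p * real d" using p assms(5) by simp
    have "(\<Sum>v\<in>V. real (card ({u \<in> R. {v, u} \<in> E} - (R \<inter> B v))) / real (card (R \<inter> B v)))
      \<le> (\<Sum>v\<in>V. real (card (R \<inter> C v)) * (8 / (p * real d)))"
    proof (rule sum_mono)
      fix v assume v: "v \<in> V"
      have "{u \<in> R. {v, u} \<in> E} - (R \<inter> B v) = R \<inter> C v" using RV by (auto simp: B_def C_def)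
      moreover have "1 / real (card (R \<inter> B v)) \<le> 8 / (p * real d)"
        using large[OF v] pd0 by (simp add: divide_simps)
      ultimately show "real (card ({u \<in> R. {v, u} \<in> E} - (R \<inter> B v))) / real (card (R \<inter> B v)) \<le> real (card (R \<inter> C v)) * (8 / (p * real d))"
        using mult_left_mono[of "1 / real (card (R \<inter> B v))" "8 / (p * real d)" "real (card (R \<inter> C v))"] by simp
    qed
    also have "\<dots> = (\<Sum>v\<in>V. real (card (R \<inter> C v))) * (8 / (p * real d))" by (simp only: sum_distrib_right)
    also have "\<dots> \<le> (8 * p * real d) * (8 / (p * real d))"
      using R(1) pd0 by (intro mult_right_mono) (auto simp: RG_def)
    also have "\<dots> = 64" using p(1) assms(5) by simp
    finally have "exp (-64) / 2 \<le> exp (- (\<Sum>v\<in>V. real (card ({u \<in> R. {v, u} \<in> E} - (R \<inter> B v))) / real (card (R \<inter> B v)))) / 2"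
      by simp
    also have "\<dots> \<le> measure_pmf.prob (stars_pmf V (12 * l) s) (WG R)"
      unfolding WG_def
    proof (rule prob_stars[OF assms(1,3) RV])
      have "2 * card V \<le> 2 * 2 ^ l" using nl by (simp add: n_def)
      also have "\<dots> \<le> 2 ^ s" by (simp add: s_def)
      finally show "2 * card V \<le> 2 ^ s" .
      have "(7/8) ^ (12 * l) * real (card V) \<le> ((7/8) ^ 12) ^ l * 2 ^ l"
        using nlr by (intro mult_mono) (auto simp: power_mult n_def)
      also have "\<dots> = ((7/8) ^ 12 * 2) ^ l" by (simp only: power_mult_distrib)
      also have "\<dots> \<le> (1/2) ^ l" by (intro power_mono) (auto simp: power_divide)
      also have "\<dots> \<le> (1/2) ^ 1" using l1 by (intro power_decreasing) auto
      finally show "(7/8) ^ (12 * l) * real (card V) \<le> 1/2" by simp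
      show "R \<inter> B v \<noteq> {} \<and> R \<inter> B v \<subseteq> {u \<in> R. {v, u} \<in> E}" if "v \<in> V" for v
        using large[OF that] pd0 by (auto simp: B_def)
    qed
    finally show ?thesis .
  qed
  define r where "r = 1 / (8 * real d)"
  have r: "0 < r" "r \<le> 1" using assms(5) by (auto simp: r_def divide_simps)
  \<comment> \<open>Two negated Markov events. For natural numbers they say that no cut edge is
    sampled and that at most \<open>inter_bound n\<close> edges remain.\<close>
  define PG where "PG R ws = {P. \<not> 1 \<le> real (card (P \<inter> boundary E S)) \<and>
     \<not> real (inter_bound n) + 1 \<le> real (card (inter_edges V E (star_edges V (isolates E) R ws \<union> (P \<inter> E))))}" for R ws
  have star_props: "star_edges V (isolates E) R ws \<subseteq> E" "boundary (star_edges V (isolates E) R ws) S = {}"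
      "card (comps V (star_edges V (isolates E) R ws)) \<le> card R"
    if R: "R \<in> RG" "R \<in> set_pmf (random_subset V p)" and ws: "ws \<in> WG R" for R ws
  proof -
    let ?F = "star_edges V (isolates E) R ws"
    have RV: "R \<subseteq> V" using R(2) set_random_subset by blast
    have pick: "\<exists>u\<in>R \<inter> B v. star_pick (isolates E) v R (ws v) = {{v, u}}" if "v \<in> V" for v
      using ws that by (simp add: WG_def)
    have edge: "\<exists>v u. e = {v, u} \<and> v \<in> V \<and> u \<in> B v" if eF: "e \<in> ?F" for e
    proof -
      obtain v where "v \<in> V" "e \<in> star_pick (isolates E) v R (ws v)" using eF by (auto simp: star_edges_def)
      then show ?thesis using pick[of v] by auto
    qed
    show sub: "?F \<subseteq> E" using edge by (fastforce simp: B_def)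
    show "boundary ?F S = {}"
    proof (rule ccontr)
      assume "boundary ?F S \<noteq> {}"
      then obtain e where e: "e \<in> boundary ?F S" by blast
      then obtain v u where vu: "e = {v, u}" "u \<in> B v" using edge[of e] boundary_subset[of ?F S] by blast
      have "e \<in> pairs V" using e boundary_subset[of ?F S] sub assms(3) by blast
      then have "v \<noteq> u" using vu by simp
      then show False using e vu by (simp add: B_def)
    qed
    \<comment> \<open>Each vertex is joined to the center it picked, so each block contains a
      center.\<close>
    have "comps V ?F \<subseteq> comp_of V ?F ` R"
    proof
      fix A assume "A \<in> comps V ?F"
      then obtain v where v: "v \<in> V" "A = comp_of V ?F v" by (auto simp: comps_def)
      obtain u where u: "u \<in> R" "star_pick (isolates E) v R (ws v) = {{v, u}}" using pick[OF v(1)] by blast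
      then have "{v, u} \<in> ?F" using v(1) by (auto simp: star_edges_def)
      then have "A = comp_of V ?F u" using v(2) comp_of_eq_edge by metis
      then show "A \<in> comp_of V ?F ` R" using u(1) by blast
    qed
    then show "card (comps V ?F) \<le> card R"
      using finite_subset[OF RV assms(1)] by (rule surj_card_le[rotated])
  qed
  have step3: "1/2 \<le> measure_pmf.prob (random_subset (pairs V) r) (PG R ws)"
    if R: "R \<in> RG" "R \<in> set_pmf (random_subset V p)" and ws: "ws \<in> WG R" for R ws
  proof -
    let ?D = "random_subset (pairs V) r" and ?F = "star_edges V (isolates E) R ws"
    have fD: "finite (set_pmf ?D)" by (rule finite_set_random_subset[OF fP])
    have bE: "boundary E S \<subseteq> pairs V" using boundary_subset[of E S] assms(3) by blast
    have "measure_pmf.prob ?D {P. 1 \<le> real (card (P \<inter> boundary E S))}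
      \<le> measure_pmf.expectation ?D (\<lambda>P. real (card (P \<inter> boundary E S))) / 1"
      using fD by (intro prob_ge_le_expectation) auto
    also have "\<dots> = r * real (card (boundary E S))"
      using expectation_random_subset_Int[OF fP bE, of r "\<lambda>X. real (card X)"] r
        expectation_card_random_subset[OF finite_subset[OF bE fP], of r] by simp
    also have "\<dots> \<le> r * real d" using cut r by simp
    also have "\<dots> = 1/8" using assms(5) by (simp add: r_def)
    finally have a: "measure_pmf.prob ?D {P. 1 \<le> real (card (P \<inter> boundary E S))} \<le> 1/8" .
    let ?X = "measure_pmf.expectation ?D (\<lambda>P. real (card (inter_edges V E (?F \<union> (P \<inter> E)))))"
    have "r * ?X \<le> real (card (comps V ?F))"
      using expectation_inter_edges[OF assms(1) _ r(2) assms(3), of ?F] r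
        expectation_random_subset_Int[OF fP assms(3), of r "\<lambda>X. real (card (inter_edges V E (?F \<union> X)))"] by simp
    also have "\<dots> \<le> real (card R)" using star_props(3)[OF R ws] by simp
    also have "\<dots> \<le> 4 * p * real n" using R(1) by (simp add: RG_def n_def)
    finally have "?X \<le> 8 * real d * (4 * p * real n)" using assms(5) by (simp add: r_def field_simps)
    also have "\<dots> = 32 * real n * (p * real d)" by simp
    also have "\<dots> \<le> 32 * real n * (32 * real l)" using pd by (intro mult_left_mono) auto
    finally have X: "?X \<le> 1024 * real l * real n" by (simp add: mult_ac)
    have M: "real (inter_bound n) = 4096 * real l * real n" by (simp add: inter_bound_def l_def)
    have "measure_pmf.prob ?D {P. real (inter_bound n) + 1 \<le> real (card (inter_edges V E (?F \<union> (P \<inter> E))))}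
      \<le> ?X / (real (inter_bound n) + 1)"
      using fD by (intro prob_ge_le_expectation) auto
    also have "\<dots> \<le> (1024 * real l * real n) / (4096 * real l * real n)"
      using X n2 l1 unfolding M by (intro frac_le) auto
    also have "\<dots> = 1/4" using n2 l1 by simp
    finally have b: "measure_pmf.prob ?D {P. real (inter_bound n) + 1 \<le> real (card (inter_edges V E (?F \<union> (P \<inter> E))))} \<le> 1/4" .
    show ?thesis unfolding PG_def using a b
      prob_conj_ge[of ?D "\<lambda>P. \<not> 1 \<le> real (card (P \<inter> boundary E S))"
        "\<lambda>P. \<not> real (inter_bound n) + 1 \<le> real (card (inter_edges V E (?F \<union> (P \<inter> E))))"]
      unfolding not_not by linarith
  qed
  \<comment> \<open>Fewer than one open component means none: the steps have found the components of
    the sampled graph.\<close>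
  define QG where "QG P = {Qss. \<not> 1 \<le> real (card (open_comps V (E \<inter> P) (fold (boruvka_step V (isolates E) P) Qss {})))}" for P
  have step4: "7/8 \<le> measure_pmf.prob (replicate_pmf (44 * l) (scales_pmf V s)) (QG P)" for P
  proof -
    let ?D = "replicate_pmf (44 * l) (scales_pmf V s)"
    have fD: "finite (set_pmf ?D)" by (intro finite_set_replicate_pmf finite_set_scales_pmf assms(1))
    have "2 * card V ^ 2 \<le> 2 * (2 ^ l) ^ 2" using nl by (intro mult_left_mono power_mono) (auto simp: n_def)
    also have "\<dots> = 2 ^ s" by (simp add: s_def flip: power_mult add: mult.commute)
    finally have s: "2 * card V ^ 2 \<le> 2 ^ s" .
    have "measure_pmf.prob ?D {Qss. 1 \<le> real (card (open_comps V (E \<inter> P) (fold (boruvka_step V (isolates E) P) Qss {})))}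
      \<le> measure_pmf.expectation ?D (\<lambda>Qss. real (card (open_comps V (E \<inter> P) (fold (boruvka_step V (isolates E) P) Qss {})))) / 1"
      using fD by (intro prob_ge_le_expectation) auto
    also have "\<dots> \<le> (15/16) ^ (44 * l) * real (card (open_comps V (E \<inter> P) {}))"
      using expectation_boruvka[OF assms(1,3) s, of "44 * l" P "{}"] by simp
    also have "\<dots> \<le> ((15/16) ^ 44) ^ l * 2 ^ l"
    proof (rule mult_mono)
      have "card (open_comps V (E \<inter> P) {}) \<le> card (comps V {})"
        using finite_comps[OF assms(1)] by (intro card_mono) (auto simp: open_comps_def)
      also have "\<dots> \<le> n" using card_comps_le[OF assms(1)] by (simp add: n_def)
      finally show "real (card (open_comps V (E \<inter> P) {})) \<le> 2 ^ l" using nlr by linarith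
    qed (auto simp: power_mult)
    also have "\<dots> = ((15/16) ^ 44 * 2) ^ l" by (simp only: power_mult_distrib)
    also have "\<dots> \<le> (1/8) ^ l" by (intro power_mono) (auto simp: power_divide)
    also have "\<dots> \<le> (1/8) ^ 1" using l1 by (intro power_decreasing) auto
    finally show ?thesis unfolding QG_def prob_Collect_not by simp
  qed
  \<comment> \<open>The tests of the exact run; no parity set enters, so they are fixed before Zs is
    drawn.\<close>
  define TT where "TT R ws P Qss = star_tests V R ws \<union> boruvka_tests V (isolates E) P Qss {}" for R ws P Qss
  define ZG where "ZG R ws P Qss = {Zs. \<forall>(A, X)\<in>TT R ws P Qss. \<forall>e. detects E Zs A X e = isolates E A X e}" for R ws P Qss
  have step5: "1/2 \<le> measure_pmf.prob (parity_pmf V (15 * l)) (ZG R ws P Qss)"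
    if "R \<in> set_pmf (random_subset V p)" "ws \<in> set_pmf (stars_pmf V (12 * l) s)"
      "P \<in> set_pmf (random_subset (pairs V) r)" "Qss \<in> set_pmf (replicate_pmf (44 * l) (scales_pmf V s))" for R ws P Qss
  proof -
    have RV: "R \<subseteq> V" and PV: "P \<subseteq> pairs V" using that(1,3) set_random_subset by blast+
    have Q: "length Qss = 44 * l" "Qs \<in> set Qss \<Longrightarrow> finite Qs \<and> card Qs \<le> Suc s" for Qs
      using that(4) set_scales_pmf by (auto simp: set_replicate_pmf)
    have t1: "finite (star_tests V R ws)" "card (star_tests V R ws) \<le> n * (12 * l * Suc s)"
      using card_star_tests[OF assms(1), of ws "12 * l * Suc s" R] set_stars_pmf[OF assms(1) that(2)] by (auto simp: n_def)
    have t2: "finite (boruvka_tests V (isolates E) P Qss {})" "card (boruvka_tests V (isolates E) P Qss {}) \<le> 44 * l * (n * Suc s)"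
      using finite_boruvka_tests[OF assms(1), of Qss "Suc s" "isolates E" P "{}"] Q by (auto simp: n_def)
    have fT: "finite (TT R ws P Qss)" using t1 t2 by (simp add: TT_def)
    have "card (TT R ws P Qss) \<le> n * (12 * l * Suc s) + 44 * l * (n * Suc s)"
      unfolding TT_def using card_Un_le[of "star_tests V R ws" "boruvka_tests V (isolates E) P Qss {}"] t1 t2 by linarith
    also have "\<dots> = 56 * (n * l * Suc s)" by (simp add: algebra_simps)
    also have "\<dots> \<le> 56 * (2 ^ l * 2 ^ l * (4 * 2 ^ l))"
    proof (intro mult_left_mono mult_mono)
      have "l < 2 ^ l" by (rule less_exp)
      then show "l \<le> 2 ^ l" by simp
      moreover have "(1::nat) \<le> 2 ^ l" by simp
      ultimately show "Suc s \<le> 4 * 2 ^ l" unfolding s_def by linarith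
    qed (use nl in auto)
    finally have "real (card (TT R ws P Qss)) \<le> real (56 * (2 ^ l * 2 ^ l * (4 * 2 ^ l)))" by (simp only: of_nat_le_iff)
    then have T: "real (card (TT R ws P Qss)) \<le> 224 * (2 ^ l) ^ 3" by (simp add: power3_eq_cube)
    \<comment> \<open>Tests contribute 2^(3 l) and possible edges 2^(2 l); of the 15 l parities 10 l
      are left against the constant 224.\<close>
    have "real (card (TT R ws P Qss)) * (real (card V) ^ 2 / 2 ^ (15 * l)) \<le> (224 * (2 ^ l) ^ 3) * ((2 ^ l) ^ 2 / 2 ^ (15 * l))"
      using T nlr by (intro mult_mono divide_right_mono power_mono) (auto simp: n_def)
    also have "\<dots> = 224 / 2 ^ (10 * l)"
    proof -
      have "(2::real) ^ (15 * l) = (2 ^ l) ^ 3 * (2 ^ l) ^ 2 * 2 ^ (10 * l)"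
        by (simp flip: power_mult power_add)
      moreover have "(2::real) ^ l \<noteq> 0" by simp
      moreover have "224 * a ^ 3 * (a\<^sup>2 / (a ^ 3 * a\<^sup>2 * b)) = 224 / b" if "a \<noteq> 0" for a b :: real
        using that by (cases "b = 0") (auto simp: field_simps)
      ultimately show ?thesis by (simp only:)
    qed
    also have "\<dots> \<le> 224 / 2 ^ (10 * 1)" using l1 by (intro divide_left_mono power_increasing) auto
    also have "\<dots> \<le> 1/2" by simp
    finally have "real (card (TT R ws P Qss)) * (real (card V) ^ 2 / 2 ^ (15 * l)) \<le> 1/2" .
    moreover have sub: "X \<subseteq> pairs V" if AX: "(A, X) \<in> TT R ws P Qss" for A X
    proof (cases "(A, X) \<in> star_tests V R ws")
      case True
      then obtain v W where "v \<in> V" "X = star v (R \<inter> W)" by (auto simp: star_tests_def)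
      moreover have "R \<inter> W \<subseteq> V" using RV by blast
      ultimately show ?thesis using star_subset_pairs by metis
    next
      case False
      then have "(A, X) \<in> boruvka_tests V (isolates E) P Qss {}" using AX by (simp add: TT_def)
      then have "X \<subseteq> P" using boruvka_tests_subset by metis
      then show ?thesis using PV by blast
    qed
    moreover have "1 - real (card (TT R ws P Qss)) * (real (card V) ^ 2 / 2 ^ (15 * l))
        \<le> measure_pmf.prob (parity_pmf V (15 * l)) (ZG R ws P Qss)"
      unfolding ZG_def by (rule prob_all_detected[OF assms(1,3) fT]) (rule sub)
    ultimately show ?thesis by linarith
  qed
  have good: "(R, ws, P, Qss, Zs) \<in> ?Good"
    if R: "R \<in> RG" "R \<in> set_pmf (random_subset V p)" and ws: "ws \<in> WG R" and P: "P \<in> PG R ws"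
      and Q: "Qss \<in> QG P" and Z: "Zs \<in> ZG R ws P Qss" for R ws P Qss Zs
  proof -
    let ?Fs = "star_edges V (isolates E) R ws" and ?Fb = "fold (boruvka_step V (isolates E) P) Qss {}"
    \<comment> \<open>The parities answer every test of the exact run correctly, so the run with
      parities never departs from it.\<close>
    have forest: "forest V E (R, ws, P, Qss, Zs) = ?Fs \<union> ?Fb"
      unfolding forest_def prod.case
      by (subst contracted_cong[where fn' = "isolates E"]) (use Z in \<open>auto simp: ZG_def TT_def contracted_def\<close>)
    have Fb: "?Fb \<subseteq> E \<inter> P" by (rule fold_boruvka_subset) simp
    have "finite (boundary E S)" using fE boundary_subset finite_subset by metis
    then have bP: "P \<inter> boundary E S = {}" using P by (auto simp: PG_def card_eq_0_iff not_le)
    have "boundary ?Fb S \<subseteq> P \<inter> boundary E S" using Fb by (auto simp: boundary_def)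
    then have bd: "boundary (?Fs \<union> ?Fb) S = {}" using bP star_props(2)[OF R ws] by (auto simp: boundary_def)
    have sub: "?Fs \<union> ?Fb \<subseteq> pairs V" using star_props(1)[OF R ws] Fb assms(3) by blast
    have "finite (open_comps V (E \<inter> P) ?Fb)" using finite_comps[OF assms(1)] by (simp add: open_comps_def)
    then have "open_comps V (E \<inter> P) ?Fb = {}" using Q by (auto simp: QG_def card_eq_0_iff not_le)
    then have "E \<inter> P \<subseteq> {{u, v} |u v. (u, v) \<in> (adj ?Fb)\<^sup>*}"
      using assms(3) by (intro open_comps_empty_connected[of _ V]) auto
    then have "inter_edges V E (?Fs \<union> ?Fb) \<subseteq> inter_edges V E (?Fs \<union> (E \<inter> P))"
      by (intro inter_edges_antimono[OF assms(3)] adj_rtrancl_absorb)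
    then have "card (inter_edges V E (?Fs \<union> ?Fb)) \<le> card (inter_edges V E (?Fs \<union> (E \<inter> P)))"
      using fE inter_edges_subset[of V E "?Fs \<union> (E \<inter> P)"] by (meson card_mono finite_subset)
    also have "\<dots> \<le> inter_bound n" using P by (simp add: PG_def Int_commute)
    finally show ?thesis using bd sub forest by (simp add: n_def)
  qed
  have sample: "sample_pmf V d = bind_pmf (random_subset V p) (\<lambda>R. bind_pmf (stars_pmf V (12 * l) s) (\<lambda>ws.
     bind_pmf (random_subset (pairs V) r) (\<lambda>P. bind_pmf (replicate_pmf (44 * l) (scales_pmf V s)) (\<lambda>Qss.
     bind_pmf (parity_pmf V (15 * l)) (\<lambda>Zs. return_pmf (R, ws, P, Qss, Zs))))))"
    by (simp add: sample_pmf_def Let_def p_def r_def s_def l_def n_def)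
  show ?thesis
    unfolding sample success_rate_def
  proof (rule prob_bind_ge[OF step1], simp)
    fix R assume R: "R \<in> RG" "R \<in> set_pmf (random_subset V p)"
    show "exp (-64) / 2 * (1/2 * (7/8 * (1/2))) \<le> measure_pmf.prob (bind_pmf (stars_pmf V (12 * l) s) (\<lambda>ws.
     bind_pmf (random_subset (pairs V) r) (\<lambda>P. bind_pmf (replicate_pmf (44 * l) (scales_pmf V s)) (\<lambda>Qss.
     bind_pmf (parity_pmf V (15 * l)) (\<lambda>Zs. return_pmf (R, ws, P, Qss, Zs)))))) ?Good"
    proof (rule prob_bind_ge[OF step2[OF R]], simp)
      fix ws assume ws: "ws \<in> WG R" "ws \<in> set_pmf (stars_pmf V (12 * l) s)"
      show "1/2 * (7/8 * (1/2)) \<le> measure_pmf.prob (bind_pmf (random_subset (pairs V) r) (\<lambda>P.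
        bind_pmf (replicate_pmf (44 * l) (scales_pmf V s)) (\<lambda>Qss.
        bind_pmf (parity_pmf V (15 * l)) (\<lambda>Zs. return_pmf (R, ws, P, Qss, Zs))))) ?Good"
      proof (rule prob_bind_ge[OF step3[OF R ws(1)]], simp)
        fix P assume P: "P \<in> PG R ws" "P \<in> set_pmf (random_subset (pairs V) r)"
        show "7/8 * (1/2) \<le> measure_pmf.prob (bind_pmf (replicate_pmf (44 * l) (scales_pmf V s)) (\<lambda>Qss.
          bind_pmf (parity_pmf V (15 * l)) (\<lambda>Zs. return_pmf (R, ws, P, Qss, Zs)))) ?Good"
        proof (rule prob_bind_ge[OF step4], simp)
          fix Qss assume Q: "Qss \<in> QG P" "Qss \<in> set_pmf (replicate_pmf (44 * l) (scales_pmf V s))"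
          have "1/2 * 1 \<le> measure_pmf.prob (bind_pmf (parity_pmf V (15 * l)) (\<lambda>Zs. return_pmf (R, ws, P, Qss, Zs))) ?Good"
          proof (rule prob_bind_ge[OF step5[OF R(2) ws(2) P(2) Q(2)]], simp)
            fix Zs assume "Zs \<in> ZG R ws P Qss"
            then have "(R, ws, P, Qss, Zs) \<in> ?Good" using good R ws(1) P(1) Q(1) by blast
            then show "1 \<le> measure_pmf.prob (return_pmf (R, ws, P, Qss, Zs)) ?Good" by simp
          qed
          then show "1/2 \<le> measure_pmf.prob (bind_pmf (parity_pmf V (15 * l)) (\<lambda>Zs. return_pmf (R, ws, P, Qss, Zs))) ?Good" by simp
        qed
      qed
    qed
  qed
qed

section \<open>Vertex degrees and cuts\<close>

lemma boundary_singleton: "boundary E {v} = {e \<in> E. v \<in> e}"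
proof -
  have "card (e \<inter> {v}) = 1 \<longleftrightarrow> v \<in> e" for e by (cases "v \<in> e") auto
  then show ?thesis by (simp add: boundary_def)
qed

lemma vertex_degree_boundary: "vertex_degree E v = card (boundary E {v})"
  by (simp add: vertex_degree_def boundary_singleton)

lemma sum_vertex_degree:
  assumes "finite Y" "finite A"
  shows "(\<Sum>v\<in>A. vertex_degree Y v) = (\<Sum>e\<in>Y. card (e \<inter> A))"
proof -
  have "(\<Sum>v\<in>A. vertex_degree Y v) = (\<Sum>v\<in>A. \<Sum>e\<in>Y. of_bool (v \<in> e))"
    using assms by (simp add: vertex_degree_def sum_of_bool_eq Int_def)
  also have "\<dots> = (\<Sum>e\<in>Y. \<Sum>v\<in>A. of_bool (v \<in> e))" by (rule sum.swap)
  also have "\<dots> = (\<Sum>e\<in>Y. card (e \<inter> A))"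
    using assms by (simp add: sum_of_bool_eq Int_commute Int_def conj_commute)
  finally show ?thesis .
qed

lemma even_card_boundary:
  assumes "finite V" "Y \<subseteq> pairs V" "A \<subseteq> V"
  shows "even (card (boundary Y A)) \<longleftrightarrow> even (\<Sum>v\<in>A. vertex_degree Y v)"
proof -
  have fin: "finite Y" "finite A" using assms finite_pairs finite_subset by metis+
  have "even (card (e \<inter> A) + of_bool (card (e \<inter> A) = 1))" if "e \<in> Y" for e
  proof -
    have e: "card e = 2" using that assms(2) by (auto simp: pairs_def)
    then have "finite e" using card_ge_0_finite[of e] by simp
    with e have "card (e \<inter> A) \<le> 2" by (metis card_mono inf_le1)
    then consider "card (e \<inter> A) = 0" | "card (e \<inter> A) = 1" | "card (e \<inter> A) = 2" by linarith
    then show ?thesis by cases auto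
  qed
  then have "even (\<Sum>e\<in>Y. card (e \<inter> A) + of_bool (card (e \<inter> A) = 1))" by (intro dvd_sum)
  then have "even ((\<Sum>v\<in>A. vertex_degree Y v) + card (boundary Y A))"
    by (simp only: sum.distrib sum_vertex_degree[OF fin] card_boundary_sum[OF fin(1)])
  then show ?thesis by simp
qed

text \<open>The parity of the boundary of A is a sum of degrees of single vertices in E \<inter> (X
  \<inter> Z). Measuring these for all vertices in advance therefore serves every component A that
  may turn up later.\<close>

lemma detects_cong:
  assumes "finite V" "E \<subseteq> pairs V" "E' \<subseteq> pairs V" "A \<subseteq> V"
    and "\<And>v Z. v \<in> A \<Longrightarrow> Z \<in> set Zs \<Longrightarrow> vertex_degree (E \<inter> (X \<inter> Z)) v = vertex_degree (E' \<inter> (X \<inter> Z)) v"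
  shows "detects E Zs A X e = detects E' Zs A X e"
proof -
  have "odd (card (boundary E A \<inter> X \<inter> Z)) = odd (card (boundary E' A \<inter> X \<inter> Z))" if Z: "Z \<in> set Zs" for Z
  proof -
    have "(\<Sum>v\<in>A. vertex_degree (E \<inter> (X \<inter> Z)) v) = (\<Sum>v\<in>A. vertex_degree (E' \<inter> (X \<inter> Z)) v)"
      using assms(5) Z by (intro sum.cong) auto
    moreover have "E \<inter> (X \<inter> Z) \<subseteq> pairs V" "E' \<inter> (X \<inter> Z) \<subseteq> pairs V" using assms(2,3) by auto
    ultimately show ?thesis
      using even_card_boundary[OF assms(1) _ assms(4)] by (simp add: Int_assoc flip: boundary_Int)
  qed
  then show ?thesis by (simp add: detects_def)
qed

section \<open>Measuring rows of the adjacency matrix by cuts\<close>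

definition row :: "'a set \<Rightarrow> 'a \<Rightarrow> 'a set set \<Rightarrow> 'a set" where
  "row V v X = {u \<in> V - {v}. {v, u} \<in> X}"

lemma card_edges_between:
  assumes "E \<subseteq> pairs V" "v \<notin> U"
  shows "card {e \<in> E. card (e \<inter> {v}) = 1 \<and> card (e \<inter> U) = 1} = card {u \<in> U. {v, u} \<in> E}"
proof -
  have "{e \<in> E. card (e \<inter> {v}) = 1 \<and> card (e \<inter> U) = 1} = (\<lambda>u. {v, u}) ` {u \<in> U. {v, u} \<in> E}"
  proof (intro equalityI subsetI)
    fix e assume e: "e \<in> {e \<in> E. card (e \<inter> {v}) = 1 \<and> card (e \<inter> U) = 1}"
    then have "e \<in> pairs V" using assms(1) by blast
    then obtain x y where xy: "e = {x, y}" "x \<noteq> y" by (rule pairsE)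
    from e have "{x, y} \<in> E" "card ({x, y} \<inter> {v}) = 1" "card ({x, y} \<inter> U) = 1" unfolding xy(1) by blast+
    then have "{x, y} \<in> E" "(x \<in> {v}) \<noteq> (y \<in> {v})" "(x \<in> U) \<noteq> (y \<in> U)"
      unfolding card_doubleton_Int[OF xy(2)] by blast+
    then show "e \<in> (\<lambda>u. {v, u}) ` {u \<in> U. {v, u} \<in> E}"
      using xy(1) assms(2) by (cases "x = v") (auto simp: insert_commute)
  next
    fix e assume "e \<in> (\<lambda>u. {v, u}) ` {u \<in> U. {v, u} \<in> E}"
    then obtain u where u: "e = {v, u}" "u \<in> U" "{v, u} \<in> E" by blast
    then have "v \<noteq> u" using assms(2) by blast
    then show "e \<in> {e \<in> E. card (e \<inter> {v}) = 1 \<and> card (e \<inter> U) = 1}"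
      using u assms(2) card_doubleton_Int[of v u "{v}"] card_doubleton_Int[of v u U] by simp
  qed
  moreover have "inj_on (\<lambda>u. {v, u}) {u \<in> U. {v, u} \<in> E}" by (auto simp: inj_on_def doubleton_eq_iff)
  ultimately show ?thesis by (simp add: card_image)
qed

lemma boundary_empty [simp]: "boundary E {} = {}"
  by (simp add: boundary_def)

lemma boundary_insert_vertex:
  assumes "finite V" "E \<subseteq> pairs V" "v \<notin> U"
  shows "card (boundary E {v}) + card (boundary E U) = card (boundary E (insert v U)) + 2 * card {u \<in> U. {v, u} \<in> E}"
  using boundary_second_difference[OF assms(1,2), of "{v}" U "{}"] assms(3) card_edges_between[OF assms(2,3)] by simp

lemma degree_eq_neighbours:
  assumes "finite V" "E \<subseteq> pairs V" "v \<in> V"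
  shows "card (boundary E {v}) = card {u \<in> V. {v, u} \<in> E}"
proof -
  have "{u \<in> V - {v}. {v, u} \<in> E} = {u \<in> V. {v, u} \<in> E}"
  proof -
    have "{v} \<notin> E" using assms(2) by (auto simp: pairs_def)
    then show ?thesis by auto
  qed
  moreover have "insert v (V - {v}) = V" using assms(3) by auto
  moreover have "boundary E V = {}"
  proof -
    have "e \<inter> V = e \<and> card e = 2" if "e \<in> E" for e using that assms(2) by (auto simp: pairs_def)
    then show ?thesis by (fastforce simp: boundary_def)
  qed
  moreover have "{e \<in> E. card (e \<inter> {v}) = 1 \<and> card (e \<inter> (V - {v})) = 1} = boundary E {v}"
  proof -
    have "card (e \<inter> (V - {v})) = 1" if "e \<in> E" "card (e \<inter> {v}) = 1" for e
    proof -
      have "e \<in> pairs V" using that assms(2) by auto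
      then obtain x y where xy: "e = {x, y}" "x \<noteq> y" "x \<in> V" "y \<in> V" by (rule pairsE)
      show ?thesis using that(2) xy(2-4) unfolding xy(1) card_doubleton_Int[OF xy(2)] by blast
    qed
    then show ?thesis by (auto simp: boundary_def)
  qed
  ultimately show ?thesis using card_edges_between[OF assms(2), of v "V - {v}"] by simp
qed

text \<open>The degree of v in E \<inter> X is the number of edges from v to its row, which is half
  of a second difference of the cut function.\<close>

lemma row_agree:
  assumes "finite V" "E \<subseteq> pairs V" "v \<in> V"
  shows "card (boundary E {v}) + card (boundary E (row V v X)) =
    card (boundary E (insert v (row V v X))) + 2 * vertex_degree (E \<inter> X) v"
proof -
  have v: "v \<notin> row V v X" by (simp add: row_def)
  have "{v} \<notin> E" using assms(2) by (auto simp: pairs_def)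
  then have "{u \<in> row V v X. {v, u} \<in> E} = {u \<in> V. {v, u} \<in> E \<inter> X}" by (auto simp: row_def)
  moreover have "vertex_degree (E \<inter> X) v = card {u \<in> V. {v, u} \<in> E \<inter> X}"
    unfolding vertex_degree_boundary using assms by (intro degree_eq_neighbours) auto
  ultimately show ?thesis using boundary_insert_vertex[OF assms(1,2) v] by simp
qed

lemma vertex_degree_cong:
  assumes "finite V" "E \<subseteq> pairs V" "E' \<subseteq> pairs V" "v \<in> V"
    and "\<And>S. S \<in> {{v}, row V v X, insert v (row V v X)} \<Longrightarrow> card (boundary E S) = card (boundary E' S)"
  shows "vertex_degree (E \<inter> X) v = vertex_degree (E' \<inter> X) v"
  using row_agree[OF assms(1,2,4), of X] row_agree[OF assms(1,3,4), of X] assms(5)[of "{v}"]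
    assms(5)[of "row V v X"] assms(5)[of "insert v (row V v X)"] by simp

lemma card_inter_edges_le:
  assumes "finite V"
  shows "card (inter_edges V E F) \<le> (\<Sum>A\<in>comps V F. card (boundary E A))"
proof -
  have "inter_edges V E F = (\<Union>A\<in>comps V F. boundary E A)" by (auto simp: inter_edges_def boundary_def)
  then show ?thesis using card_UN_le[OF finite_comps[OF assms]] by simp
qed

text \<open>An edge leaves only the components of its two endpoints. The sum of the block cuts,
  which queries reveal, thus replaces the number of remaining edges at the price of a factor
  2.\<close>

lemma sum_boundary_comps_le:
  assumes "finite V" "E \<subseteq> pairs V"
  shows "(\<Sum>A\<in>comps V F. card (boundary E A)) \<le> 2 * card (inter_edges V E F)"
proof -
  let ?I = "inter_edges V E F"
  have fI: "finite ?I" using assms finite_pairs finite_subset inter_edges_subset by metis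
  have "(\<Sum>A\<in>comps V F. card (boundary E A)) = (\<Sum>A\<in>comps V F. card (boundary ?I A))"
    using boundary_Union_comps[OF assms(2), of "{A}" F for A] by (intro sum.cong) auto
  also have "\<dots> = (\<Sum>e\<in>?I. \<Sum>A\<in>comps V F. of_bool (card (e \<inter> A) = 1))"
    unfolding card_boundary_sum[OF fI] by (rule sum.swap)
  also have "\<dots> \<le> (\<Sum>e\<in>?I. 2)"
  proof (rule sum_mono)
    fix e assume "e \<in> ?I"
    then have "e \<in> pairs V" using assms(2) inter_edges_subset by blast
    then obtain x y where xy: "e = {x, y}" "x \<noteq> y" by (rule pairsE)
    have "comps V F \<inter> {A. card (e \<inter> A) = 1} \<subseteq> {comp_of V F x, comp_of V F y}"
    proof
      fix A assume A: "A \<in> comps V F \<inter> {A. card (e \<inter> A) = 1}"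
      then have "x \<in> A \<or> y \<in> A" unfolding xy(1) using card_doubleton_Int[OF xy(2), of A] by auto
      then show "A \<in> {comp_of V F x, comp_of V F y}" using A compsD[of A V F x] compsD[of A V F y] by blast
    qed
    then have "card (comps V F \<inter> {A. card (e \<inter> A) = 1}) \<le> card {comp_of V F x, comp_of V F y}"
      by (intro card_mono) auto
    also have "\<dots> \<le> 2" by (simp add: card_insert_if)
    finally show "(\<Sum>A\<in>comps V F. of_bool (card (e \<inter> A) = 1)) \<le> (2::nat)"
      using finite_comps[OF assms(1), of F] by (simp add: sum_of_bool_eq)
  qed
  finally show ?thesis by (simp add: mult.commute)
qed

lemma boundary_complement:
  assumes "E \<subseteq> pairs V" "S \<subseteq> V"
  shows "boundary E (V - S) = boundary E S"
proof -
  have "card (e \<inter> (V - S)) = 1 \<longleftrightarrow> card (e \<inter> S) = 1" if "e \<in> E" for e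
  proof -
    have "e \<in> pairs V" using that assms(1) by auto
    then obtain x y where xy: "e = {x, y}" "x \<noteq> y" "x \<in> V" "y \<in> V" by (rule pairsE)
    show ?thesis unfolding xy(1) card_doubleton_Int[OF xy(2)] using xy by auto
  qed
  then show ?thesis by (auto simp: boundary_def)
qed

text \<open>Moving v to the other side cannot make a minimum cut smaller, so at most half of the
  edges at v cross it. The move is illegal only when v is alone on its side; then the cut would
  equal the degree of v, against the last hypothesis.\<close>

lemma same_side_neighbours:
  assumes "finite V" "E \<subseteq> pairs V" "S \<subset> V" "S \<noteq> {}" "v \<in> V"
    and min: "\<And>T. T \<noteq> {} \<Longrightarrow> T \<subset> V \<Longrightarrow> card (boundary E S) \<le> card (boundary E T)"
    and v: "card (boundary E S) < card (boundary E {v})"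
  shows "card (boundary E {v}) \<le> 2 * card {u \<in> V. {v, u} \<in> E \<and> (u \<in> S) = (v \<in> S)}"
proof (cases "v \<in> S")
  case True
  let ?S = "S - {v}"
  have "?S \<noteq> {}"
  proof
    assume "?S = {}"
    then have "S = {v}" using True by auto
    with v show False by simp
  qed
  then have "card (boundary E S) \<le> card (boundary E ?S)" using assms(3) by (intro min) auto
  moreover have "insert v ?S = S" using True by auto
  moreover have "{u \<in> ?S. {v, u} \<in> E} = {u \<in> V. {v, u} \<in> E \<and> (u \<in> S) = (v \<in> S)}"
  proof -
    have "{v} \<notin> E" using assms(2) by (auto simp: pairs_def)
    then show ?thesis using True assms(3) by auto
  qed
  ultimately show ?thesis using boundary_insert_vertex[OF assms(1,2), of v ?S] by simp
next
  case False
  let ?c = "{u \<in> S. {v, u} \<in> E}" and ?s = "{u \<in> V. {v, u} \<in> E \<and> (u \<in> S) = (v \<in> S)}"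
  have "insert v S \<noteq> V"
  proof
    assume "insert v S = V"
    then have "V - S = {v}" using False by auto
    then show False using v boundary_complement[OF assms(2), of S] assms(3) by auto
  qed
  then have "card (boundary E S) \<le> card (boundary E (insert v S))" using assms(3,5) by (intro min) auto
  then have 1: "2 * card ?c \<le> card (boundary E {v})"
    using boundary_insert_vertex[OF assms(1,2) False] by simp
  have "{u \<in> V. {v, u} \<in> E} = ?c \<union> ?s" using False assms(3) by auto
  moreover have "?c \<inter> ?s = {}" using False by auto
  moreover have "finite S" using assms(1,3) finite_subset by blast
  then have "finite ?c" "finite ?s" using assms(1) by simp_all
  ultimately have "card {u \<in> V. {v, u} \<in> E} = card ?c + card ?s" by (simp add: card_Un_disjoint)
  then show ?thesis using 1 degree_eq_neighbours[OF assms(1,2,5)] by simp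
qed

lemma sum_crossing_neighbours:
  assumes "finite V" "E \<subseteq> pairs V"
  shows "(\<Sum>v\<in>V. card {u \<in> V. {v, u} \<in> E \<and> (u \<in> S) \<noteq> (v \<in> S)}) \<le> 2 * card (boundary E S)"
proof -
  let ?Y = "boundary E S"
  have Y: "?Y \<subseteq> pairs V" using assms(2) boundary_subset by blast
  then have fY: "finite ?Y" using assms(1) finite_pairs finite_subset by blast
  have "card {u \<in> V. {v, u} \<in> E \<and> (u \<in> S) \<noteq> (v \<in> S)} \<le> vertex_degree ?Y v" if "v \<in> V" for v
  proof -
    have "{u \<in> V. {v, u} \<in> E \<and> (u \<in> S) \<noteq> (v \<in> S)} \<subseteq> {u \<in> V. {v, u} \<in> ?Y}"
    proof
      fix u assume u: "u \<in> {u \<in> V. {v, u} \<in> E \<and> (u \<in> S) \<noteq> (v \<in> S)}"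
      then have "v \<noteq> u" by auto
      then show "u \<in> {u \<in> V. {v, u} \<in> ?Y}" using u by auto
    qed
    then have "card {u \<in> V. {v, u} \<in> E \<and> (u \<in> S) \<noteq> (v \<in> S)} \<le> card {u \<in> V. {v, u} \<in> ?Y}"
      using assms(1) by (intro card_mono) auto
    also have "\<dots> = vertex_degree ?Y v"
      using degree_eq_neighbours[OF assms(1) Y that] by (simp add: vertex_degree_boundary)
    finally show ?thesis .
  qed
  then have "(\<Sum>v\<in>V. card {u \<in> V. {v, u} \<in> E \<and> (u \<in> S) \<noteq> (v \<in> S)}) \<le> (\<Sum>v\<in>V. vertex_degree ?Y v)"
    by (rule sum_mono)
  also have "\<dots> = (\<Sum>e\<in>?Y. card (e \<inter> V))" by (rule sum_vertex_degree[OF fY assms(1)])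
  also have "\<dots> = (\<Sum>e\<in>?Y. 2)"
  proof (rule sum.cong[OF refl])
    fix e assume "e \<in> ?Y"
    then have "e \<subseteq> V" "card e = 2" using Y by (auto simp: pairs_def)
    then show "card (e \<inter> V) = 2" by (simp add: Int_absorb2)
  qed
  finally show ?thesis by (simp add: mult.commute)
qed

section \<open>The algorithm\<close>

definition enum :: "'a set \<Rightarrow> 'a list" where
  "enum A = (SOME xs. set xs = A \<and> length xs = card A)"

lemma enum: "finite A \<Longrightarrow> set (enum A) = A \<and> length (enum A) = card A"
  unfolding enum_def by (rule someI_ex) (metis finite_distinct_list distinct_card)

lemma card_UN_le_mult:
  assumes "finite I" "card I \<le> k" "\<And>i. i \<in> I \<Longrightarrow> finite (A i) \<and> card (A i) \<le> m"
  shows "finite (\<Union>i\<in>I. A i) \<and> card (\<Union>i\<in>I. A i) \<le> k * m"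
proof -
  have "card (\<Union>i\<in>I. A i) \<le> (\<Sum>i\<in>I. card (A i))" by (rule card_UN_le[OF assms(1)])
  also have "\<dots> \<le> card I * m" using assms(3) sum_bounded_above[of I "\<lambda>i. card (A i)" m] by simp
  also have "\<dots> \<le> k * m" using assms(2) by simp
  finally show ?thesis using assms by auto
qed

text \<open>The second family ranges over all vertices for each Q, because the components that will
  need these parities are not yet known.\<close>

definition test_rows :: "'a set \<Rightarrow> 'a sample \<Rightarrow> ('a \<times> 'a set set) set" where
  "test_rows V = (\<lambda>(R, ws, P, Qss, Zs).
     (\<Union>v\<in>V. \<Union>W\<in>set (ws v). \<Union>Z\<in>set Zs. {(v, star v (R \<inter> W) \<inter> Z)}) \<union>
     (\<Union>v\<in>V. \<Union>Qs\<in>set Qss. \<Union>Q\<in>Qs. \<Union>Z\<in>set Zs. {(v, P \<inter> Q \<inter> Z)}))"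

text \<open>Two queries per row suffice: the third cut, that of {v}, is an answer of the first
  round.\<close>

definition sketch_queries :: "'a set \<Rightarrow> 'a sample \<Rightarrow> 'a set set" where
  "sketch_queries V w = (\<Union>(v, X)\<in>test_rows V w. {row V v X, insert v (row V v X)})"

lemma sketch_queries_subset: "sketch_queries V w \<subseteq> Pow V"
proof -
  have "v \<in> V" if "(v, X) \<in> test_rows V w" for v X
    using that by (auto simp: test_rows_def split: prod.splits)
  then show ?thesis by (fastforce simp: sketch_queries_def row_def)
qed

lemma card_sketch_queries:
  assumes "finite V" "w \<in> set_pmf (sample_pmf V d)" "l = clog (card V)"
  shows "finite (sketch_queries V w) \<and> card (sketch_queries V w) \<le> 1680 * l * l * (2 * l + 2) * card V"
proof -
  let ?s = "2 * l + 1" and ?n = "card V"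
  obtain R ws P Qss Zs where w: "w = (R, ws, P, Qss, Zs)" by (metis prod_cases5)
  have sup: "ws \<in> set_pmf (stars_pmf V (12 * l) ?s)" "Qss \<in> set_pmf (replicate_pmf (44 * l) (scales_pmf V ?s))"
    "Zs \<in> set_pmf (parity_pmf V (15 * l))"
    using assms(2) unfolding w sample_pmf_def Let_def assms(3) by auto
  have Z: "card (set Zs) \<le> 15 * l" using sup(3) card_length[of Zs] by (auto simp: parity_pmf_def set_replicate_pmf)
  have W: "card (set (ws v)) \<le> 12 * l * Suc ?s" if "v \<in> V" for v
    using set_stars_pmf[OF assms(1) sup(1) that] card_length[of "ws v"] by simp
  have Q: "card (set Qss) \<le> 44 * l" "Qs \<in> set Qss \<Longrightarrow> finite Qs \<and> card Qs \<le> Suc ?s" for Qs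
    using sup(2) card_length[of Qss] set_scales_pmf[of Qs V ?s] by (auto simp: set_replicate_pmf)
  let ?A = "\<Union>v\<in>V. \<Union>W\<in>set (ws v). \<Union>Z\<in>set Zs. {(v, star v (R \<inter> W) \<inter> Z)}"
  let ?B = "\<Union>v\<in>V. \<Union>Qs\<in>set Qss. \<Union>Q\<in>Qs. \<Union>Z\<in>set Zs. {(v, P \<inter> Q \<inter> Z)}"
  have A: "finite ?A \<and> card ?A \<le> ?n * (12 * l * Suc ?s * (15 * l * 1))"
    using assms(1) W Z by (intro card_UN_le_mult) auto
  have B: "finite ?B \<and> card ?B \<le> ?n * (44 * l * (Suc ?s * (15 * l * 1)))"
    using assms(1) Q Z by (intro card_UN_le_mult) auto
  have rows: "test_rows V w = ?A \<union> ?B" by (simp add: w test_rows_def)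
  have "card (test_rows V w) \<le> ?n * (12 * l * Suc ?s * (15 * l * 1)) + ?n * (44 * l * (Suc ?s * (15 * l * 1)))"
    unfolding rows using A B card_Un_le[of ?A ?B] by linarith
  \<comment> \<open>840 = 15 * (12 + 44): parities times sweeps and Boruvka steps.\<close>
  also have "\<dots> = 840 * l * l * (2 * l + 2) * ?n" by (simp add: algebra_simps)
  finally have c: "card (test_rows V w) \<le> 840 * l * l * (2 * l + 2) * ?n" .
  have "finite (test_rows V w)" unfolding rows using A B by simp
  then have "finite (sketch_queries V w) \<and> card (sketch_queries V w) \<le> (840 * l * l * (2 * l + 2) * ?n) * 2"
    unfolding sketch_queries_def using c
    by (intro card_UN_le_mult) (auto simp: card_insert_if split: prod.splits)
  then show ?thesis by (simp add: algebra_simps)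
qed

lemma boruvka_testsD:
  "(A, X) \<in> boruvka_tests V fn P Qss F \<Longrightarrow> A \<subseteq> V \<and> (\<exists>Qs\<in>set Qss. \<exists>Q\<in>Qs. X = P \<inter> Q)"
  by (induction Qss arbitrary: F) (auto dest: comps_subset)

text \<open>Both graphs give the same parities, hence take the same decisions, whether these detect
  edges correctly or not. So the algorithm obtains the forest of the true graph from any graph with
  the same answers.\<close>

lemma forest_cong:
  assumes "finite V" "E \<subseteq> pairs V" "E' \<subseteq> pairs V"
    and agree: "\<And>S. S \<in> (\<lambda>v. {v}) ` V \<union> sketch_queries V w \<Longrightarrow> card (boundary E S) = card (boundary E' S)"
  shows "forest V E w = forest V E' w"
proof -
  obtain R ws P Qss Zs where w: "w = (R, ws, P, Qss, Zs)" by (metis prod_cases5)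
  have deg: "vertex_degree (E \<inter> X) v = vertex_degree (E' \<inter> X) v" if "(v, X) \<in> test_rows V w" "v \<in> V" for v X
    using that by (intro vertex_degree_cong[OF assms(1-3)] agree) (auto simp: sketch_queries_def)
  have "contracted V (detects E Zs) R ws P Qss = contracted V (detects E' Zs) R ws P Qss"
  proof (rule contracted_cong)
    fix A X e assume AX: "(A, X) \<in> star_tests V R ws \<union> boruvka_tests V (detects E' Zs) P Qss {}"
    show "detects E Zs A X e = detects E' Zs A X e"
    proof (cases "(A, X) \<in> star_tests V R ws")
      case True
      then obtain v W where v: "v \<in> V" "W \<in> set (ws v)" "A = {v}" "X = star v (R \<inter> W)"
        by (auto simp: star_tests_def)
      show ?thesis
      proof (rule detects_cong[OF assms(1-3)])
        show "A \<subseteq> V" using v by simp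
        fix u Z assume "u \<in> A" "Z \<in> set Zs"
        then show "vertex_degree (E \<inter> (X \<inter> Z)) u = vertex_degree (E' \<inter> (X \<inter> Z)) u"
          using v by (intro deg) (auto simp: test_rows_def w)
      qed
    next
      case False
      then have "(A, X) \<in> boruvka_tests V (detects E' Zs) P Qss {}" using AX by blast
      from boruvka_testsD[OF this] obtain Qs Q where Q: "A \<subseteq> V" "Qs \<in> set Qss" "Q \<in> Qs" "X = P \<inter> Q" by blast
      show ?thesis
      proof (rule detects_cong[OF assms(1-3) Q(1)])
        fix u Z assume u: "u \<in> A" and Z: "Z \<in> set Zs"
        have "(u, X \<inter> Z) \<in> test_rows V w"
          unfolding test_rows_def w prod.case using Q u Z by blast
        then show "vertex_degree (E \<inter> (X \<inter> Z)) u = vertex_degree (E' \<inter> (X \<inter> Z)) u"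
          using Q(1) u by (intro deg) auto
      qed
    qed
  qed
  then show ?thesis by (simp add: forest_def w)
qed

text \<open>n^2 + 1 \<le> 2^(2 l + 1) for l = \<open>clog n\<close>, quotients have at most M = 2 *
  \<open>inter_bound n\<close> edges, and the counting bound has exponent 2 M. The factor 3 comes
  from (4/3)^3 \<ge> 2, the summand 1 makes the inequality strict.\<close>

definition quotient_length :: "nat \<Rightarrow> nat" where
  "quotient_length n = 3 * ((2 * clog n + 1) * (2 * (2 * inter_bound n)) + 1)"

lemma quotient_length:
  "(real n ^ 2 + 1) ^ (2 * (2 * inter_bound n)) < (4/3) ^ quotient_length n"
proof -
  let ?l = "clog n" and ?M = "2 * (2 * inter_bound n)"
  have "real n \<le> real (2 ^ ?l)" using le_two_power_clog by (simp only: of_nat_le_iff)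
  then have "real n ^ 2 + 1 \<le> (2 ^ ?l) ^ 2 + 1" by (intro add_mono power_mono) auto
  also have "\<dots> \<le> 2 ^ (2 * ?l + 1)"
    using one_le_power[of "2::real" "2 * ?l"] by (simp flip: power_mult add: mult.commute)
  finally have "(real n ^ 2 + 1) ^ ?M \<le> (2 ^ (2 * ?l + 1)) ^ ?M" by (intro power_mono) auto
  also have "\<dots> = 2 ^ ((2 * ?l + 1) * ?M)" by (simp only: power_mult)
  also have "\<dots> < 2 ^ ((2 * ?l + 1) * ?M + 1)" by (intro power_strict_increasing) auto
  also have "\<dots> \<le> ((4/3) ^ 3) ^ ((2 * ?l + 1) * ?M + 1)" by (intro power_mono) (auto simp: power_divide)
  also have "\<dots> = (4/3) ^ quotient_length n" by (simp only: quotient_length_def power_mult)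
  finally show ?thesis .
qed

section \<open>Queries and candidate cuts of the third round\<close>

definition separates_quotients :: "'a set \<Rightarrow> 'a set set \<Rightarrow> 'a set set list \<Rightarrow> bool" where
  "separates_quotients V F qs \<longleftrightarrow>
    (\<forall>E E'. E \<subseteq> pairs V \<longrightarrow> E' \<subseteq> pairs V \<longrightarrow>
      card (inter_edges V E F) \<le> 2 * inter_bound (card V) \<longrightarrow> card (inter_edges V E' F) \<le> 2 * inter_bound (card V) \<longrightarrow>
      (\<forall>A\<in>comps V F. card (boundary E A) = card (boundary E' A)) \<longrightarrow>
      (\<forall>U\<in>set qs. card (boundary E (\<Union>U)) = card (boundary E' (\<Union>U))) \<longrightarrow>
      (\<forall>U\<subseteq>comps V F. card (boundary E (\<Union>U)) = card (boundary E' (\<Union>U))))"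

definition quotient_queries :: "'a set \<Rightarrow> 'a set set \<Rightarrow> 'a set set list" where
  "quotient_queries V F = (SOME qs. length qs = quotient_length (card V) \<and> set qs \<subseteq> Pow (comps V F) \<and> separates_quotients V F qs)"

lemma quotient_queries:
  assumes "finite V"
  shows "length (quotient_queries V F) = quotient_length (card V) \<and> set (quotient_queries V F) \<subseteq> Pow (comps V F)
    \<and> separates_quotients V F (quotient_queries V F)"
  unfolding quotient_queries_def separates_quotients_def
  by (rule someI_ex) (rule exists_quotient_queries[OF assms quotient_length])

definition block_queries :: "'a set \<Rightarrow> 'a set set \<Rightarrow> 'a set set" where
  "block_queries V F = comps V F \<union> \<Union> ` set (quotient_queries V F)"

lemma block_queries:
  assumes "finite V"
  shows "block_queries V F \<subseteq> Pow V" "finite (block_queries V F) \<and> card (block_queries V F) \<le> card V + quotient_length (card V)"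
proof -
  have "\<Union>U \<subseteq> V" if "U \<in> set (quotient_queries V F)" for U
  proof -
    have "U \<subseteq> comps V F" using quotient_queries[OF assms] that by blast
    then show ?thesis using comps_subset by (metis Sup_least subsetD)
  qed
  then have "\<Union> ` set (quotient_queries V F) \<subseteq> Pow V" by (intro image_subsetI PowI)
  moreover have "comps V F \<subseteq> Pow V" using comps_subset[of _ V F] by blast
  ultimately show "block_queries V F \<subseteq> Pow V" unfolding block_queries_def by (rule Un_least[rotated])
  have "card (\<Union> ` set (quotient_queries V F)) \<le> quotient_length (card V)"
    using quotient_queries[OF assms, of F] card_image_le[of "set (quotient_queries V F)" Union] card_length[of "quotient_queries V F"] by simp
  then show "finite (block_queries V F) \<and> card (block_queries V F) \<le> card V + quotient_length (card V)"
    using card_Un_le[of "comps V F" "\<Union> ` set (quotient_queries V F)"] card_comps_le[OF assms, of F] finite_comps[OF assms, of F]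
    by (simp add: block_queries_def)
qed

text \<open>Phrased by block cuts rather than by \<open>inter_edges\<close>, so that the answers of
  the third round decide it.\<close>

definition sparse_quotient :: "'a set \<Rightarrow> 'a set set \<Rightarrow> 'a set set \<Rightarrow> bool" where
  "sparse_quotient V E F \<longleftrightarrow> (\<Sum>A\<in>comps V F. card (boundary E A)) \<le> 2 * inter_bound (card V)"

text \<open>Single vertices cover the case that the contraction argument excludes. Quotients that
  are not sparse are dropped, since for them the queries guarantee nothing.\<close>

definition candidates :: "'a set \<Rightarrow> 'a set set \<Rightarrow> 'a set set set \<Rightarrow> 'a set set" where
  "candidates V E Fs = {S. S \<noteq> {} \<and> S \<subset> V \<and>
     ((\<exists>v\<in>V. S = {v}) \<or> (\<exists>F\<in>Fs. sparse_quotient V E F \<and> (\<exists>U\<subseteq>comps V F. S = \<Union>U)))}"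

text \<open>Agreement on the block cuts makes the same quotients sparse for both graphs, and for
  sparse quotients the chosen queries determine the cuts of all unions.\<close>

lemma candidates_agree:
  assumes "finite V" "E \<subseteq> pairs V" "E' \<subseteq> pairs V"
    and agree: "\<And>S. S \<in> (\<lambda>v. {v}) ` V \<union> (\<Union>F\<in>Fs. block_queries V F) \<Longrightarrow> card (boundary E S) = card (boundary E' S)"
  shows "candidates V E Fs = candidates V E' Fs"
    and "S \<in> candidates V E Fs \<Longrightarrow> card (boundary E S) = card (boundary E' S)"
proof -
  have blocks: "card (boundary E A) = card (boundary E' A)" if "F \<in> Fs" "A \<in> comps V F" for F A
    using that by (intro agree) (auto simp: block_queries_def)
  have sparse: "sparse_quotient V E F = sparse_quotient V E' F" if "F \<in> Fs" for F
  proof -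
    have "(\<Sum>A\<in>comps V F. card (boundary E A)) = (\<Sum>A\<in>comps V F. card (boundary E' A))"
      using blocks[OF that] by (rule sum.cong[OF refl])
    then show ?thesis by (simp add: sparse_quotient_def)
  qed
  then show "candidates V E Fs = candidates V E' Fs" unfolding candidates_def by blast
  assume S: "S \<in> candidates V E Fs"
  then consider v where "v \<in> V" "S = {v}"
    | F U where "F \<in> Fs" "sparse_quotient V E F" "U \<subseteq> comps V F" "S = \<Union>U"
    unfolding candidates_def by blast
  then show "card (boundary E S) = card (boundary E' S)"
  proof cases
    case 1
    then show ?thesis by (intro agree) auto
  next
    case 2
    have "card (inter_edges V E F) \<le> 2 * inter_bound (card V)"
      using card_inter_edges_le[OF assms(1), of E F] 2(2) by (simp add: sparse_quotient_def)
    moreover have "card (inter_edges V E' F) \<le> 2 * inter_bound (card V)"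
      using card_inter_edges_le[OF assms(1), of E' F] 2(2) sparse[OF 2(1)] by (simp add: sparse_quotient_def)
    moreover have "\<forall>U\<in>set (quotient_queries V F). card (boundary E (\<Union>U)) = card (boundary E' (\<Union>U))"
      using 2(1) by (auto intro!: agree simp: block_queries_def)
    moreover have "\<forall>A\<in>comps V F. card (boundary E A) = card (boundary E' A)" using blocks[OF 2(1)] by blast
    moreover have "separates_quotients V F (quotient_queries V F)" using quotient_queries[OF assms(1)] by blast
    ultimately show ?thesis using 2(3,4) assms(2,3) unfolding separates_quotients_def by blast
  qed
qed

text \<open>
  What the algorithm computes depends on the unknown graph only through the queries answered so far,
  so it may compute with any graph that gives the same answers.
\<close>

definition consistent :: "'a set \<Rightarrow> 'a set list \<Rightarrow> real list \<Rightarrow> 'a set set" where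
  "consistent V Qs as = (SOME E. simple_graph V E \<and> map (cut_value E unit_weight) Qs = as)"

lemma consistent:
  assumes "simple_graph V E"
  shows "consistent V Qs (map (cut_value E unit_weight) Qs) \<subseteq> pairs V"
    and "S \<in> set Qs \<Longrightarrow> card (boundary (consistent V Qs (map (cut_value E unit_weight) Qs)) S) = card (boundary E S)"
proof -
  let ?E = "consistent V Qs (map (cut_value E unit_weight) Qs)"
  have *: "simple_graph V ?E \<and> map (cut_value ?E unit_weight) Qs = map (cut_value E unit_weight) Qs"
    unfolding consistent_def by (rule someI[of _ E]) (use assms in simp)
  then show "?E \<subseteq> pairs V" by (simp add: simple_graph_iff)
  show "card (boundary ?E S) = card (boundary E S)" if "S \<in> set Qs"
    using * that by (simp add: cut_value_unit)
qed

definition query_round :: "'a set \<Rightarrow> (nat \<times> nat \<Rightarrow> 'a sample) \<Rightarrow> nat \<Rightarrow> nat \<Rightarrow> 'a set list" where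
  "query_round V \<omega> K d = enum (\<Union>k<K. sketch_queries V (\<omega> (d, k)))"

definition forests :: "'a set \<Rightarrow> 'a set set \<Rightarrow> (nat \<times> nat \<Rightarrow> 'a sample) \<Rightarrow> nat \<Rightarrow> nat \<Rightarrow> 'a set set set" where
  "forests V E \<omega> K d = (\<lambda>k. forest V E (\<omega> (d, k))) ` {..<K}"

definition best_candidate :: "'a set \<Rightarrow> 'a set set \<Rightarrow> 'a set set set \<Rightarrow> 'a set" where
  "best_candidate V E Fs = arg_min (\<lambda>S. card (boundary E S)) (\<lambda>S. S \<in> candidates V E Fs)"

definition algorithm :: "'a set \<Rightarrow> nat \<Rightarrow> (nat \<times> nat \<Rightarrow> 'a sample) \<Rightarrow> ('a, 'a set \<times> real) query_algorithm" where
  "algorithm V K \<omega> =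
    (let Q1 = enum ((\<lambda>v. {v}) ` V) in Round Q1 (\<lambda>a1.
     let d = min_degree V (consistent V Q1 a1); Q2 = query_round V \<omega> K d in Round Q2 (\<lambda>a2.
     let Fs = forests V (consistent V (Q1 @ Q2) (a1 @ a2)) \<omega> K d;
         Q3 = enum (\<Union>F\<in>Fs. block_queries V F) in Round Q3 (\<lambda>a3.
     let E = consistent V (Q1 @ Q2 @ Q3) (a1 @ a2 @ a3); S = best_candidate V E Fs
     in Output (S, cut_value E unit_weight S)))))"

text \<open>Eliminates the substitute graphs: degrees, forests and candidate values computed from
  them equal those of E, so the run can be described by E alone.\<close>

lemma algorithm_run:
  assumes "simple_graph V E" "2 \<le> card V"
    and fin: "\<And>k. k < K \<Longrightarrow> finite (sketch_queries V (\<omega> (min_degree V E, k)))"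
  defines "d \<equiv> min_degree V E"
  defines "Fs \<equiv> forests V E \<omega> K d"
  shows "rounds (cut_value E unit_weight) (algorithm V K \<omega>) =
      [enum ((\<lambda>v. {v}) ` V), query_round V \<omega> K d, enum (\<Union>F\<in>Fs. block_queries V F)]" (is ?rounds)
    and "\<exists>S \<in> candidates V E Fs. result (cut_value E unit_weight) (algorithm V K \<omega>) = (S, cut_value E unit_weight S) \<and>
      (\<forall>T \<in> candidates V E Fs. cut_value E unit_weight S \<le> cut_value E unit_weight T)" (is ?result)
proof -
  let ?q = "cut_value E unit_weight"
  have V: "finite V" and E: "E \<subseteq> pairs V" using assms(1) by (simp_all add: simple_graph_iff)
  define Q1 where "Q1 = enum ((\<lambda>v. {v}) ` V)"
  define Q2 where "Q2 = query_round V \<omega> K d"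
  define Q3 where "Q3 = enum (\<Union>F\<in>Fs. block_queries V F)"
  have Q1: "set Q1 = (\<lambda>v. {v}) ` V" using enum[of "(\<lambda>v. {v}) ` V"] V by (simp add: Q1_def)
  have Q2: "set Q2 = (\<Union>k<K. sketch_queries V (\<omega> (d, k)))"
    using enum[of "\<Union>k<K. sketch_queries V (\<omega> (d, k))"] fin by (simp add: Q2_def query_round_def d_def)
  have fFs: "finite Fs" by (simp add: Fs_def forests_def)
  have Q3: "set Q3 = (\<Union>F\<in>Fs. block_queries V F)"
    using enum[of "\<Union>F\<in>Fs. block_queries V F"] fFs block_queries(2)[OF V] by (simp add: Q3_def)
  have d1: "min_degree V (consistent V Q1 (map ?q Q1)) = d"
  proof -
    have "vertex_degree (consistent V Q1 (map ?q Q1)) v = vertex_degree E v" if "v \<in> V" for v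
      using consistent(2)[OF assms(1), of "{v}" Q1] that Q1 by (simp add: vertex_degree_boundary)
    then have "vertex_degree (consistent V Q1 (map ?q Q1)) ` V = vertex_degree E ` V" by (intro image_cong) auto
    then show ?thesis by (simp add: min_degree_def d_def)
  qed
  have F2: "forests V (consistent V (Q1 @ Q2) (map ?q Q1 @ map ?q Q2)) \<omega> K d = Fs"
  proof -
    have "forest V (consistent V (Q1 @ Q2) (map ?q (Q1 @ Q2))) (\<omega> (d, k)) = forest V E (\<omega> (d, k))" if "k < K" for k
      using consistent[OF assms(1), where Qs = "Q1 @ Q2"] Q1 Q2 that
      by (intro forest_cong[OF V _ E]) auto
    then show ?thesis unfolding Fs_def forests_def by (intro image_cong) auto
  qed
  define E3 where "E3 = consistent V (Q1 @ Q2 @ Q3) (map ?q (Q1 @ Q2 @ Q3))"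
  have E3: "E3 \<subseteq> pairs V" "S \<in> set Q1 \<union> set Q3 \<Longrightarrow> card (boundary E3 S) = card (boundary E S)" for S
    using consistent[OF assms(1), where Qs = "Q1 @ Q2 @ Q3"] by (auto simp: E3_def)
  have cand: "candidates V E3 Fs = candidates V E Fs"
    by (rule candidates_agree(1)[OF V E3(1) E]) (use E3(2) Q1 Q3 in auto)
  have cut: "card (boundary E3 S) = card (boundary E S)" if "S \<in> candidates V E Fs" for S
    by (rule candidates_agree(2)[OF V E3(1) E, of Fs]) (use E3(2) Q1 Q3 cand that in auto)
  let ?S = "best_candidate V E3 Fs"
  show ?rounds
    by (simp add: algorithm_def Let_def d1 F2 flip: Q1_def Q2_def Q3_def)
  have res: "result ?q (algorithm V K \<omega>) = (?S, cut_value E3 unit_weight ?S)"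
    by (simp add: algorithm_def Let_def d1 F2 E3_def flip: Q1_def Q2_def Q3_def)
  obtain v where v: "v \<in> V" using assms(2) by fastforce
  \<comment> \<open>There is always a candidate, so the minimum is attained even if every quotient
    is dense.\<close>
  have "{v} \<in> candidates V E3 Fs"
  proof -
    have "{v} \<noteq> V" using assms(2) by auto
    then show ?thesis using v by (auto simp: candidates_def)
  qed
  then have S: "?S \<in> candidates V E3 Fs" unfolding best_candidate_def by (rule arg_min_natI)
  have le: "card (boundary E3 ?S) \<le> card (boundary E3 T)" if "T \<in> candidates V E3 Fs" for T
    unfolding best_candidate_def using that by (rule arg_min_nat_le)
  show ?result
  proof (rule bexI[of _ ?S], intro conjI ballI)
    show S': "?S \<in> candidates V E Fs" using S cand by simp
    show "result ?q (algorithm V K \<omega>) = (?S, ?q ?S)" using res cut[OF S'] by (simp add: cut_value_unit)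
    fix T assume T: "T \<in> candidates V E Fs"
    then show "?q ?S \<le> ?q T" using le[of T] cand cut[OF S'] cut[OF T] by (simp add: cut_value_unit)
  qed
qed

section \<open>Success probability and query count\<close>

definition reps :: "nat \<Rightarrow> nat" where
  "reps n = nat \<lceil>1 / success_rate\<rceil> * clog n"

text \<open>
  The minimum degree d is known only after the first round, but the random bits are drawn before it:
  there are independent samples for every possible value of d.
\<close>

definition randomness :: "'a set \<Rightarrow> (nat \<times> nat \<Rightarrow> 'a sample) pmf" where
  "randomness V = Pi_pmf ({..card V} \<times> {..<reps (card V)}) undefined (\<lambda>(d, k). sample_pmf V d)"

lemma success_rate_pos: "0 < success_rate"
  by (simp add: success_rate_def)

lemma success_rate_le_one: "success_rate \<le> 1"
proof -
  have "exp (- 64) \<le> (1::real)" by simp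
  then show ?thesis unfolding success_rate_def by linarith
qed

text \<open>The failure probability is at most exp (- \<open>success_rate\<close> *
  \<open>reps n\<close>), and the number of repetitions makes this at most exp (-
  \<open>clog n\<close>).\<close>

lemma amplified_failure:
  assumes "0 < n"
  shows "(1 - success_rate) ^ reps n \<le> 1 / real n"
proof -
  have "(1 - success_rate) ^ reps n \<le> exp (- success_rate) ^ reps n"
    using exp_ge_add_one_self[of "- success_rate"] success_rate_le_one by (intro power_mono) auto
  also have "\<dots> = exp (- (success_rate * real (reps n)))"
    by (simp add: mult.commute flip: exp_of_nat_mult)
  also have "\<dots> \<le> exp (- real (clog n))"
  proof -
    have "1 / success_rate \<le> real (nat \<lceil>1 / success_rate\<rceil>)" by linarith
    then have "success_rate * (1 / success_rate) \<le> success_rate * real (nat \<lceil>1 / success_rate\<rceil>)"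
      using success_rate_pos by (intro mult_left_mono) auto
    then have "1 \<le> success_rate * real (nat \<lceil>1 / success_rate\<rceil>)" using success_rate_pos by simp
    then have "1 * real (clog n) \<le> success_rate * real (nat \<lceil>1 / success_rate\<rceil>) * real (clog n)"
      by (intro mult_right_mono) auto
    then show ?thesis by (simp add: reps_def mult.assoc)
  qed
  also have "\<dots> = exp (- 1) ^ clog n" by (simp flip: exp_of_nat_mult)
  also have "\<dots> \<le> (1/2) ^ clog n"
    using exp_ge_add_one_self[of 1] by (intro power_mono) (auto simp: exp_minus field_simps)
  also have "\<dots> \<le> 1 / real n"
  proof -
    have "real n \<le> real (2 ^ clog n)" using le_two_power_clog by (simp only: of_nat_le_iff)
    then have "real n \<le> 2 ^ clog n" by simp
    then show ?thesis using assms by (simp add: power_one_over divide_simps)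
  qed
  finally show ?thesis .
qed

text \<open>Only the repetitions drawn for the actual value d count. Failure is a product event with
  no condition on the other coordinates, so independence gives a power.\<close>

lemma prob_some_repetition:
  fixes V :: "'a set"
  assumes "0 < card V" "d \<le> card V" "success_rate \<le> measure_pmf.prob (sample_pmf V d) Good"
  shows "1 - 1 / real (card V) \<le> measure_pmf.prob (randomness V) {\<omega>. \<exists>k<reps (card V). \<omega> (d, k) \<in> Good}"
proof -
  let ?n = "card V" let ?K = "reps ?n"
  let ?I = "{..?n} \<times> {..<?K}"
  define bad :: "nat \<times> nat \<Rightarrow> 'a sample set" where "bad = (\<lambda>(d', k). if d' = d then - Good else UNIV)"
  have "{\<omega>. \<not> (\<exists>k<?K. \<omega> (d, k) \<in> Good)} = Pi ?I bad"
  proof (intro equalityI subsetI)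
    fix \<omega> :: "nat \<times> nat \<Rightarrow> 'a sample" assume "\<omega> \<in> Pi ?I bad"
    then have "\<omega> (d, k) \<in> bad (d, k)" if "k < ?K" for k using that assms(2) by (intro Pi_mem[of \<omega> ?I bad]) auto
    then show "\<omega> \<in> {\<omega>. \<not> (\<exists>k<?K. \<omega> (d, k) \<in> Good)}" by (auto simp: bad_def)
  qed (auto simp: bad_def)
  then have "measure_pmf.prob (randomness V) {\<omega>. \<not> (\<exists>k<?K. \<omega> (d, k) \<in> Good)}
    = (\<Prod>x\<in>?I. measure_pmf.prob (case x of (d, k) \<Rightarrow> sample_pmf V d) (bad x))"
    unfolding randomness_def by (subst measure_Pi_pmf_Pi[symmetric]) auto
  also have "\<dots> = (\<Prod>x\<in>{d} \<times> {..<?K}. measure_pmf.prob (case x of (d, k) \<Rightarrow> sample_pmf V d) (bad x))"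
  proof (rule prod.mono_neutral_right)
    show "\<forall>x\<in>?I - {d} \<times> {..<?K}. measure_pmf.prob (case x of (d, k) \<Rightarrow> sample_pmf V d) (bad x) = 1"
    proof
      fix x assume x: "x \<in> ?I - {d} \<times> {..<?K}"
      obtain d' k where "x = (d', k)" by force
      with x show "measure_pmf.prob (case x of (d, k) \<Rightarrow> sample_pmf V d) (bad x) = 1" by (auto simp: bad_def)
    qed
  qed (use assms(2) in auto)
  also have "\<dots> = (\<Prod>x\<in>{d} \<times> {..<?K}. 1 - measure_pmf.prob (sample_pmf V d) Good)"
    by (intro prod.cong) (auto simp: bad_def Compl_eq_Diff_UNIV measure_pmf.prob_compl[of Good "sample_pmf V d", simplified])
  also have "\<dots> = (1 - measure_pmf.prob (sample_pmf V d) Good) ^ ?K" by (simp add: card_cartesian_product)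
  also have "\<dots> \<le> (1 - success_rate) ^ ?K" using assms(3) by (intro power_mono) auto
  also have "\<dots> \<le> 1 / real ?n" by (rule amplified_failure[OF assms(1)])
  finally show ?thesis
    unfolding prob_Collect_not by linarith
qed

lemma min_degree_le:
  assumes "finite V" "E \<subseteq> pairs V" "v \<in> V"
  shows "min_degree V E \<le> card (boundary E {v})" and "min_degree V E \<le> card V"
proof -
  show 1: "min_degree V E \<le> card (boundary E {v})"
    using assms(1,3) by (auto simp: min_degree_def vertex_degree_boundary intro!: Min_le)
  have "card {u \<in> V. {v, u} \<in> E} \<le> card V" using assms(1) by (intro card_mono) auto
  then show "min_degree V E \<le> card V" using 1 degree_eq_neighbours[OF assms] by linarith
qed

definition optimal_cut :: "'a set \<Rightarrow> 'a set set \<Rightarrow> 'a set \<Rightarrow> bool" where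
  "optimal_cut V E S \<longleftrightarrow> S \<noteq> {} \<and> S \<subset> V \<and> (\<forall>T. T \<noteq> {} \<longrightarrow> T \<subset> V \<longrightarrow> card (boundary E S) \<le> card (boundary E T))"

lemma exists_optimal_cut:
  assumes "2 \<le> card V"
  shows "\<exists>S. optimal_cut V E S"
proof -
  obtain v where v: "v \<in> V" using assms by fastforce
  have "{v} \<noteq> V" using assms by auto
  then have *: "{v} \<noteq> {} \<and> {v} \<subset> V" using v by auto
  define S where "S = arg_min (\<lambda>S. card (boundary E S)) (\<lambda>S. S \<noteq> {} \<and> S \<subset> V)"
  have "S \<noteq> {} \<and> S \<subset> V" unfolding S_def
    by (rule arg_min_natI[where P = "\<lambda>S. S \<noteq> {} \<and> S \<subset> V" and k = "{v}"]) (rule *)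
  moreover have "card (boundary E S) \<le> card (boundary E T)" if "T \<noteq> {} \<and> T \<subset> V" for T
    unfolding S_def
    by (rule arg_min_nat_le[where P = "\<lambda>S. S \<noteq> {} \<and> S \<subset> V"]) (rule that)
  ultimately have "optimal_cut V E S" by (simp add: optimal_cut_def)
  then show ?thesis ..
qed

text \<open>If some vertex is a minimum cut, it is a candidate in every run. Otherwise all degrees
  exceed the minimum cut, which is what \<open>same_side_neighbours\<close> and
  \<open>prob_good_forest\<close> require.\<close>

lemma prob_optimal_candidate:
  fixes V :: "'a set"
  assumes "finite V" "2 \<le> card V" "E \<subseteq> pairs V"
  shows "1 - 1 / real (card V) \<le> measure_pmf.prob (randomness V)
    {\<omega>. \<exists>S\<in>candidates V E (forests V E \<omega> (reps (card V)) (min_degree V E)). optimal_cut V E S}"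
proof -
  let ?K = "reps (card V)" and ?d = "min_degree V E"
  let ?X = "{\<omega>. \<exists>S\<in>candidates V E (forests V E \<omega> ?K ?d). optimal_cut V E S}"
  obtain v0 where v0: "v0 \<in> V" using assms(2) by fastforce
  show ?thesis
  proof (cases "\<exists>v\<in>V. optimal_cut V E {v}")
    case True
    then obtain v where v: "v \<in> V" "optimal_cut V E {v}" by blast
    then have "{v} \<in> candidates V E Fs" for Fs by (auto simp: candidates_def optimal_cut_def)
    then have "?X = UNIV" using v(2) by blast
    then have "measure_pmf.prob (randomness V) ?X = 1" by (simp only: measure_pmf_UNIV)
    then show ?thesis by simp
  next
    case False
    obtain S where S: "optimal_cut V E S" using exists_optimal_cut[OF assms(2)] by blast
    then have S': "S \<noteq> {}" "S \<subset> V" "\<And>T. T \<noteq> {} \<Longrightarrow> T \<subset> V \<Longrightarrow> card (boundary E S) \<le> card (boundary E T)"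
      by (auto simp: optimal_cut_def)
    have larger: "card (boundary E S) < card (boundary E {v})" if v: "v \<in> V" for v
    proof (rule ccontr)
      assume "\<not> card (boundary E S) < card (boundary E {v})"
      then have "card (boundary E {v}) \<le> card (boundary E T)" if "T \<noteq> {}" "T \<subset> V" for T
        using S'(3)[OF that] by linarith
      moreover have "{v} \<noteq> V" using assms(2) by auto
      ultimately have "optimal_cut V E {v}" using v by (auto simp: optimal_cut_def)
      with False v show False by blast
    qed
    have "?d \<in> vertex_degree E ` V" using assms(1) v0 unfolding min_degree_def by (intro Min_in) auto
    then obtain v1 where v1: "v1 \<in> V" "?d = card (boundary E {v1})" by (auto simp: vertex_degree_boundary)
    \<comment> \<open>In particular d > 0: a vertex of degree 0 would itself be a minimum
      cut.\<close>
    have d: "card (boundary E S) < ?d" using larger[OF v1(1)] v1(2) by simp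
    let ?Good = "{w. boundary (forest V E w) S = {} \<and> forest V E w \<subseteq> pairs V \<and> card (inter_edges V E (forest V E w)) \<le> inter_bound (card V)}"
    have "success_rate \<le> measure_pmf.prob (sample_pmf V ?d) ?Good"
    proof (rule prob_good_forest[OF assms])
      show "S \<subseteq> V" using S'(2) by blast
      show "0 < ?d" "card (boundary E S) \<le> ?d" using d by simp_all
      show "?d \<le> 2 * card {u \<in> V. {v, u} \<in> E \<and> (u \<in> S) = (v \<in> S)}" if "v \<in> V" for v
        using same_side_neighbours[OF assms(1,3) S'(2,1) that S'(3) larger[OF that]]
          min_degree_le(1)[OF assms(1,3) that] by linarith
      show "(\<Sum>v\<in>V. card {u \<in> V. {v, u} \<in> E \<and> (u \<in> S) \<noteq> (v \<in> S)}) \<le> 2 * ?d"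
        using sum_crossing_neighbours[OF assms(1,3), of S] d by linarith
    qed
    then have "1 - 1 / real (card V) \<le> measure_pmf.prob (randomness V) {\<omega>. \<exists>k<?K. \<omega> (?d, k) \<in> ?Good}"
      using assms(2) min_degree_le(2)[OF assms(1,3) v0] by (intro prob_some_repetition) auto
    also have "\<dots> \<le> measure_pmf.prob (randomness V) ?X"
    proof (rule prob_mono_support)
      fix \<omega> :: "nat \<times> nat \<Rightarrow> 'a sample"
      assume "\<exists>k<?K. \<omega> (?d, k) \<in> ?Good"
      then obtain k where k: "k < ?K" "boundary (forest V E (\<omega> (?d, k))) S = {}" "forest V E (\<omega> (?d, k)) \<subseteq> pairs V"
        "card (inter_edges V E (forest V E (\<omega> (?d, k)))) \<le> inter_bound (card V)" by blast
      let ?F = "forest V E (\<omega> (?d, k))"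
      have "?F \<in> forests V E \<omega> ?K ?d" using k(1) by (auto simp: forests_def)
      moreover have "sparse_quotient V E ?F"
        using sum_boundary_comps_le[OF assms(1,3), of ?F] k(4) by (simp add: sparse_quotient_def)
      moreover have "\<exists>U\<subseteq>comps V ?F. S = \<Union>U" using Union_comps_closed[OF k(3,2)] S'(2) by blast
      ultimately have "S \<in> candidates V E (forests V E \<omega> ?K ?d)" using S'(1,2) unfolding candidates_def by blast
      then show "\<exists>S\<in>candidates V E (forests V E \<omega> ?K ?d). optimal_cut V E S" using S by blast
    qed
    finally show ?thesis .
  qed
qed

lemma set_randomness:
  assumes "\<omega> \<in> set_pmf (randomness V)" "d \<le> card V" "k < reps (card V)"
  shows "\<omega> (d, k) \<in> set_pmf (sample_pmf V d)"
  using assms unfolding randomness_def by (auto simp: set_Pi_pmf PiE_dflt_def)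

text \<open>154180 = 6720 + 1 + 147459: sketches, blocks and quotient queries of one repetition,
  each in units of l^3 n. The leading 1 is for the first round.\<close>

definition query_constant :: nat where
  "query_constant = 1 + nat \<lceil>1 / success_rate\<rceil> * 154180"

lemma total_query_bound:
  assumes "1 \<le> l" "l = clog n" "1 \<le> n"
  shows "n + reps n * (1680 * l * l * (2 * l + 2) * n) + reps n * (n + quotient_length n) \<le> query_constant * l ^ 4 * n"
proof -
  let ?k = "nat \<lceil>1 / success_rate\<rceil>"
  have r: "reps n = ?k * l" by (simp add: reps_def assms(2))
  have l3: "l * l \<le> l ^ 3" "1 \<le> l ^ 3" "1 \<le> l ^ 4"
    using assms(1) by (auto simp: power3_eq_cube)
  have a: "1680 * l * l * (2 * l + 2) * n \<le> 6720 * l ^ 3 * n"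
  proof -
    have "1680 * l * l * (2 * l + 2) * n \<le> 1680 * l * l * (4 * l) * n"
      using assms(1) by (intro mult_right_mono mult_left_mono) auto
    then show ?thesis by (simp add: power3_eq_cube mult_ac)
  qed
  have b: "quotient_length n \<le> 147459 * l ^ 3 * n"
  proof -
    have "quotient_length n = 49152 * (2 * l + 1) * l * n + 3"
      by (simp add: quotient_length_def inter_bound_def assms(2) algebra_simps)
    also have "\<dots> \<le> 49152 * (3 * l) * l * n + 3 * (l ^ 3 * n)"
    proof (rule add_mono)
      show "49152 * (2 * l + 1) * l * n \<le> 49152 * (3 * l) * l * n"
        using assms(1) by (intro mult_right_mono mult_left_mono) auto
      have "1 * 1 \<le> l ^ 3 * n" using l3(2) assms(3) by (rule mult_le_mono)
      then show "3 \<le> 3 * (l ^ 3 * n)" by simp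
    qed
    also have "\<dots> = 147456 * (l * l) * n + 3 * (l ^ 3 * n)" by simp
    also have "\<dots> \<le> 147456 * (l ^ 3) * n + 3 * (l ^ 3 * n)"
      using l3(1) by (intro add_mono mult_right_mono mult_left_mono) auto
    finally show ?thesis by (simp add: mult_ac)
  qed
  have c: "n \<le> l ^ 3 * n" "n \<le> l ^ 4 * n" using l3 by auto
  have "n + reps n * (1680 * l * l * (2 * l + 2) * n) + reps n * (n + quotient_length n)
    = n + ?k * l * (1680 * l * l * (2 * l + 2) * n + (n + quotient_length n))"
    unfolding r by (simp add: distrib_left)
  also have "\<dots> \<le> l ^ 4 * n + ?k * l * (6720 * l ^ 3 * n + (l ^ 3 * n + 147459 * l ^ 3 * n))"
    by (rule add_mono[OF c(2) mult_left_mono[OF add_mono[OF a add_mono[OF c(1) b]]]]) simp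
  also have "\<dots> = query_constant * l ^ 4 * n"
    by (simp add: query_constant_def algebra_simps power4_eq_xxxx power3_eq_cube)
  finally show ?thesis .
qed

text \<open>These bounds hold for every outcome of the random bits, including runs that miss the
  minimum cut.\<close>

lemma algorithm_queries:
  assumes "simple_graph V E" "2 \<le> card V" "\<omega> \<in> set_pmf (randomness V)"
  defines "a \<equiv> algorithm V (reps (card V)) \<omega>"
  shows "queries (cut_value E unit_weight) a \<subseteq> Pow V"
    and "num_rounds (cut_value E unit_weight) a = 3"
    and "num_queries (cut_value E unit_weight) a \<le> query_constant * clog (card V) ^ 4 * card V"
    and "k < reps (card V) \<Longrightarrow> finite (sketch_queries V (\<omega> (min_degree V E, k)))"
proof -
  let ?n = "card V" let ?K = "reps ?n" and ?d = "min_degree V E" and ?l = "clog ?n"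
  let ?Fs = "forests V E \<omega> ?K ?d"
  have V: "finite V" and E: "E \<subseteq> pairs V" using assms(1) by (simp_all add: simple_graph_iff)
  obtain v0 where v0: "v0 \<in> V" using assms(2) by fastforce
  have d: "?d \<le> ?n" by (rule min_degree_le(2)[OF V E v0])
  have sk: "finite (sketch_queries V (\<omega> (?d, k))) \<and> card (sketch_queries V (\<omega> (?d, k))) \<le> 1680 * ?l * ?l * (2 * ?l + 2) * ?n"
    if "k < ?K" for k
    by (rule card_sketch_queries[OF V set_randomness[OF assms(3) d that] refl])
  then show "k < ?K \<Longrightarrow> finite (sketch_queries V (\<omega> (?d, k)))" by blast
  have rounds: "rounds (cut_value E unit_weight) a =
      [enum ((\<lambda>v. {v}) ` V), query_round V \<omega> ?K ?d, enum (\<Union>F\<in>?Fs. block_queries V F)]"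
    unfolding a_def by (rule algorithm_run(1)[OF assms(1,2)]) (use sk in blast)
  show "num_rounds (cut_value E unit_weight) a = 3" by (simp add: num_rounds_def rounds)
  have q1: "set (enum ((\<lambda>v. {v}) ` V)) = (\<lambda>v. {v}) ` V" "length (enum ((\<lambda>v. {v}) ` V)) = ?n"
    using enum[of "(\<lambda>v. {v}) ` V"] V by (auto simp: card_image)
  have U2: "finite (\<Union>k<?K. sketch_queries V (\<omega> (?d, k))) \<and>
      card (\<Union>k<?K. sketch_queries V (\<omega> (?d, k))) \<le> ?K * (1680 * ?l * ?l * (2 * ?l + 2) * ?n)"
    using sk by (intro card_UN_le_mult) auto
  note e2 = enum[OF conjunct1[OF U2]]
  have q2: "set (query_round V \<omega> ?K ?d) = (\<Union>k<?K. sketch_queries V (\<omega> (?d, k)))"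
    "length (query_round V \<omega> ?K ?d) \<le> ?K * (1680 * ?l * ?l * (2 * ?l + 2) * ?n)"
    unfolding query_round_def conjunct1[OF e2] conjunct2[OF e2] using U2 by blast+
  have Fs: "finite ?Fs" "card ?Fs \<le> ?K" using card_image_le[of "{..<?K}"] by (auto simp: forests_def)
  have U3: "finite (\<Union>F\<in>?Fs. block_queries V F) \<and> card (\<Union>F\<in>?Fs. block_queries V F) \<le> ?K * (?n + quotient_length ?n)"
    using Fs block_queries(2)[OF V] by (intro card_UN_le_mult) auto
  note e3 = enum[OF conjunct1[OF U3]]
  have q3: "set (enum (\<Union>F\<in>?Fs. block_queries V F)) = (\<Union>F\<in>?Fs. block_queries V F)"
    "length (enum (\<Union>F\<in>?Fs. block_queries V F)) \<le> ?K * (?n + quotient_length ?n)"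
    unfolding conjunct1[OF e3] conjunct2[OF e3] using U3 by blast+
  have "(\<lambda>v. {v}) ` V \<subseteq> Pow V" by auto
  moreover have "(\<Union>k<?K. sketch_queries V (\<omega> (?d, k))) \<subseteq> Pow V" by (intro UN_least sketch_queries_subset)
  moreover have "(\<Union>F\<in>?Fs. block_queries V F) \<subseteq> Pow V" by (intro UN_least block_queries(1)[OF V])
  ultimately show "queries (cut_value E unit_weight) a \<subseteq> Pow V"
    by (simp only: queries_def rounds concat.simps set_append q1(1) q2(1) q3(1) append_Nil2 Un_subset_iff simp_thms list.set Un_empty_right)
  have "num_queries (cut_value E unit_weight) a \<le> ?n + ?K * (1680 * ?l * ?l * (2 * ?l + 2) * ?n) + ?K * (?n + quotient_length ?n)"
    unfolding num_queries_def rounds using q1(2) q2(2) q3(2) by simp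
  also have "\<dots> \<le> query_constant * ?l ^ 4 * ?n"
    using assms(2) clog_ge_one[OF assms(2)] by (intro total_query_bound) auto
  finally show "num_queries (cut_value E unit_weight) a \<le> query_constant * clog (card V) ^ 4 * card V" .
qed

text \<open>The right-hand side is r n (n / d)^(1/r).\<close>

lemma le_powr_degree:
  assumes "1 \<le> (n :: nat)" "0 < d" "d \<le> n" "1 \<le> r"
  shows "real n \<le> real r * real n powr (1 + 1 / real r) * real d powr (- 1 / real r)"
proof -
  have "1 \<le> (real n / real d) powr (1 / real r)"
    using assms by (intro ge_one_powr_ge_zero) auto
  also have "\<dots> = real n powr (1 / real r) * real d powr (- 1 / real r)"
    using assms by (simp add: powr_divide powr_minus_divide)
  finally have "real n * 1 \<le> real n * (real n powr (1 / real r) * real d powr (- 1 / real r))"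
    by (intro mult_left_mono) auto
  also have "\<dots> = real n powr (1 + 1 / real r) * real d powr (- 1 / real r)"
    using assms by (simp add: powr_add)
  also have "\<dots> \<le> real r * (real n powr (1 + 1 / real r) * real d powr (- 1 / real r))"
    using assms(4) mult_right_mono[of 1 "real r" "real n powr (1 + 1 / real r) * real d powr (- 1 / real r)"] by simp
  finally show ?thesis by (simp add: mult.assoc)
qed

(* The query bound is claimed for positive minimum degree only, since
   min_degree powr (- 1 / r) is infinite on paper, but 0 in HOL, for minimum degree 0. *)
theorem mainTheorem2:
  "\<exists>(C :: real) (k :: nat) (A :: nat set \<Rightarrow> nat \<Rightarrow> (nat, nat set \<times> real) randomized_algorithm).
     C > 0 \<and>
     (\<forall>V n r. finite V \<and> card V = n \<and> n \<ge> 2 \<and> 1 \<le> r \<and> real r \<le> log 2 (real n) \<longrightarrow>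
       (\<forall>E. simple_graph V E \<longrightarrow>
         measure_pmf.prob (A V r)
             {a. is_min_cut V E unit_weight (result (cut_value E unit_weight) a)} \<ge> 1 - 1 / real n \<and>
         (\<forall>a \<in> set_pmf (A V r).
            queries (cut_value E unit_weight) a \<subseteq> Pow V \<and>
            num_rounds (cut_value E unit_weight) a \<le> 2 * r + 1 \<and>
            (min_degree V E > 0 \<longrightarrow>
              real (num_queries (cut_value E unit_weight) a)
                \<le> C * log 2 (real n) ^ k *
                  (real r * real n powr (1 + 1 / real r)
                     * real (min_degree V E) powr (- 1 / real r))))))"
proof -
  \<comment> \<open>16 = 2^4, because \<open>clog n\<close> is at most 2 log n and enters with the
    fourth power.\<close>
  define C where "C = 16 * real query_constant"
  define A :: "nat set \<Rightarrow> nat \<Rightarrow> (nat, nat set \<times> real) randomized_algorithm"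
    where "A V r = map_pmf (algorithm V (reps (card V))) (randomness V)" for V r
  have main: "1 - 1 / real (card V) \<le> measure_pmf.prob (A V r) {a. is_min_cut V E unit_weight (result (cut_value E unit_weight) a)} \<and>
      (\<forall>a \<in> set_pmf (A V r).
            queries (cut_value E unit_weight) a \<subseteq> Pow V \<and>
            num_rounds (cut_value E unit_weight) a \<le> 2 * r + 1 \<and>
            (min_degree V E > 0 \<longrightarrow>
              real (num_queries (cut_value E unit_weight) a)
                \<le> C * log 2 (real (card V)) ^ 4 *
                  (real r * real (card V) powr (1 + 1 / real r)
                     * real (min_degree V E) powr (- 1 / real r))))"
    if n: "2 \<le> card V" and r: "1 \<le> r" and E: "simple_graph V E" for V r E
  proof (intro conjI ballI impI)
    let ?K = "reps (card V)" and ?d = "min_degree V E"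
    have V: "finite V" and EV: "E \<subseteq> pairs V" using E by (simp_all add: simple_graph_iff)
    have "1 - 1 / real (card V) \<le> measure_pmf.prob (randomness V)
      {\<omega>. \<exists>S\<in>candidates V E (forests V E \<omega> ?K ?d). optimal_cut V E S}"
      by (rule prob_optimal_candidate[OF V n EV])
    also have "\<dots> \<le> measure_pmf.prob (randomness V)
      {\<omega>. is_min_cut V E unit_weight (result (cut_value E unit_weight) (algorithm V ?K \<omega>))}"
    proof (rule prob_mono_support)
      fix \<omega> assume \<omega>: "\<omega> \<in> set_pmf (randomness V)"
      assume "\<exists>S\<in>candidates V E (forests V E \<omega> ?K ?d). optimal_cut V E S"
      then obtain S where S: "S \<in> candidates V E (forests V E \<omega> ?K ?d)" "optimal_cut V E S" by blast
      obtain S' where S': "S' \<in> candidates V E (forests V E \<omega> ?K ?d)"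
        "result (cut_value E unit_weight) (algorithm V ?K \<omega>) = (S', cut_value E unit_weight S')"
        "\<forall>T \<in> candidates V E (forests V E \<omega> ?K ?d). cut_value E unit_weight S' \<le> cut_value E unit_weight T"
        using algorithm_run(2)[OF E n, of ?K \<omega>] algorithm_queries(4)[OF E n \<omega>] by blast
      have "cut_value E unit_weight S' \<le> cut_value E unit_weight T" if "T \<noteq> {}" "T \<subset> V" for T
      proof -
        have "cut_value E unit_weight S \<le> cut_value E unit_weight T"
          using S(2) that by (simp add: optimal_cut_def cut_value_unit)
        then show ?thesis using S'(3) S(1) by (meson order_trans)
      qed
      moreover have "S' \<noteq> {}" "S' \<subset> V" using S'(1) by (auto simp: candidates_def)
      ultimately show "is_min_cut V E unit_weight (result (cut_value E unit_weight) (algorithm V ?K \<omega>))"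
        unfolding S'(2) is_min_cut_def by simp
    qed
    also have "\<dots> = measure_pmf.prob (A V r) {a. is_min_cut V E unit_weight (result (cut_value E unit_weight) a)}"
      by (simp add: A_def vimage_def)
    finally show "1 - 1 / real (card V) \<le> measure_pmf.prob (A V r) {a. is_min_cut V E unit_weight (result (cut_value E unit_weight) a)}" .
    fix a assume "a \<in> set_pmf (A V r)"
    then obtain \<omega> where \<omega>: "\<omega> \<in> set_pmf (randomness V)" and a: "a = algorithm V ?K \<omega>" by (auto simp: A_def)
    show "queries (cut_value E unit_weight) a \<subseteq> Pow V" unfolding a by (rule algorithm_queries(1)[OF E n \<omega>])
    \<comment> \<open>Three rounds are allowed already for r = 1.\<close>
    show "num_rounds (cut_value E unit_weight) a \<le> 2 * r + 1"
      using algorithm_queries(2)[OF E n \<omega>] r by (simp add: a)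
    assume d: "0 < ?d"
    obtain v0 where v0: "v0 \<in> V" using n by fastforce
    have "real (num_queries (cut_value E unit_weight) a) \<le> real (query_constant * clog (card V) ^ 4 * card V)"
      using algorithm_queries(3)[OF E n \<omega>] unfolding a by (simp only: of_nat_le_iff)
    also have "\<dots> = real query_constant * real (clog (card V)) ^ 4 * real (card V)" by simp
    also have "\<dots> \<le> real query_constant * (2 * log 2 (real (card V))) ^ 4 * real (card V)"
      using clog_le[OF n] by (intro mult_right_mono mult_left_mono power_mono) auto
    also have "\<dots> = C * log 2 (real (card V)) ^ 4 * real (card V)"
      by (simp add: C_def power_mult_distrib)
    also have "\<dots> \<le> C * log 2 (real (card V)) ^ 4 *
                  (real r * real (card V) powr (1 + 1 / real r) * real ?d powr (- 1 / real r))"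
      using n r d min_degree_le(2)[OF V EV v0] log_two_ge_one[OF n]
      by (intro mult_left_mono le_powr_degree) (auto simp: C_def)
    finally show "real (num_queries (cut_value E unit_weight) a) \<le> C * log 2 (real (card V)) ^ 4 *
                  (real r * real (card V) powr (1 + 1 / real r) * real ?d powr (- 1 / real r))" .
  qed
  have "C > 0" by (simp add: C_def query_constant_def)
  then show ?thesis using main by (intro exI[of _ C] exI[of _ 4] exI[of _ A]) blast
qed

end
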